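(* Let $t<T$, and let $\{\phi_j\}_{j=0}^{\infty}$ be either the complete orthonormal system of Legendre polynomials or the complete orthonormal trigonometric system in $L_2([t,T])$. Let $\psi_2:[t,T]\to\mathbb{R}$ be continuously differentiable and $\psi_1:[t,T]\to\mathbb{R}$ be twice continuously differentiable (nonrandom). Let $i_1,i_2\in\{0,1,\ldots,m\}$. Then the iterated Stratonovich stochastic integral $$J^{*}[\psi^{(2)}]_{T,t}=\int_t^{*T}\psi_2(t_2)\int_t^{*t_2}\psi_1(t_1)\,d\mathbf{w}^{(i_1)}_{t_1}\,d\mathbf{w}^{(i_2)}_{t_2}$$ admits the expansion, converging in the mean-square sense, $$J^{*}[\psi^{(2)}]_{T,t}=\operatorname*{l.i.m.}_{p_1,p_2\to\infty}\sum_{j_1=0}^{p_1}\sum_{j_2=0}^{p_2}C_{j_2j_1}\,\zeta^{(i_1)}_{j_1}\zeta^{(i_2)}_{j_2},$$ where $p_1,p_2$ tend to infinity independently, $$C_{j_2j_1}=\int_t^T\psi_2(s_2)\phi_{j_2}(s_2)\int_t^{s_2}\psi_1(s_1)\phi_{j_1}(s_1)\,ds_1\,ds_2,\qquad \zeta^{(i)}_j=\int_t^T\phi_j(s)\,d\mathbf{w}^{(i)}_s .$$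
   Context: $(\Omega,\mathrm{F},\mathsf{P})$ is a complete probability space with a nondecreasing right-continuous filtration $\{\mathrm{F}_s\}$, and $\mathbf{f}_s=(\mathbf{f}^{(1)}_s,\ldots,\mathbf{f}^{(m)}_s)$ is a standard $m$-dimensional Wiener process adapted to it with independent components. Set $\mathbf{w}^{(i)}_s=\mathbf{f}^{(i)}_s$ for $i=1,\ldots,m$ and $\mathbf{w}^{(0)}_s=s$ (so integration against $d\mathbf{w}^{(0)}$ is ordinary Lebesgue integration). $\int^{*}$ denotes the Stratonovich stochastic integral, and $\operatorname{l.i.m.}$ denotes the limit in the mean-square sense. For $i\neq 0$, the $\zeta^{(i)}_j$ are independent standard Gaussian random variables for distinct $i$ or $j$. The Legendre system on $[t,T]$ is $\phi_j(x)=\sqrt{\frac{2j+1}{T-t}}\,P_j\!\left(\left(x-\frac{T+t}{2}\right)\frac{2}{T-t}\right)$, $j\ge0$, with $P_j$ the Legendre polynomial of degree $j$; the trigonometric system is $\phi_0(x)=\frac{1}{\sqrt{T-t}}$, $\phi_{2r-1}(x)=\sqrt{\frac{2}{T-t}}\sin\frac{2\pi r(x-t)}{T-t}$, $\phi_{2r}(x)=\sqrt{\frac{2}{T-t}}\cos\frac{2\pi r(x-t)}{T-t}$, $r\ge1$. *)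

theory Defs
  imports "HOL-Probability.Probability"
begin

fun legendreP :: "nat \<Rightarrow> real \<Rightarrow> real" where
  "legendreP 0 x = 1"
| "legendreP (Suc 0) x = x"
| "legendreP (Suc (Suc n)) x =
     ((2 * real n + 3) * x * legendreP (Suc n) x - (real n + 1) * legendreP n x) / (real n + 2)"

definition phi_legendre :: "real \<Rightarrow> real \<Rightarrow> nat \<Rightarrow> real \<Rightarrow> real" where
  "phi_legendre t T j x =
     sqrt ((2 * real j + 1) / (T - t)) * legendreP j ((x - (T + t) / 2) * (2 / (T - t)))"

definition phi_trig :: "real \<Rightarrow> real \<Rightarrow> nat \<Rightarrow> real \<Rightarrow> real" where
  "phi_trig t T j x =
     (if j = 0 then 1 / sqrt (T - t)
      else if odd j then sqrt (2 / (T - t)) * sin (2 * pi * real ((j + 1) div 2) * (x - t) / (T - t))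
      else sqrt (2 / (T - t)) * cos (2 * pi * real (j div 2) * (x - t) / (T - t)))"

definition C1_on :: "real set \<Rightarrow> (real \<Rightarrow> real) \<Rightarrow> bool" where
  "C1_on S g \<longleftrightarrow> (\<exists>g'. continuous_on S g' \<and>
     (\<forall>x\<in>S. (g has_real_derivative g' x) (at x within S)))"

definition C2_on :: "real set \<Rightarrow> (real \<Rightarrow> real) \<Rightarrow> bool" where
  "C2_on S g \<longleftrightarrow> (\<exists>g' g''. continuous_on S g'' \<and>
     (\<forall>x\<in>S. (g has_real_derivative g' x) (at x within S)) \<and>
     (\<forall>x\<in>S. (g' has_real_derivative g'' x) (at x within S)))"

definition complete_prob_space :: "'a measure \<Rightarrow> bool" where
  "complete_prob_space M \<longleftrightarrow> prob_space M \<and>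
     (\<forall>A B. B \<in> null_sets M \<and> A \<subseteq> B \<longrightarrow> A \<in> sets M)"

definition rc_filtration :: "'a measure \<Rightarrow> (real \<Rightarrow> 'a set set) \<Rightarrow> bool" where
  "rc_filtration M F \<longleftrightarrow>
     (\<forall>s. sigma_algebra (space M) (F s) \<and> F s \<subseteq> sets M) \<and>
     (\<forall>r s. r \<le> s \<longrightarrow> F r \<subseteq> F s) \<and>
     (\<forall>s. F s = (\<Inter>u\<in>{s<..}. F u))"

definition wiener_process :: "'a measure \<Rightarrow> (real \<Rightarrow> 'a set set) \<Rightarrow> (real \<Rightarrow> 'a \<Rightarrow> real) \<Rightarrow> bool" where
  "wiener_process M F W \<longleftrightarrow>
     (\<forall>\<omega>\<in>space M. W 0 \<omega> = 0) \<and>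
     (\<forall>\<omega>\<in>space M. continuous_on {0..} (\<lambda>s. W s \<omega>)) \<and>
     (\<forall>s\<ge>0. W s \<in> measurable (sigma (space M) (F s)) borel) \<and>
     (\<forall>s u. 0 \<le> s \<and> s < u \<longrightarrow>
        distributed M lborel (\<lambda>\<omega>. W u \<omega> - W s \<omega>)
          (\<lambda>x. ennreal (normal_density 0 (sqrt (u - s)) x)) \<and>
        prob_space.indep_set M (F s) {(\<lambda>\<omega>. W u \<omega> - W s \<omega>) -` A \<inter> space M | A. A \<in> sets borel})"

definition wiener_process_m ::
  "'a measure \<Rightarrow> (real \<Rightarrow> 'a set set) \<Rightarrow> nat \<Rightarrow> (nat \<Rightarrow> real \<Rightarrow> 'a \<Rightarrow> real) \<Rightarrow> bool" where
  "wiener_process_m M F m f \<longleftrightarrow>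
     (\<forall>i\<in>{1..m}. wiener_process M F (f i)) \<and>
     prob_space.indep_vars M (\<lambda>i. Pi\<^sub>M UNIV (\<lambda>_. borel)) (\<lambda>i \<omega>. \<lambda>s. f i s \<omega>) {1..m}"

definition wproc :: "(nat \<Rightarrow> real \<Rightarrow> 'a \<Rightarrow> real) \<Rightarrow> nat \<Rightarrow> real \<Rightarrow> 'a \<Rightarrow> real" where
  "wproc f i s \<omega> = (if i = 0 then s else f i s \<omega>)"

definition is_partition :: "real \<Rightarrow> real \<Rightarrow> nat \<Rightarrow> (nat \<Rightarrow> real) \<Rightarrow> bool" where
  "is_partition a b n \<tau> \<longleftrightarrow> \<tau> 0 = a \<and> \<tau> n = b \<and> (\<forall>k<n. \<tau> k < \<tau> (Suc k))"

definition ms_limit_mesh ::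
  "'a measure \<Rightarrow> real \<Rightarrow> real \<Rightarrow> (nat \<Rightarrow> (nat \<Rightarrow> real) \<Rightarrow> 'a \<Rightarrow> real) \<Rightarrow> ('a \<Rightarrow> real) \<Rightarrow> bool" where
  "ms_limit_mesh M a b S X \<longleftrightarrow>
     X \<in> borel_measurable M \<and> integrable M (\<lambda>\<omega>. (X \<omega>)\<^sup>2) \<and>
     (\<forall>\<epsilon>>0. \<exists>\<delta>>0. \<forall>n \<tau>. is_partition a b n \<tau> \<and> (\<forall>k<n. \<tau> (Suc k) - \<tau> k < \<delta>) \<longrightarrow>
        S n \<tau> \<in> borel_measurable M \<and>
        integrable M (\<lambda>\<omega>. (S n \<tau> \<omega> - X \<omega>)\<^sup>2) \<and>
        (\<integral>\<omega>. (S n \<tau> \<omega> - X \<omega>)\<^sup>2 \<partial>M) < \<epsilon>)"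

definition ms_tendsto :: "'a measure \<Rightarrow> ('b \<Rightarrow> 'a \<Rightarrow> real) \<Rightarrow> ('a \<Rightarrow> real) \<Rightarrow> 'b filter \<Rightarrow> bool" where
  "ms_tendsto M S X F \<longleftrightarrow>
     X \<in> borel_measurable M \<and> integrable M (\<lambda>\<omega>. (X \<omega>)\<^sup>2) \<and>
     (\<forall>\<^sub>F n in F. S n \<in> borel_measurable M \<and> integrable M (\<lambda>\<omega>. (S n \<omega>)\<^sup>2)) \<and>
     ((\<lambda>n. \<integral>\<omega>. (S n \<omega> - X \<omega>)\<^sup>2 \<partial>M) \<longlongrightarrow> 0) F"

definition ito_integral ::
  "'a measure \<Rightarrow> (real \<Rightarrow> 'a \<Rightarrow> real) \<Rightarrow> (real \<Rightarrow> real) \<Rightarrow> real \<Rightarrow> real \<Rightarrow> ('a \<Rightarrow> real) \<Rightarrow> bool" where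
  "ito_integral M w g a b X \<longleftrightarrow>
     ms_limit_mesh M a b
       (\<lambda>n \<tau> \<omega>. \<Sum>k<n. g (\<tau> k) * (w (\<tau> (Suc k)) \<omega> - w (\<tau> k) \<omega>)) X"

definition strat_integral ::
  "'a measure \<Rightarrow> (real \<Rightarrow> 'a \<Rightarrow> real) \<Rightarrow> (real \<Rightarrow> 'a \<Rightarrow> real) \<Rightarrow> real \<Rightarrow> real \<Rightarrow> ('a \<Rightarrow> real) \<Rightarrow> bool" where
  "strat_integral M w Y a b X \<longleftrightarrow>
     ms_limit_mesh M a b
       (\<lambda>n \<tau> \<omega>. \<Sum>k<n. (Y (\<tau> k) \<omega> + Y (\<tau> (Suc k)) \<omega>) / 2 * (w (\<tau> (Suc k)) \<omega> - w (\<tau> k) \<omega>)) X"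

definition inner_strat ::
  "'a measure \<Rightarrow> (real \<Rightarrow> 'a \<Rightarrow> real) \<Rightarrow> (real \<Rightarrow> real) \<Rightarrow> real \<Rightarrow> real \<Rightarrow> (real \<Rightarrow> 'a \<Rightarrow> real) \<Rightarrow> bool" where
  "inner_strat M w \<psi> t T \<eta> \<longleftrightarrow>
     (\<forall>s\<in>{t..T}. strat_integral M w (\<lambda>u \<omega>. \<psi> u) t s (\<eta> s))"

definition iter_strat2 ::
  "'a measure \<Rightarrow> (real \<Rightarrow> 'a \<Rightarrow> real) \<Rightarrow> (real \<Rightarrow> 'a \<Rightarrow> real) \<Rightarrow> (real \<Rightarrow> real) \<Rightarrow> (real \<Rightarrow> real)
     \<Rightarrow> real \<Rightarrow> real \<Rightarrow> (real \<Rightarrow> 'a \<Rightarrow> real) \<Rightarrow> ('a \<Rightarrow> real) \<Rightarrow> bool" where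
  "iter_strat2 M w1 w2 \<psi>1 \<psi>2 t T \<eta> J \<longleftrightarrow>
     inner_strat M w1 \<psi>1 t T \<eta> \<and>
     strat_integral M w2 (\<lambda>s \<omega>. \<psi>2 s * \<eta> s \<omega>) t T J"

definition coefC :: "(real \<Rightarrow> real) \<Rightarrow> (real \<Rightarrow> real) \<Rightarrow> (nat \<Rightarrow> real \<Rightarrow> real) \<Rightarrow> real \<Rightarrow> real \<Rightarrow> nat \<Rightarrow> nat \<Rightarrow> real" where
  "coefC \<psi>1 \<psi>2 \<phi> t T j2 j1 =
     integral {t..T} (\<lambda>s2. \<psi>2 s2 * \<phi> j2 s2 * integral {t..s2} (\<lambda>s1. \<psi>1 s1 * \<phi> j1 s1))"

end

theory Submission
  imports Defs
begin

text \<open>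
Write a finite sum of products of Wiener integrals as \<open>D K = (\<Sum>j. I1 (a j) * I2 (b j))\<close> with
\<open>K (x, y) = (\<Sum>j. a j x * b j y)\<close>. Isserlis' formula gives
\<open>E (D K)\<^sup>2 \<le> c \<parallel>K\<parallel>\<^sup>2 + (tr K)\<^sup>2\<close> in \<open>L\<^sub>2([t,T]\<^sup>2)\<close>, where the trace term is present only for
\<open>i1 = i2 \<noteq> 0\<close>. Both the trapezoidal sums defining the Stratonovich integral and the partial sums of the
expansion have this form. Their kernels converge in \<open>L\<^sub>2\<close> to \<open>\<psi>1 x \<psi>2 y 1(x < y)\<close>, and both traces tend to
\<open>\<integral> \<psi>1 \<psi>2 / 2\<close>, so their difference tends to 0 in mean square.

For the trace of the expansion, \<open>\<Sum>j. C j j\<close>, one may assume \<open>\<psi>2 > 0\<close> because \<open>C\<close> is linear in \<open>\<psi>2\<close>. With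
\<open>r = \<psi>1 / \<psi>2\<close> and \<open>c j u = \<integral>\<^sub>u\<^sup>T \<psi>2 \<phi> j\<close>, integration by parts gives
\<open>2 C j j = r t (c j t)\<^sup>2 + \<integral> r' u (c j u)\<^sup>2 du\<close>, and Parseval's identity applies to \<open>\<Sum>j. (c j u)\<^sup>2\<close>.
\<close>

section \<open>Square-integrable functions\<close>

text \<open>The obstacle is the diagonal. It is a null set of the square, so convergence of kernels
  in \<open>L2\<close> says nothing about traces, and each trace needs a limit of its own. Along
  meshes the factor 1/2 comes from the diagonal cells, where only the right endpoint of the
  trapezoid reaches the integration point; for a basis it comes from the symmetric form of
  \<open>C j j\<close>.

  The moment bound is applied to the difference of a mesh sum and a partial sum, taken as one form.
  It therefore presupposes no limit: it shows that the mesh sums are Cauchy, and the existence of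
  the Stratonovich integral falls out of the comparison with the expansion.

  The constant \<open>c\<close> is \<open>2 + (T - t) + (T - t)^2\<close>: two traceless pairings
  when both integrators are the same Wiener component, and one factor \<open>T - t\<close> for each
  integrator that is time. For sums over one component, the identity
  \<open>E Z^4 = 3 (E Z^2)^2\<close> on step integrals, polarised, stands in for joint Gaussianity.

  Integrals are given as relations between integrands and random variables, so every version has to
  be covered; closing the step pairs under \<open>L2\<close> limits achieves this.\<close>

definition l2 :: "'a measure \<Rightarrow> ('a \<Rightarrow> real) \<Rightarrow> bool" where
  "l2 M X \<longleftrightarrow> X \<in> borel_measurable M \<and> integrable M (\<lambda>x. (X x)\<^sup>2)"

lemma l2_measurable: "l2 M X \<Longrightarrow> X \<in> borel_measurable M"
  by (simp add: l2_def)

lemma l2_square: "l2 M X \<Longrightarrow> integrable M (\<lambda>x. (X x)\<^sup>2)"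
  by (simp add: l2_def)

lemma l2_mult:
  assumes "l2 M X" "l2 M Y"
  shows "integrable M (\<lambda>x. X x * Y x)"
proof (rule Bochner_Integration.integrable_bound)
  show "integrable M (\<lambda>x. (X x)\<^sup>2 + (Y x)\<^sup>2)"
    using assms by (auto simp: l2_def)
  show "(\<lambda>x. X x * Y x) \<in> borel_measurable M"
    using assms by (auto simp: l2_def)
  show "AE x in M. norm (X x * Y x) \<le> norm ((X x)\<^sup>2 + (Y x)\<^sup>2)"
  proof (rule AE_I2)
    fix x
    have "2 * \<bar>X x\<bar> * \<bar>Y x\<bar> \<le> \<bar>X x\<bar>\<^sup>2 + \<bar>Y x\<bar>\<^sup>2"
      by (rule sum_squares_bound)
    moreover have "0 \<le> \<bar>X x\<bar> * \<bar>Y x\<bar>" by simp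
    ultimately have "\<bar>X x\<bar> * \<bar>Y x\<bar> \<le> (X x)\<^sup>2 + (Y x)\<^sup>2"
      unfolding power2_abs by linarith
    then show "norm (X x * Y x) \<le> norm ((X x)\<^sup>2 + (Y x)\<^sup>2)"
      by (simp add: abs_mult)
  qed
qed

lemma l2_zero [simp]: "l2 M (\<lambda>x. 0)"
  by (simp add: l2_def)

lemma l2_add:
  assumes "l2 M X" "l2 M Y"
  shows "l2 M (\<lambda>x. X x + Y x)"
  using assms l2_mult[OF assms] by (auto simp: l2_def power2_sum mult.assoc)

lemma l2_scale: "l2 M X \<Longrightarrow> l2 M (\<lambda>x. c * X x)"
  by (auto simp: l2_def power_mult_distrib)

lemma l2_diff:
  assumes "l2 M X" "l2 M Y"
  shows "l2 M (\<lambda>x. X x - Y x)"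
  using l2_add[OF assms(1) l2_scale[OF assms(2), of "-1"]] by simp

lemma l2_sum:
  assumes "\<And>i. i \<in> I \<Longrightarrow> l2 M (X i)"
  shows "l2 M (\<lambda>x. \<Sum>i\<in>I. X i x)"
  using assms by (induction I rule: infinite_finite_induct) (auto intro: l2_add)

lemma (in finite_measure) l2_const: "l2 M (\<lambda>x. c)"
  by (simp add: l2_def)

lemma (in finite_measure) l2_integrable: "l2 M X \<Longrightarrow> integrable M X"
  using l2_mult[OF _ l2_const[of 1]] by simp

lemma (in finite_measure) l2_bounded:
  assumes "X \<in> borel_measurable M" "\<And>x. x \<in> space M \<Longrightarrow> \<bar>X x\<bar> \<le> B"
  shows "l2 M X"
  unfolding l2_def
proof (intro conjI assms(1) integrable_const_bound[of _ "B\<^sup>2"] AE_I2)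
  show "(\<lambda>x. (X x)\<^sup>2) \<in> borel_measurable M" using assms(1) by simp
  show "norm ((X x)\<^sup>2) \<le> B\<^sup>2" if "x \<in> space M" for x
    using assms(2)[OF that] power_mono[of "\<bar>X x\<bar>" B 2] by simp
qed

lemma integral_cauchy_schwarz:
  assumes "l2 M X" "l2 M Y"
  shows "(\<integral>x. \<bar>X x * Y x\<bar> \<partial>M) \<le> sqrt (\<integral>x. (X x)\<^sup>2 \<partial>M) * sqrt (\<integral>x. (Y x)\<^sup>2 \<partial>M)"
proof -
  have m: "X \<in> borel_measurable M" "Y \<in> borel_measurable M"
    using assms by (auto simp: l2_def)
  note i = l2_mult[OF assms] assms[THEN l2_square]
  have "(\<integral>\<^sup>+x. ennreal \<bar>X x\<bar> * ennreal \<bar>Y x\<bar> \<partial>M)\<^sup>2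
      \<le> (\<integral>\<^sup>+x. (ennreal \<bar>X x\<bar>)\<^sup>2 \<partial>M) * (\<integral>\<^sup>+x. (ennreal \<bar>Y x\<bar>)\<^sup>2 \<partial>M)"
    using m by (intro Cauchy_Schwarz_nn_integral) auto
  also have "(\<integral>\<^sup>+x. ennreal \<bar>X x\<bar> * ennreal \<bar>Y x\<bar> \<partial>M) = ennreal (\<integral>x. \<bar>X x * Y x\<bar> \<partial>M)"
    using integrable_abs[OF i(1)] by (subst nn_integral_eq_integral[symmetric])
      (auto simp: ennreal_mult[symmetric] abs_mult)
  also have "(\<integral>\<^sup>+x. (ennreal \<bar>X x\<bar>)\<^sup>2 \<partial>M) = ennreal (\<integral>x. (X x)\<^sup>2 \<partial>M)"
    using i(2) by (subst nn_integral_eq_integral[symmetric]) (auto simp: ennreal_power)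
  also have "(\<integral>\<^sup>+x. (ennreal \<bar>Y x\<bar>)\<^sup>2 \<partial>M) = ennreal (\<integral>x. (Y x)\<^sup>2 \<partial>M)"
    using i(3) by (subst nn_integral_eq_integral[symmetric]) (auto simp: ennreal_power)
  finally have "(\<integral>x. \<bar>X x * Y x\<bar> \<partial>M)\<^sup>2 \<le> (\<integral>x. (X x)\<^sup>2 \<partial>M) * (\<integral>x. (Y x)\<^sup>2 \<partial>M)"
    by (simp add: ennreal_power ennreal_mult[symmetric])
  from real_sqrt_le_mono[OF this] show ?thesis
    by (simp add: real_sqrt_mult)
qed

lemma integral_cauchy_schwarz':
  assumes "l2 M X" "l2 M Y"
  shows "(\<integral>x. X x * Y x \<partial>M)\<^sup>2 \<le> (\<integral>x. (X x)\<^sup>2 \<partial>M) * (\<integral>x. (Y x)\<^sup>2 \<partial>M)"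
proof -
  have "\<bar>\<integral>x. X x * Y x \<partial>M\<bar> \<le> (\<integral>x. \<bar>X x * Y x\<bar> \<partial>M)"
    by (rule integral_abs_bound)
  also note integral_cauchy_schwarz[OF assms]
  finally have "\<bar>\<integral>x. X x * Y x \<partial>M\<bar>\<^sup>2 \<le> (sqrt (\<integral>x. (X x)\<^sup>2 \<partial>M) * sqrt (\<integral>x. (Y x)\<^sup>2 \<partial>M))\<^sup>2"
    by (intro power_mono) auto
  then show ?thesis by (simp add: power_mult_distrib)
qed

lemma integral_square_triangle:
  assumes "l2 M X" "l2 M Y" "l2 M Z"
  shows "(\<integral>x. (X x - Z x)\<^sup>2 \<partial>M) \<le> 2 * (\<integral>x. (X x - Y x)\<^sup>2 \<partial>M) + 2 * (\<integral>x. (Y x - Z x)\<^sup>2 \<partial>M)"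
proof -
  note i = l2_square[OF l2_diff[OF assms(1,2)]] l2_square[OF l2_diff[OF assms(2,3)]]
    l2_square[OF l2_diff[OF assms(1,3)]]
  have "(\<integral>x. (X x - Z x)\<^sup>2 \<partial>M) \<le> (\<integral>x. 2 * (X x - Y x)\<^sup>2 + 2 * (Y x - Z x)\<^sup>2 \<partial>M)"
  proof (rule integral_mono)
    show "(X x - Z x)\<^sup>2 \<le> 2 * (X x - Y x)\<^sup>2 + 2 * (Y x - Z x)\<^sup>2" for x
      \<comment> \<open>With \<open>a = X x - Y x\<close> and \<open>b = Y x - Z x\<close> this is
        \<open>2 a^2 + 2 b^2 - (a + b)^2 = (a - b)^2\<close>. The factor 2 is the source of the
        fractions \<open>e / 4\<close> and \<open>e / 8\<close> later.\<close>
      using zero_le_power2[of "(X x - Y x) - (Y x - Z x)"] by (simp add: power2_eq_square algebra_simps)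
  qed (use i in auto)
  also have "\<dots> = 2 * (\<integral>x. (X x - Y x)\<^sup>2 \<partial>M) + 2 * (\<integral>x. (Y x - Z x)\<^sup>2 \<partial>M)"
    using i by simp
  finally show ?thesis .
qed

text \<open>Membership of all terms and of the limit is part of the notion: a non-integrable square
  would have Bochner integral 0 and look convergent.\<close>

definition l2conv :: "'a measure \<Rightarrow> (nat \<Rightarrow> 'a \<Rightarrow> real) \<Rightarrow> ('a \<Rightarrow> real) \<Rightarrow> bool" where
  "l2conv M X Z \<longleftrightarrow> (\<forall>n. l2 M (X n)) \<and> l2 M Z \<and> (\<lambda>n. \<integral>x. (X n x - Z x)\<^sup>2 \<partial>M) \<longlonglongrightarrow> 0"

lemma l2conv_add:
  assumes "l2conv M X Z" "l2conv M X' Z'"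
  shows "l2conv M (\<lambda>n x. X n x + X' n x) (\<lambda>x. Z x + Z' x)"
  unfolding l2conv_def
proof (intro conjI allI)
  have l: "l2 M (X n)" "l2 M Z" "l2 M (X' n)" "l2 M Z'" for n
    using assms by (auto simp: l2conv_def)
  then show "l2 M (\<lambda>x. X n x + X' n x)" "l2 M (\<lambda>x. Z x + Z' x)" for n
    by (auto intro: l2_add)
  show "(\<lambda>n. \<integral>x. (X n x + X' n x - (Z x + Z' x))\<^sup>2 \<partial>M) \<longlonglongrightarrow> 0"
  proof (rule tendsto_sandwich[OF _ _ tendsto_const])
    show "(\<lambda>n. 2 * (\<integral>x. (X n x - Z x)\<^sup>2 \<partial>M) + 2 * (\<integral>x. (X' n x - Z' x)\<^sup>2 \<partial>M)) \<longlonglongrightarrow> 0"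
      using assms by (auto simp: l2conv_def intro!: tendsto_eq_intros)
    show "\<forall>\<^sub>F n in sequentially. (\<integral>x. (X n x + X' n x - (Z x + Z' x))\<^sup>2 \<partial>M)
       \<le> 2 * (\<integral>x. (X n x - Z x)\<^sup>2 \<partial>M) + 2 * (\<integral>x. (X' n x - Z' x)\<^sup>2 \<partial>M)"
    proof (intro always_eventually allI)
      fix n
      show "(\<integral>x. (X n x + X' n x - (Z x + Z' x))\<^sup>2 \<partial>M)
        \<le> 2 * (\<integral>x. (X n x - Z x)\<^sup>2 \<partial>M) + 2 * (\<integral>x. (X' n x - Z' x)\<^sup>2 \<partial>M)"
        \<comment> \<open>The middle function is 0 and the third is \<open>Z' - X' n\<close>, so the
          triangle inequality becomes a bound for a sum of two errors.\<close>
        using integral_square_triangle[OF l2_diff[OF l(1,2)] l2_zero l2_diff[OF l(4,3)], of n n]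
        by (simp add: power2_commute algebra_simps)
    qed
  qed auto
qed

lemma l2conv_scale:
  assumes "l2conv M X Z"
  shows "l2conv M (\<lambda>n x. c * X n x) (\<lambda>x. c * Z x)"
proof -
  have "(\<lambda>n. c\<^sup>2 * (\<integral>x. (X n x - Z x)\<^sup>2 \<partial>M)) \<longlonglongrightarrow> 0"
    using assms by (auto simp: l2conv_def intro!: tendsto_eq_intros)
  also have "(\<lambda>n. c\<^sup>2 * (\<integral>x. (X n x - Z x)\<^sup>2 \<partial>M)) = (\<lambda>n. \<integral>x. (c * X n x - c * Z x)\<^sup>2 \<partial>M)"
    by (simp add: right_diff_distrib[symmetric] power_mult_distrib)
  finally show ?thesis
    using assms by (auto simp: l2conv_def intro: l2_scale)
qed

lemma l2conv_zero: "l2conv M (\<lambda>n x. 0) (\<lambda>x. 0)"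
  by (simp add: l2conv_def)

text \<open>A product of two \<open>L2\<close> functions is only integrable, so \<open>L1\<close> is
  the natural mode of convergence. The difference of products splits into three terms, each with a
  factor that tends to 0, and Cauchy-Schwarz applies to each.\<close>

lemma l2conv_product_L1:
  assumes "l2conv M X Z" "l2conv M X' Z'"
  shows "(\<lambda>n. \<integral>x. \<bar>X n x * X' n x - Z x * Z' x\<bar> \<partial>M) \<longlonglongrightarrow> 0"
proof -
  have l: "l2 M (X n)" "l2 M Z" "l2 M (X' n)" "l2 M Z'" for n
    using assms by (auto simp: l2conv_def)
  define a where "a n = (\<integral>x. (X n x - Z x)\<^sup>2 \<partial>M)" for n
  define b where "b n = (\<integral>x. (X' n x - Z' x)\<^sup>2 \<partial>M)" for n
  have ab: "a \<longlonglongrightarrow> 0" "b \<longlonglongrightarrow> 0"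
    using assms unfolding l2conv_def a_def[abs_def] b_def[abs_def] by auto
  define u where "u = sqrt (\<integral>x. (Z x)\<^sup>2 \<partial>M)"
  define v where "v = sqrt (\<integral>x. (Z' x)\<^sup>2 \<partial>M)"
  note d = l2_diff[OF l(1,2)] l2_diff[OF l(3,4)]
  have "(\<integral>x. \<bar>X n x * X' n x - Z x * Z' x\<bar> \<partial>M)
     \<le> sqrt (a n) * sqrt (b n) + sqrt (a n) * v + u * sqrt (b n)" for n
  proof -
    note i = l2_mult[OF d(1)[of n] d(2)[of n]] l2_mult[OF d(1)[of n] l(4)] l2_mult[OF l(2) d(2)[of n]]
    have "(\<integral>x. \<bar>X n x * X' n x - Z x * Z' x\<bar> \<partial>M)
      \<le> (\<integral>x. \<bar>(X n x - Z x) * (X' n x - Z' x)\<bar> + \<bar>(X n x - Z x) * Z' x\<bar> + \<bar>Z x * (X' n x - Z' x)\<bar> \<partial>M)"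
    proof (rule integral_mono)
      show "integrable M (\<lambda>x. \<bar>X n x * X' n x - Z x * Z' x\<bar>)"
        using l2_mult[OF l(1)[of n] l(3)[of n]] l2_mult[OF l(2,4)] by auto
      show "\<bar>X n x * X' n x - Z x * Z' x\<bar>
         \<le> \<bar>(X n x - Z x) * (X' n x - Z' x)\<bar> + \<bar>(X n x - Z x) * Z' x\<bar> + \<bar>Z x * (X' n x - Z' x)\<bar>" for x
      proof -
        have "X n x * X' n x - Z x * Z' x = (X n x - Z x) * (X' n x - Z' x) + (X n x - Z x) * Z' x + Z x * (X' n x - Z' x)"
          by (simp add: algebra_simps)
        then show ?thesis by linarith
      qed
    qed (use i in auto)
    also have "\<dots> = (\<integral>x. \<bar>(X n x - Z x) * (X' n x - Z' x)\<bar> \<partial>M) + (\<integral>x. \<bar>(X n x - Z x) * Z' x\<bar> \<partial>M)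
        + (\<integral>x. \<bar>Z x * (X' n x - Z' x)\<bar> \<partial>M)"
      using i by simp
    also have "\<dots> \<le> sqrt (a n) * sqrt (b n) + sqrt (a n) * v + u * sqrt (b n)"
      unfolding a_def b_def u_def v_def
      by (intro add_mono integral_cauchy_schwarz d l)
    finally show ?thesis .
  qed
  moreover have "(\<lambda>n. sqrt (a n) * sqrt (b n) + sqrt (a n) * v + u * sqrt (b n)) \<longlonglongrightarrow> 0"
    using tendsto_add[OF tendsto_add[OF tendsto_mult[OF tendsto_real_sqrt[OF ab(1)] tendsto_real_sqrt[OF ab(2)]]
      tendsto_mult_right[OF tendsto_real_sqrt[OF ab(1)]]] tendsto_mult_left[OF tendsto_real_sqrt[OF ab(2)]]]
    by simp
  ultimately show ?thesis
    by (intro Lim_null_comparison[of "\<lambda>n. \<integral>x. \<bar>X n x * X' n x - Z x * Z' x\<bar> \<partial>M"]) auto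
qed

lemma l2conv_inner:
  assumes "l2conv M X Z" "l2conv M X' Z'"
  shows "(\<lambda>n. \<integral>x. X n x * X' n x \<partial>M) \<longlonglongrightarrow> (\<integral>x. Z x * Z' x \<partial>M)"
proof (rule LIM_zero_cancel, rule tendsto_rabs_zero_cancel, rule tendsto_sandwich[OF _ _ tendsto_const])
  show "(\<lambda>n. \<integral>x. \<bar>X n x * X' n x - Z x * Z' x\<bar> \<partial>M) \<longlonglongrightarrow> 0"
    by (rule l2conv_product_L1[OF assms])
  have l: "l2 M (X n)" "l2 M Z" "l2 M (X' n)" "l2 M Z'" for n
    using assms by (auto simp: l2conv_def)
  show "\<forall>\<^sub>F n in sequentially. \<bar>(\<integral>x. X n x * X' n x \<partial>M) - (\<integral>x. Z x * Z' x \<partial>M)\<bar>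
     \<le> (\<integral>x. \<bar>X n x * X' n x - Z x * Z' x\<bar> \<partial>M)"
  proof (intro always_eventually allI)
    fix n
    have "(\<integral>x. X n x * X' n x \<partial>M) - (\<integral>x. Z x * Z' x \<partial>M) = (\<integral>x. X n x * X' n x - Z x * Z' x \<partial>M)"
      using l2_mult[OF l(1)[of n] l(3)[of n]] l2_mult[OF l(2,4)] by simp
    then show "\<bar>(\<integral>x. X n x * X' n x \<partial>M) - (\<integral>x. Z x * Z' x \<partial>M)\<bar>
     \<le> (\<integral>x. \<bar>X n x * X' n x - Z x * Z' x\<bar> \<partial>M)"
      by (simp only: integral_abs_bound)
  qed
qed auto

text \<open>Fatou's lemma carries the bound to the limit and proves at the same time that the limit
  is square integrable.\<close>

lemma fatou_square:
  fixes Z :: "'a \<Rightarrow> real"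
  assumes Zn: "\<And>n. Zn n \<in> borel_measurable M" and Z: "Z \<in> borel_measurable M"
    and ae: "AE x in M. (\<lambda>n. Zn n x) \<longlonglongrightarrow> Z x"
    and sq: "\<And>n. integrable M (\<lambda>x. (Zn n x)\<^sup>2)"
    and le: "\<And>n. (\<integral>x. (Zn n x)\<^sup>2 \<partial>M) \<le> c n" and c: "c \<longlonglongrightarrow> C"
  shows "l2 M Z" and "(\<integral>x. (Z x)\<^sup>2 \<partial>M) \<le> C"
proof -
  have cn: "0 \<le> c n" for n
    using le[of n] by (rule order_trans[rotated]) simp
  have C0: "0 \<le> C"
    by (rule LIMSEQ_le_const[OF c]) (use cn in auto)
  have "(\<integral>\<^sup>+x. ennreal ((Z x)\<^sup>2) \<partial>M) = (\<integral>\<^sup>+x. liminf (\<lambda>n. ennreal ((Zn n x)\<^sup>2)) \<partial>M)"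
  proof (rule nn_integral_cong_AE)
    show "AE x in M. ennreal ((Z x)\<^sup>2) = liminf (\<lambda>n. ennreal ((Zn n x)\<^sup>2))"
      using ae
    proof eventually_elim
      case (elim x)
      then have "(\<lambda>n. ennreal ((Zn n x)\<^sup>2)) \<longlonglongrightarrow> ennreal ((Z x)\<^sup>2)"
        by (intro tendsto_ennrealI tendsto_power)
      then show ?case
        by (intro lim_imp_Liminf[symmetric]) auto
    qed
  qed
  also have "\<dots> \<le> liminf (\<lambda>n. \<integral>\<^sup>+x. ennreal ((Zn n x)\<^sup>2) \<partial>M)"
    by (rule nn_integral_liminf) (use Zn in auto)
  also have "\<dots> \<le> liminf (\<lambda>n. ennreal (c n))"
  proof (intro Liminf_mono always_eventually allI)
    fix n
    show "(\<integral>\<^sup>+x. ennreal ((Zn n x)\<^sup>2) \<partial>M) \<le> ennreal (c n)"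
      using le[of n] sq[of n] by (subst nn_integral_eq_integral) (auto intro: ennreal_leI)
  qed
  also have "\<dots> = ennreal C"
    using c by (intro lim_imp_Liminf tendsto_ennrealI) auto
  finally have *: "(\<integral>\<^sup>+x. ennreal ((Z x)\<^sup>2) \<partial>M) \<le> ennreal C" .
  have i: "integrable M (\<lambda>x. (Z x)\<^sup>2)"
    by (rule integrableI_bounded) (use * Z in \<open>auto intro: le_less_trans\<close>)
  then show "l2 M Z" using Z by (auto simp: l2_def)
  show "(\<integral>x. (Z x)\<^sup>2 \<partial>M) \<le> C"
    using * i C0 by (subst (asm) nn_integral_eq_integral) auto
qed

text \<open>Along a subsequence the \<open>L1\<close> convergence is almost sure, and
  \<open>c\<close> keeps its limit there. The intended \<open>Zn\<close> are sums of products, for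
  which only \<open>L1\<close> convergence is at hand, while the bound concerns their
  squares.\<close>

lemma L1_fatou_square:
  fixes Z :: "'a \<Rightarrow> real"
  assumes Zn: "\<And>n. integrable M (Zn n)" and Z: "integrable M Z"
    and conv: "(\<lambda>n. \<integral>x. \<bar>Zn n x - Z x\<bar> \<partial>M) \<longlonglongrightarrow> 0"
    and sq: "\<And>n. integrable M (\<lambda>x. (Zn n x)\<^sup>2)"
    and le: "\<And>n. (\<integral>x. (Zn n x)\<^sup>2 \<partial>M) \<le> c n" and c: "c \<longlonglongrightarrow> C"
  shows "l2 M Z" and "(\<integral>x. (Z x)\<^sup>2 \<partial>M) \<le> C"
proof -
  have "\<exists>r::nat\<Rightarrow>nat. strict_mono r \<and> (AE x in M. (\<lambda>n. Zn (r n) x - Z x) \<longlonglongrightarrow> 0)"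
    by (rule tendsto_L1_AE_subseq) (use Zn Z conv in auto)
  then obtain r :: "nat \<Rightarrow> nat" where r: "strict_mono r"
    and ae: "AE x in M. (\<lambda>n. Zn (r n) x - Z x) \<longlonglongrightarrow> 0" by blast
  have ae': "AE x in M. (\<lambda>n. Zn (r n) x) \<longlonglongrightarrow> Z x"
    using ae by eventually_elim (rule LIM_zero_cancel)
  have c': "(\<lambda>n. c (r n)) \<longlonglongrightarrow> C"
    using LIMSEQ_subseq_LIMSEQ[OF c r] by (simp add: o_def)
  show "l2 M Z" "(\<integral>x. (Z x)\<^sup>2 \<partial>M) \<le> C"
    using fatou_square[OF borel_measurable_integrable[OF Zn] borel_measurable_integrable[OF Z] ae' sq le c'] .
qed

text \<open>On a finite measure space a Cauchy sequence in \<open>L2\<close> is Cauchy in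
  \<open>L1\<close>, hence almost surely along a subsequence. The pointwise limit of that
  subsequence is the candidate, and Fatou's lemma bounds its distance from every late
  \<open>X n\<close>.\<close>

lemma (in finite_measure) l2_complete:
  assumes l: "\<And>n. l2 M (X n)"
    and cauchy: "\<And>e. e > 0 \<Longrightarrow> \<exists>N. \<forall>i\<ge>N. \<forall>j\<ge>N. (\<integral>x. (X i x - X j x)\<^sup>2 \<partial>M) < e"
  shows "\<exists>Z. l2conv M X Z"
proof -
  \<comment> \<open>The added 1 keeps \<open>K\<close> positive, so that \<open>e / K\<close> makes
    sense on a null space too.\<close>
  define K where "K = sqrt (measure M (space M)) + 1"
  have K: "K > 0" "sqrt (measure M (space M)) \<le> K" by (auto simp: K_def add_nonneg_pos)
  have L1: "\<exists>N. \<forall>i\<ge>N. \<forall>j\<ge>N. (\<integral>x. norm (X i x - X j x) \<partial>M) < e" if e: "e > 0" for e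
  proof -
    obtain N where N: "\<And>i j. i \<ge> N \<Longrightarrow> j \<ge> N \<Longrightarrow> (\<integral>x. (X i x - X j x)\<^sup>2 \<partial>M) < (e / K)\<^sup>2"
      using cauchy[of "(e / K)\<^sup>2"] e K by auto
    have "(\<integral>x. norm (X i x - X j x) \<partial>M) < e" if "i \<ge> N" "j \<ge> N" for i j
    proof -
      have "(\<integral>x. norm (X i x - X j x) \<partial>M) \<le> sqrt (\<integral>x. (X i x - X j x)\<^sup>2 \<partial>M) * sqrt (measure M (space M))"
        using integral_cauchy_schwarz[OF l2_diff[OF l[of i] l[of j]] l2_const[of 1]] by simp
      also have "\<dots> \<le> sqrt (\<integral>x. (X i x - X j x)\<^sup>2 \<partial>M) * K"
        using K by (intro mult_left_mono) auto
      also have "\<dots> < (e / K) * K"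
        using N[OF that] e K real_sqrt_less_mono[OF N[OF that]] by (intro mult_strict_right_mono) auto
      finally show ?thesis using K by simp
    qed
    then show ?thesis by blast
  qed
  obtain r where r: "strict_mono r" and ae: "AE x in M. Cauchy (\<lambda>i. X (r i) x)"
    by (rule cauchy_L1_AE_cauchy_subseq[OF l2_integrable[OF l] L1])
  have m[measurable]: "X n \<in> borel_measurable M" for n
    using l by (rule l2_measurable)
  define Z where "Z x = lim (\<lambda>i. X (r i) x)" for x
  have Zm[measurable]: "Z \<in> borel_measurable M"
    unfolding Z_def[abs_def] by measurable
  have ae': "AE x in M. (\<lambda>i. X (r i) x) \<longlonglongrightarrow> Z x"
    using ae by eventually_elim (simp add: Z_def Cauchy_convergent_iff convergent_LIMSEQ_iff)
  \<comment> \<open>Fatou with \<open>n\<close> fixed and the subsequence index growing. The strict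
    bound turns into \<open>\<le> e\<close>, whence the \<open>e / 2\<close> at the end.\<close>
  have key: "l2 M (\<lambda>x. X n x - Z x) \<and> (\<integral>x. (X n x - Z x)\<^sup>2 \<partial>M) \<le> e"
    if "e > 0" and N: "\<forall>i\<ge>N. \<forall>j\<ge>N. (\<integral>x. (X i x - X j x)\<^sup>2 \<partial>M) < e" and n: "n \<ge> N" for e n N
  proof -
    have rN: "N \<le> r (i + N)" for i
      using seq_suble[OF r, of "i + N"] by simp
    have d: "l2 M (\<lambda>x. X n x - X (r (i + N)) x)" for i by (intro l2_diff l)
    have "AE x in M. (\<lambda>i. X n x - X (r (i + N)) x) \<longlonglongrightarrow> X n x - Z x"
      using ae' by eventually_elim (intro tendsto_intros LIMSEQ_ignore_initial_segment)
    note F = fatou_square[OF _ _ this l2_square[OF d] _ tendsto_const[of e]]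
    have le: "(\<integral>x. (X n x - X (r (i + N)) x)\<^sup>2 \<partial>M) \<le> e" for i
      using N n rN by (auto intro: less_imp_le)
    show ?thesis
      by (intro conjI F) (use le in auto)
  qed
  obtain N where N: "\<forall>i\<ge>N. \<forall>j\<ge>N. (\<integral>x. (X i x - X j x)\<^sup>2 \<partial>M) < 1"
    using cauchy[of 1] by auto
  have lZ: "l2 M Z"
    using l2_diff[OF l[of N] conjunct1[OF key[OF _ N, of N]]] by simp
  have "(\<lambda>n. \<integral>x. (X n x - Z x)\<^sup>2 \<partial>M) \<longlonglongrightarrow> 0"
  proof (rule LIMSEQ_I)
    fix e :: real assume e: "e > 0"
    obtain N where N: "\<forall>i\<ge>N. \<forall>j\<ge>N. (\<integral>x. (X i x - X j x)\<^sup>2 \<partial>M) < e / 2"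
      using cauchy[of "e / 2"] e by auto
    show "\<exists>no. \<forall>n\<ge>no. norm ((\<integral>x. (X n x - Z x)\<^sup>2 \<partial>M) - 0) < e"
      using key[OF _ N] e by (intro exI[of _ N]) fastforce
  qed
  then show ?thesis using l lZ by (auto simp: l2conv_def)
qed

section \<open>Moments of Wiener increments\<close>

text \<open>Indicators with the common left end \<open>t\<close> serve as a basis: linear
  combinations act on coefficients over the union of the index sets, without refining partitions,
  and the Gram matrix \<open>min s u - t\<close> is also the covariance of the increments from
  \<open>t\<close>.\<close>

definition stepg :: "real \<Rightarrow> real set \<Rightarrow> (real \<Rightarrow> real) \<Rightarrow> real \<Rightarrow> real" where
  "stepg t S c x = (\<Sum>s\<in>S. c s * indicator {t<..s} x)"

definition stepX :: "(real \<Rightarrow> 'a \<Rightarrow> real) \<Rightarrow> real \<Rightarrow> real set \<Rightarrow> (real \<Rightarrow> real) \<Rightarrow> 'a \<Rightarrow> real" where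
  "stepX w t S c \<omega> = (\<Sum>s\<in>S. c s * (w s \<omega> - w t \<omega>))"

lemma (in finite_measure) integrable_power_le_4:
  fixes Y :: "'a \<Rightarrow> real"
  assumes "Y \<in> borel_measurable M" "integrable M (\<lambda>x. (Y x) ^ 4)" "k \<le> 4"
  shows "integrable M (\<lambda>x. (Y x) ^ k)"
proof (rule Bochner_Integration.integrable_bound)
  show "integrable M (\<lambda>x. 1 + (Y x) ^ 4)" using assms by auto
  show "(\<lambda>x. (Y x) ^ k) \<in> borel_measurable M" using assms by auto
  show "AE x in M. norm ((Y x) ^ k) \<le> norm (1 + (Y x) ^ 4)"
  proof (rule AE_I2)
    fix x
    have "\<bar>Y x\<bar> ^ k \<le> 1 + \<bar>Y x\<bar> ^ 4"
    proof (cases "\<bar>Y x\<bar> \<le> 1")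
      case True
      then have "\<bar>Y x\<bar> ^ k \<le> 1" by (simp add: power_le_one)
      then show ?thesis by (smt (verit) zero_le_power abs_ge_zero)
    next
      case False
      then have "\<bar>Y x\<bar> ^ k \<le> \<bar>Y x\<bar> ^ 4" using assms(3) by (intro power_increasing) auto
      then show ?thesis by simp
    qed
    then show "norm ((Y x) ^ k) \<le> norm (1 + (Y x) ^ 4)"
      by (simp add: power_abs)
  qed
qed

lemma filtrationD:
  assumes "rc_filtration M F"
  shows "sets (sigma (space M) (F s)) = F s" "space (sigma (space M) (F s)) = space M"
    "F s \<subseteq> sets M" "s \<le> u \<Longrightarrow> F s \<subseteq> F u"
proof -
  interpret Fs: sigma_algebra "space M" "F s" using assms unfolding rc_filtration_def by (elim conjE allE[of _ s])
  show "sets (sigma (space M) (F s)) = F s" "space (sigma (space M) (F s)) = space M"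
    by (simp_all add: sets_measure_of[OF Fs.space_closed] space_measure_of[OF Fs.space_closed] Fs.sigma_sets_eq)
  have "\<forall>s. sigma_algebra (space M) (F s) \<and> F s \<subseteq> sets M" using assms unfolding rc_filtration_def by (elim conjE)
  then show "F s \<subseteq> sets M" by blast
  have "\<forall>r s. r \<le> s \<longrightarrow> F r \<subseteq> F s" using assms unfolding rc_filtration_def by (elim conjE)
  then show "s \<le> u \<Longrightarrow> F s \<subseteq> F u" by blast
qed

text \<open>\<open>Y\<close> is any variable known at time \<open>s\<close>; the independence of the
  next increment from it drives the later induction on time. The moments are read off the normal
  density.\<close>

lemma (in prob_space) increment_moments:
  assumes fi: "rc_filtration M F" and W: "wiener_process M F W" and su: "0 \<le> s" "s < u"
    and Y: "Y \<in> measurable (sigma (space M) (F s)) borel"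
  defines "D \<equiv> (\<lambda>\<omega>. W u \<omega> - W s \<omega>)"
  shows "indep_var borel Y borel D"
    and "integrable M (\<lambda>\<omega>. (D \<omega>) ^ k)"
    and "expectation D = 0" "expectation (\<lambda>\<omega>. (D \<omega>)\<^sup>2) = u - s"
      "expectation (\<lambda>\<omega>. (D \<omega>) ^ 3) = 0" "expectation (\<lambda>\<omega>. (D \<omega>) ^ 4) = 3 * (u - s)\<^sup>2"
proof -
  have dist: "distributed M lborel D (\<lambda>x. ennreal (normal_density 0 (sqrt (u - s)) x))"
    and ind: "indep_set (F s) {D -` A \<inter> space M | A. A \<in> sets borel}"
    using W su unfolding wiener_process_def D_def by auto
  interpret Fs: sigma_algebra "space M" "F s" using fi unfolding rc_filtration_def by blast
  have FsM: "F s \<subseteq> events" using filtrationD[OF fi] by blast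
  have Fsp: "F s \<subseteq> Pow (space M)" using Fs.space_closed by auto
  have D[measurable]: "D \<in> borel_measurable M"
    using distributed_measurable[OF dist] by simp
  have Y_M[measurable]: "Y \<in> borel_measurable M"
    by (rule borel_measurable_subalgebra[OF _ _ Y]) (use filtrationD[OF fi] in auto)
  show "indep_var borel Y borel D"
    unfolding indep_var_eq
  proof (intro conjI)
    \<comment> \<open>Independence of generators extends to the generated sigma-algebras once both
      families are closed under intersection; the sigma-algebra of \<open>Y\<close> lies within that
      of \<open>F s\<close>.\<close>
    have "Int_stable (F s)" by (auto simp: Int_stable_def)
    moreover have "Int_stable {D -` A \<inter> space M | A. A \<in> sets borel}"
      unfolding Int_stable_def
    proof safe
      fix A B :: "real set" assume "A \<in> sets borel" "B \<in> sets borel"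
      then show "\<exists>C. D -` A \<inter> space M \<inter> (D -` B \<inter> space M) = D -` C \<inter> space M \<and> C \<in> sets borel"
        by (intro exI[of _ "A \<inter> B"]) auto
    qed
    ultimately have "indep_set (sigma_sets (space M) (F s)) (sigma_sets (space M) {D -` A \<inter> space M | A. A \<in> sets borel})"
      using ind by (intro indep_set_sigma_sets)
    moreover have "sigma_sets (space M) {Y -` A \<inter> space M | A. A \<in> sets borel} \<subseteq> sigma_sets (space M) (F s)"
    proof (rule sigma_sets_mono, safe)
      fix A :: "real set" assume "A \<in> sets borel"
      then show "Y -` A \<inter> space M \<in> sigma_sets (space M) (F s)"
        using measurable_sets[OF Y] Fsp by (simp add: space_measure_of)
    qed
    ultimately show "indep_set (sigma_sets (space M) {Y -` A \<inter> space M | A. A \<in> sets borel})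
        (sigma_sets (space M) {D -` A \<inter> space M | A. A \<in> sets borel})"
      unfolding indep_sets2_eq by blast
  qed auto
  have pos: "0 < sqrt (u - s)" using su by simp
  note dens = normal_density_nonneg
  show "integrable M (\<lambda>\<omega>. (D \<omega>) ^ k)"
    using integrable_normal_moment[OF pos, of 0 k]
    by (subst distributed_integrable[OF dist, of "\<lambda>x. x ^ k", symmetric]) auto
  have mom: "expectation (\<lambda>\<omega>. (D \<omega>) ^ k) = (\<integral>x. normal_density 0 (sqrt (u - s)) x * x ^ k \<partial>lborel)" for k
    by (subst distributed_integral[OF dist, of "\<lambda>x. x ^ k", symmetric]) auto
  show "expectation D = 0"
    using mom[of 1] integral_normal_moment_odd[OF pos, of 0 0] by simp
  show "expectation (\<lambda>\<omega>. (D \<omega>)\<^sup>2) = u - s"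
    using mom[of 2] integral_normal_moment_even[OF pos, of 0 1] su by (simp add: fact_numeral)
  show "expectation (\<lambda>\<omega>. (D \<omega>) ^ 3) = 0"
    using mom[of 3] integral_normal_moment_odd[OF pos, of 0 1] by (simp add: numeral_eq_Suc)
  show "expectation (\<lambda>\<omega>. (D \<omega>) ^ 4) = 3 * (u - s)\<^sup>2"
    using mom[of 4] integral_normal_moment_even[OF pos, of 0 2] su
    by (simp add: fact_numeral field_simps power2_eq_square)
qed

lemma wiener_measurable_filtration:
  assumes fi: "rc_filtration M F" and W: "wiener_process M F W" and "0 \<le> s" "s \<le> u"
  shows "W s \<in> measurable (sigma (space M) (F u)) borel"
proof (rule borel_measurable_subalgebra)
  show "W s \<in> measurable (sigma (space M) (F s)) borel"
    using W assms(3) by (auto simp: wiener_process_def)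
  show "sets (sigma (space M) (F s)) \<subseteq> sets (sigma (space M) (F u))"
    using filtrationD[OF fi] assms(4) by auto
qed (use filtrationD[OF fi] in auto)

text \<open>\<open>W u - W t\<close> is split at \<open>s\<close>; the increment after
  \<open>s\<close> is centred and independent of the past, so only the square survives. Equal times
  are separate because the definition states a law only for strictly increasing times.\<close>

lemma (in prob_space) wiener_covariance_le:
  assumes fi: "rc_filtration M F" and W: "wiener_process M F W"
    and t: "0 \<le> t" "t \<le> s" "s \<le> u"
  shows "expectation (\<lambda>\<omega>. (W s \<omega> - W t \<omega>) * (W u \<omega> - W t \<omega>)) = s - t"
    and "integrable M (\<lambda>\<omega>. (W s \<omega> - W t \<omega>) * (W u \<omega> - W t \<omega>))"
proof -
  have Ys: "(\<lambda>\<omega>. W s \<omega> - W t \<omega>) \<in> measurable (sigma (space M) (F s)) borel"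
    using wiener_measurable_filtration[OF fi W, of s s] wiener_measurable_filtration[OF fi W, of t s] t
    by (intro borel_measurable_diff) auto
  have sq: "expectation (\<lambda>\<omega>. (W s \<omega> - W t \<omega>)\<^sup>2) = s - t \<and> integrable M (\<lambda>\<omega>. (W s \<omega> - W t \<omega>)\<^sup>2)
     \<and> integrable M (\<lambda>\<omega>. W s \<omega> - W t \<omega>)" if "t \<noteq> s"
  proof -
    \<comment> \<open>A dummy for the companion variable \<open>Y\<close>: here only the moments of
      the increment matter.\<close>
    have "(\<lambda>\<omega>. 0) \<in> measurable (sigma (space M) (F t)) borel" by simp
    note I = increment_moments[OF fi W _ _ this, of s]
    show ?thesis
      using I(4) I(2)[of 2] I(2)[of 1] that t by auto
  qed
  have cross: "expectation (\<lambda>\<omega>. (W s \<omega> - W t \<omega>) * (W u \<omega> - W s \<omega>)) = 0 \<and>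
    integrable M (\<lambda>\<omega>. (W s \<omega> - W t \<omega>) * (W u \<omega> - W s \<omega>))" if "t \<noteq> s" "s \<noteq> u"
  proof -
    note I = increment_moments[OF fi W _ _ Ys, of u]
    have "s < u" "0 \<le> s" using that t by auto
    then show ?thesis
      using indep_var_lebesgue_integral[OF I(1)] indep_var_integrable[OF I(1)] I(3) I(2)[of 1] sq that
      by auto
  qed
  have eq: "(\<lambda>\<omega>. (W s \<omega> - W t \<omega>) * (W u \<omega> - W t \<omega>)) =
    (\<lambda>\<omega>. (W s \<omega> - W t \<omega>)\<^sup>2 + (W s \<omega> - W t \<omega>) * (W u \<omega> - W s \<omega>))"
    by (auto simp: power2_eq_square algebra_simps)
  show "integrable M (\<lambda>\<omega>. (W s \<omega> - W t \<omega>) * (W u \<omega> - W t \<omega>))"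
    unfolding eq using sq cross by (cases "t = s"; cases "s = u") auto
  show "expectation (\<lambda>\<omega>. (W s \<omega> - W t \<omega>) * (W u \<omega> - W t \<omega>)) = s - t"
    unfolding eq using sq cross by (cases "t = s"; cases "s = u") auto
qed

lemma (in prob_space) wiener_covariance:
  assumes fi: "rc_filtration M F" and W: "wiener_process M F W"
    and t: "0 \<le> t" "t \<le> s" "t \<le> u"
  shows "expectation (\<lambda>\<omega>. (W s \<omega> - W t \<omega>) * (W u \<omega> - W t \<omega>)) = min s u - t"
    and "integrable M (\<lambda>\<omega>. (W s \<omega> - W t \<omega>) * (W u \<omega> - W t \<omega>))"
  using wiener_covariance_le[OF fi W, of t s u] wiener_covariance_le[OF fi W, of t u s] t
  by (cases "s \<le> u"; simp add: mult.commute)+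

text \<open>Induction on the latest time writes the sum as \<open>Y + c b * D\<close> with
  \<open>D\<close> independent of the past. Measurability with respect to the sigma-algebra of the
  latest time is carried along because it supplies this independence.\<close>

lemma (in prob_space) wiener_fourth_moment:
  assumes fi: "rc_filtration M F" and W: "wiener_process M F W"
    and t: "0 \<le> t" and S: "finite S" "S \<subseteq> {t..}"
  shows "stepX W t S c \<in> measurable (sigma (space M) (F (Max (insert t S)))) borel \<and>
    integrable M (\<lambda>\<omega>. (stepX W t S c \<omega>) ^ 4) \<and> expectation (stepX W t S c) = 0 \<and>
    expectation (\<lambda>\<omega>. (stepX W t S c \<omega>) ^ 4) = 3 * (expectation (\<lambda>\<omega>. (stepX W t S c \<omega>)\<^sup>2))\<^sup>2"
  using S
proof (induction S arbitrary: c rule: finite_linorder_max_induct)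
  case empty
  then show ?case by (simp add: stepX_def[abs_def])
next
  case (insert b A)
  define a where "a = Max (insert t A)"
  have tb: "t \<le> b" using insert.prems by auto
  have a: "t \<le> a" "a \<le> b" "a = t \<or> a \<in> A"
    using insert.hyps Max_in[of "insert t A"] tb by (auto simp: a_def intro: less_imp_le)
  have bA: "b \<notin> A" using insert.hyps by auto
  have Mb: "Max (insert t (insert b A)) = b"
    using insert.hyps tb by (intro Max_eqI) (auto intro: less_imp_le)
  show ?case
  proof (cases "a = b")
    case True
    \<comment> \<open>All times in \<open>A\<close> lie below \<open>b\<close>, so \<open>b\<close>
      equals the previous maximum only if \<open>b = t\<close>, and then the sum is 0.\<close>
    then have "A = {}" "b = t" using a bA insert.prems insert.hyps by force+
    then show ?thesis by (simp add: stepX_def[abs_def])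
  next
    case False
    then have ab: "a < b" using a by simp
    \<comment> \<open>From \<open>W b - W t = D + (W a - W t)\<close>, the weight \<open>c b\<close>
      moves onto \<open>a\<close>, which is why the induction ranges over all \<open>c\<close>. If
      \<open>a\<close> is not in \<open>A\<close>, then \<open>a = t\<close> and the moved term is
      0.\<close>
    define c' where "c' = (if a \<in> A then c(a := c a + c b) else c)"
    define Y where "Y = stepX W t A c'"
    define D where "D \<omega> = W b \<omega> - W a \<omega>" for \<omega>
    have Y_eq: "Y \<omega> = stepX W t A c \<omega> + c b * (W a \<omega> - W t \<omega>)" for \<omega>
    proof (cases "a \<in> A")
      case True
      then show ?thesis
        using insert.hyps(1) unfolding Y_def stepX_def c'_def
        by (simp add: sum.remove[OF _ True] algebra_simps)
    next
      case False
      then show ?thesis using a by (auto simp: Y_def c'_def)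
    qed
    have Z_eq: "stepX W t (insert b A) c = (\<lambda>\<omega>. Y \<omega> + c b * D \<omega>)"
      using insert.hyps(1) bA by (auto simp: fun_eq_iff stepX_def Y_eq D_def algebra_simps)
    have IH: "Y \<in> measurable (sigma (space M) (F a)) borel" "integrable M (\<lambda>\<omega>. (Y \<omega>) ^ 4)"
      "expectation Y = 0" "expectation (\<lambda>\<omega>. (Y \<omega>) ^ 4) = 3 * (expectation (\<lambda>\<omega>. (Y \<omega>)\<^sup>2))\<^sup>2"
      using insert.IH[of c'] insert.prems by (auto simp: Y_def a_def)
    note I = increment_moments[OF fi W _ ab IH(1), folded D_def]
    have a0: "0 \<le> a" using a t by simp
    have Ym: "Y \<in> borel_measurable M"
      using indep_var_rv1[OF I(1)[OF a0]] .
    have Yk: "integrable M (\<lambda>\<omega>. (Y \<omega>) ^ k)" if "k \<le> 4" for k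
      using integrable_power_le_4[OF Ym IH(2) that] .
    have ind: "indep_var borel (\<lambda>\<omega>. Y \<omega> ^ k) borel (\<lambda>\<omega>. D \<omega> ^ l)" for k l
      using indep_var_compose[OF I(1)[OF a0], of "\<lambda>x. x ^ k" borel "\<lambda>x. x ^ l" borel] by (simp add: comp_def)
    define y where "y k = expectation (\<lambda>\<omega>. Y \<omega> ^ k)" for k
    define d where "d l = expectation (\<lambda>\<omega>. D \<omega> ^ l)" for l
    have hb: "has_bochner_integral M (\<lambda>\<omega>. Y \<omega> ^ k * D \<omega> ^ l) (y k * d l)" if "k \<le> 4" for k l
      using indep_var_lebesgue_integral[OF ind Yk[OF that] I(2)[OF a0]]
        indep_var_integrable[OF ind Yk[OF that] I(2)[OF a0]]
      by (auto simp: has_bochner_integral_iff y_def d_def)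
    have ds: "d 0 = 1" "d (Suc 0) = 0" "d 2 = b - a" "d 3 = 0" "d 4 = 3 * (b - a)\<^sup>2"
      using I(3)[OF a0] I(4)[OF a0] I(5)[OF a0] I(6)[OF a0] by (auto simp: d_def prob_space)
    have ys: "y 0 = 1" "y (Suc 0) = 0" "y 4 = 3 * (y 2)\<^sup>2"
      using IH by (auto simp: y_def prob_space)
    have p4: "(\<lambda>\<omega>. (Y \<omega> + c b * D \<omega>) ^ 4) = (\<lambda>\<omega>. Y \<omega> ^ 4 * D \<omega> ^ 0 + (4 * c b) * (Y \<omega> ^ 3 * D \<omega> ^ 1)
       + (6 * (c b)\<^sup>2) * (Y \<omega> ^ 2 * D \<omega> ^ 2) + (4 * (c b) ^ 3) * (Y \<omega> ^ 1 * D \<omega> ^ 3) + (c b) ^ 4 * (Y \<omega> ^ 0 * D \<omega> ^ 4))"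
    proof (rule ext)
      show "(Y \<omega> + c b * D \<omega>) ^ 4 = Y \<omega> ^ 4 * D \<omega> ^ 0 + (4 * c b) * (Y \<omega> ^ 3 * D \<omega> ^ 1)
       + (6 * (c b)\<^sup>2) * (Y \<omega> ^ 2 * D \<omega> ^ 2) + (4 * (c b) ^ 3) * (Y \<omega> ^ 1 * D \<omega> ^ 3) + (c b) ^ 4 * (Y \<omega> ^ 0 * D \<omega> ^ 4)" for \<omega>
        by simp algebra
    qed
    have h4: "has_bochner_integral M (\<lambda>\<omega>. (Y \<omega> + c b * D \<omega>) ^ 4)
      (y 4 * d 0 + (4 * c b) * (y 3 * d 1) + (6 * (c b)\<^sup>2) * (y 2 * d 2) + (4 * (c b) ^ 3) * (y 1 * d 3) + (c b) ^ 4 * (y 0 * d 4))"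
      unfolding p4 by (intro has_bochner_integral_add has_bochner_integral_mult_right hb) auto
    have p2: "(\<lambda>\<omega>. (Y \<omega> + c b * D \<omega>)\<^sup>2) = (\<lambda>\<omega>. Y \<omega> ^ 2 * D \<omega> ^ 0 + (2 * c b) * (Y \<omega> ^ 1 * D \<omega> ^ 1)
       + (c b)\<^sup>2 * (Y \<omega> ^ 0 * D \<omega> ^ 2))"
      by (rule ext) (simp add: power2_eq_square algebra_simps)
    have h2: "has_bochner_integral M (\<lambda>\<omega>. (Y \<omega> + c b * D \<omega>)\<^sup>2)
      (y 2 * d 0 + (2 * c b) * (y 1 * d 1) + (c b)\<^sup>2 * (y 0 * d 2))"
      unfolding p2 by (intro has_bochner_integral_add has_bochner_integral_mult_right hb) auto
    have e2: "expectation (\<lambda>\<omega>. (Y \<omega> + c b * D \<omega>)\<^sup>2) = y 2 + (c b)\<^sup>2 * (b - a)"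
      using has_bochner_integral_integral_eq[OF h2] by (simp add: ds ys)
    \<comment> \<open>The odd moments of \<open>D\<close> vanish. The factor 6 of the mixed term is
      twice 3, so the three remaining terms complete a square and the constant 3 reproduces
      itself.\<close>
    have "expectation (\<lambda>\<omega>. (Y \<omega> + c b * D \<omega>) ^ 4) = 3 * (y 2)\<^sup>2 + 6 * (c b)\<^sup>2 * (y 2 * (b - a)) + 3 * (c b) ^ 4 * (b - a)\<^sup>2"
      using has_bochner_integral_integral_eq[OF h4] by (simp add: ds ys)
    also have "\<dots> = 3 * (y 2 + (c b)\<^sup>2 * (b - a))\<^sup>2" by algebra
    finally have e4: "expectation (\<lambda>\<omega>. (Y \<omega> + c b * D \<omega>) ^ 4) = 3 * (y 2 + (c b)\<^sup>2 * (b - a))\<^sup>2" .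
    have i4: "integrable M (\<lambda>\<omega>. (Y \<omega> + c b * D \<omega>) ^ 4)" using h4 by (rule integrable.intros)
    have e1: "expectation (\<lambda>\<omega>. Y \<omega> + c b * D \<omega>) = 0"
      using Yk[of 1] I(2)[OF a0, of 1] IH(3) I(3)[OF a0] by simp
    have "W s \<in> measurable (sigma (space M) (F b)) borel" if "s \<in> insert t (insert b A)" for s
      using that insert.prems insert.hyps tb t
      by (intro wiener_measurable_filtration[OF fi W]) (auto intro: less_imp_le order_trans)
    then have mb: "stepX W t (insert b A) c \<in> measurable (sigma (space M) (F b)) borel"
      unfolding stepX_def[abs_def]
      by (intro borel_measurable_sum borel_measurable_times borel_measurable_diff) auto
    show ?thesis
      unfolding Mb
      using mb i4 e1 unfolding Z_eq e4 e2 by simp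
  qed
qed

section \<open>Step functions and Isserlis' formula\<close>

lemma has_bochner_integral_inner:
  "l2 M X \<Longrightarrow> l2 M Y \<Longrightarrow> has_bochner_integral M (\<lambda>x. X x * Y x) (\<integral>x. X x * Y x \<partial>M)"
  by (simp add: has_bochner_integral_iff l2_mult)

text \<open>Polarisation: closure of \<open>V\<close> under linear combinations recovers the mixed
  moment from fourth powers, so the fourth-moment identity plays the part of a joint Gaussian
  law.\<close>

lemma (in prob_space) isserlis:
  fixes V :: "('a \<Rightarrow> real) set"
  assumes V: "\<And>Z. Z \<in> V \<Longrightarrow> Z \<in> borel_measurable M"
      "\<And>Z. Z \<in> V \<Longrightarrow> integrable M (\<lambda>\<omega>. (Z \<omega>) ^ 4)"
      "\<And>Z. Z \<in> V \<Longrightarrow> expectation (\<lambda>\<omega>. (Z \<omega>) ^ 4) = 3 * (expectation (\<lambda>\<omega>. (Z \<omega>)\<^sup>2))\<^sup>2"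
    and cl: "\<And>X Y k. X \<in> V \<Longrightarrow> Y \<in> V \<Longrightarrow> (\<lambda>\<omega>. X \<omega> + k * Y \<omega>) \<in> V"
    and mem: "X \<in> V" "Y \<in> V" "U \<in> V" "Z \<in> V"
  defines "E \<equiv> (\<lambda>A B. expectation (\<lambda>\<omega>. A \<omega> * B \<omega>))"
  shows "has_bochner_integral M (\<lambda>\<omega>. X \<omega> * Y \<omega> * (U \<omega> * Z \<omega>)) (E X Y * E U Z + E X U * E Y Z + E X Z * E Y U)"
proof -
  define P where "P a b c \<omega> = X \<omega> + a * Y \<omega> + b * U \<omega> + c * Z \<omega>" for a b c \<omega>
  define q where "q a b c = E X X + a\<^sup>2 * E Y Y + b\<^sup>2 * E U U + c\<^sup>2 * E Z Z
    + (2 * a) * E X Y + (2 * b) * E X U + (2 * c) * E X Z + (2 * a * b) * E Y U + (2 * a * c) * E Y Z + (2 * b * c) * E U Z" for a b c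
  have P: "P a b c \<in> V" for a b c
    unfolding P_def[abs_def] by (intro cl mem)
  have l2V: "l2 M A" if "A \<in> V" for A
    using V[OF that] integrable_power_le_4[of A 2] by (auto simp: l2_def)
  have hb: "has_bochner_integral M (\<lambda>\<omega>. A \<omega> * B \<omega>) (E A B)" if "A \<in> V" "B \<in> V" for A B
    unfolding E_def using that by (intro has_bochner_integral_inner l2V)
  have P2: "has_bochner_integral M (\<lambda>\<omega>. (P a b c \<omega>)\<^sup>2) (q a b c)" for a b c
  proof -
    have "(\<lambda>\<omega>. (P a b c \<omega>)\<^sup>2) = (\<lambda>\<omega>. X \<omega> * X \<omega> + a\<^sup>2 * (Y \<omega> * Y \<omega>) + b\<^sup>2 * (U \<omega> * U \<omega>) + c\<^sup>2 * (Z \<omega> * Z \<omega>)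
      + (2 * a) * (X \<omega> * Y \<omega>) + (2 * b) * (X \<omega> * U \<omega>) + (2 * c) * (X \<omega> * Z \<omega>) + (2 * a * b) * (Y \<omega> * U \<omega>)
      + (2 * a * c) * (Y \<omega> * Z \<omega>) + (2 * b * c) * (U \<omega> * Z \<omega>))"
      unfolding P_def by (rule ext) algebra
    then show ?thesis
      unfolding q_def
      by (simp only:) (intro has_bochner_integral_add has_bochner_integral_mult_right hb mem)
  qed
  have P4: "has_bochner_integral M (\<lambda>\<omega>. (P a b c \<omega>) ^ 4) (3 * (q a b c)\<^sup>2)" for a b c
    using V(2,3)[OF P[of a b c]] has_bochner_integral_integral_eq[OF P2[of a b c]]
    by (simp add: has_bochner_integral_iff)
  \<comment> \<open>\<open>P a b c ^ 4\<close> contains \<open>X Y U Z\<close> with coefficient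
    \<open>24 a b c\<close>. Weighting with the sign \<open>a b c\<close> and summing over the eight
    choices of signs kills every other monomial and leaves \<open>8 * 24 = 192\<close>.\<close>
  have e1: "(\<lambda>\<omega>. X \<omega> * Y \<omega> * (U \<omega> * Z \<omega>)) = (\<lambda>\<omega>. (1 / 192) * ((P 1 1 1 \<omega>) ^ 4 - (P 1 1 (-1) \<omega>) ^ 4
     - (P 1 (-1) 1 \<omega>) ^ 4 + (P 1 (-1) (-1) \<omega>) ^ 4 - (P (-1) 1 1 \<omega>) ^ 4 + (P (-1) 1 (-1) \<omega>) ^ 4
     + (P (-1) (-1) 1 \<omega>) ^ 4 - (P (-1) (-1) (-1) \<omega>) ^ 4))"
    unfolding P_def by (rule ext) (simp, algebra)
  have e2: "has_bochner_integral M \<dots> ((1 / 192) * (3 * (q 1 1 1)\<^sup>2 - 3 * (q 1 1 (-1))\<^sup>2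
     - 3 * (q 1 (-1) 1)\<^sup>2 + 3 * (q 1 (-1) (-1))\<^sup>2 - 3 * (q (-1) 1 1)\<^sup>2 + 3 * (q (-1) 1 (-1))\<^sup>2
     + 3 * (q (-1) (-1) 1)\<^sup>2 - 3 * (q (-1) (-1) (-1))\<^sup>2))"
    by (intro has_bochner_integral_add has_bochner_integral_diff has_bochner_integral_mult_right P4)
  have e3: "(1 / 192) * (3 * (q 1 1 1)\<^sup>2 - 3 * (q 1 1 (-1))\<^sup>2
     - 3 * (q 1 (-1) 1)\<^sup>2 + 3 * (q 1 (-1) (-1))\<^sup>2 - 3 * (q (-1) 1 1)\<^sup>2 + 3 * (q (-1) 1 (-1))\<^sup>2
     + 3 * (q (-1) (-1) 1)\<^sup>2 - 3 * (q (-1) (-1) (-1))\<^sup>2) = E X Y * E U Z + E X U * E Y Z + E X Z * E Y U"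
    unfolding q_def by (simp, algebra)
  show ?thesis using e2 unfolding e1 e3 .
qed

section \<open>Step functions, their stochastic integrals and the isometry\<close>

lemma step_extend:
  assumes "finite S'" "S \<subseteq> S'"
  shows "stepg t S c = stepg t S' (\<lambda>s. if s \<in> S then c s else 0)"
    and "stepX w t S c = stepX w t S' (\<lambda>s. if s \<in> S then c s else 0)"
  unfolding stepg_def[abs_def] stepX_def[abs_def] using assms
  by (intro ext sum.mono_neutral_cong_left; simp)+

lemma step_lincomb:
  fixes c c' :: "real \<Rightarrow> real" and k :: real
  assumes "finite S" "finite S'"
  defines "c'' \<equiv> (\<lambda>s. (if s \<in> S then c s else 0) + k * (if s \<in> S' then c' s else 0))"
  shows "(\<lambda>x. stepg t S c x + k * stepg t S' c' x) = stepg t (S \<union> S') c''"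
    and "(\<lambda>x. stepX w t S c x + k * stepX w t S' c' x) = stepX w t (S \<union> S') c''"
proof -
  have "finite (S \<union> S')" using assms by simp
  note e = step_extend[OF this, of S] step_extend[OF this, of S']
  show "(\<lambda>x. stepg t S c x + k * stepg t S' c' x) = stepg t (S \<union> S') c''"
    unfolding e(1)[OF Un_upper1] e(3)[OF Un_upper2]
    unfolding stepg_def c''_def sum_distrib_left sum.distrib[symmetric]
    by (intro ext sum.cong) (auto simp: algebra_simps)
  show "(\<lambda>x. stepX w t S c x + k * stepX w t S' c' x) = stepX w t (S \<union> S') c''"
    unfolding e(2)[OF Un_upper1] e(4)[OF Un_upper2]
    unfolding stepX_def c''_def sum_distrib_left sum.distrib[symmetric]
    by (intro ext sum.cong) (auto simp: algebra_simps)
qed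

text \<open>A relation, because one step function has many data \<open>S\<close>, \<open>c\<close>;
  linear operations can then be performed on integrand and integral simultaneously.\<close>

definition spair :: "(real \<Rightarrow> 'a \<Rightarrow> real) \<Rightarrow> real \<Rightarrow> real \<Rightarrow> (real \<Rightarrow> real) \<Rightarrow> ('a \<Rightarrow> real) \<Rightarrow> bool" where
  "spair w t T g X \<longleftrightarrow> (\<exists>S c. finite S \<and> S \<subseteq> {t..T} \<and> g = stepg t S c \<and> X = stepX w t S c)"

lemma spair_lincomb:
  assumes "spair w t T g X" "spair w t T h Y"
  shows "spair w t T (\<lambda>x. g x + k * h x) (\<lambda>x. X x + k * Y x)"
proof -
  obtain S c S' c' where *: "finite S" "S \<subseteq> {t..T}" "g = stepg t S c" "X = stepX w t S c"
    "finite S'" "S' \<subseteq> {t..T}" "h = stepg t S' c'" "Y = stepX w t S' c'"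
    using assms unfolding spair_def by blast
  show ?thesis
    unfolding spair_def *(3,4,7,8) step_lincomb[OF *(1,5)]
    using *(1,2,5,6) by (intro exI[of _ "S \<union> S'"] exI) auto
qed

abbreviation mu :: "real \<Rightarrow> real \<Rightarrow> real measure" where
  "mu t T \<equiv> restrict_space lborel {t..T}"

lemma finite_measure_mu: "finite_measure (mu t T)"
  by (rule finite_measureI) (use emeasure_compact_finite[of "{t..T}"] in \<open>auto simp: emeasure_restrict_space less_top\<close>)

lemma space_mu [simp]: "space (mu t T) = {t..T}"
  by (simp add: space_restrict_space)

lemma measure_mu: "t \<le> T \<Longrightarrow> measure (mu t T) {t..T} = T - t"
  by (simp add: measure_restrict_space)

lemma measurable_mu_borel: "f \<in> borel_measurable borel \<Longrightarrow> f \<in> borel_measurable (mu t T)"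
  by (rule measurable_restrict_space1) simp

lemma stepg_l2: "l2 (mu t T) (stepg t S c)"
proof -
  interpret finite_measure "mu t T" by (rule finite_measure_mu)
  have "l2 (mu t T) (\<lambda>x. c s * indicator {t<..s} x)" for s
    by (intro l2_scale l2_bounded[of _ 1] measurable_mu_borel) (auto simp: indicator_def)
  then show ?thesis unfolding stepg_def[abs_def] by (intro l2_sum)
qed

lemma inner_indicator_mu:
  assumes "s \<in> {t..T}" "u \<in> {t..T}"
  shows "(\<integral>x. indicator {t<..s} x * indicator {t<..u} x \<partial>mu t T) = min s u - (t::real)"
proof -
  have "(\<lambda>x. indicator {t<..s} x * indicator {t<..u} x) = (indicator {t<..min s u} :: real \<Rightarrow> real)"
    by (auto simp: indicator_def)
  then have "(\<integral>x. indicator {t<..s} x * indicator {t<..u} x \<partial>mu t T) = measure (mu t T) ({t<..min s u} \<inter> {t..T})"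
    by simp
  also have "{t<..min s u} \<inter> {t..T} = {t<..min s u}" using assms by auto
  also have "measure (mu t T) {t<..min s u} = measure lborel {t<..min s u}"
    using assms by (intro measure_restrict_space) auto
  finally show ?thesis using assms by simp
qed

lemma integral_stepg:
  assumes "finite S" "S \<subseteq> {t..T}"
  shows "(\<integral>x. stepg t S c x \<partial>mu t T) = (\<Sum>s\<in>S. c s * (s - t))"
proof -
  interpret finite_measure "mu t T" by (rule finite_measure_mu)
  have i: "integrable (mu t T) (indicator {t<..s} :: real \<Rightarrow> real)" for s
    by (intro l2_integrable l2_bounded[of _ 1] measurable_mu_borel) (auto simp: indicator_def)
  have "(\<integral>x. stepg t S c x \<partial>mu t T) = (\<Sum>s\<in>S. c s * (\<integral>x. indicator {t<..s} x \<partial>mu t T))"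
    unfolding stepg_def using i by (subst Bochner_Integration.integral_sum) auto
  also have "\<dots> = (\<Sum>s\<in>S. c s * (s - t))"
  proof (intro sum.cong refl)
    fix s assume "s \<in> S"
    then have s: "s \<in> {t..T}" using assms by auto
    have "(\<integral>x. indicator {t<..s} x * indicator {t<..s} x \<partial>mu t T) = s - t"
      using inner_indicator_mu[OF s s] by simp
    moreover have "(\<lambda>x. indicator {t<..s} x * indicator {t<..s} x) = (indicator {t<..s} :: real \<Rightarrow> real)"
      by (auto simp: indicator_def)
    ultimately show "c s * (\<integral>x. indicator {t<..s} x \<partial>mu t T) = c s * (s - t)" by simp
  qed
  finally show ?thesis .
qed

lemma inner_stepg:
  assumes "finite S" "S \<subseteq> {t..T}" "finite S'" "S' \<subseteq> {t..T}"
  shows "(\<integral>x. stepg t S c x * stepg t S' c' x \<partial>mu t T) = (\<Sum>s\<in>S. \<Sum>u\<in>S'. c s * c' u * (min s u - t))"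
proof -
  interpret finite_measure "mu t T" by (rule finite_measure_mu)
  have hb: "has_bochner_integral (mu t T) (\<lambda>x. indicator {t<..s} x * indicator {t<..u} x) (min s u - t)"
    if "s \<in> S" "u \<in> S'" for s u
  proof -
    have "integrable (mu t T) (\<lambda>x. indicator {t<..s} x * indicator {t<..u} x :: real)"
      by (intro l2_mult l2_bounded[of _ 1] measurable_mu_borel) (auto simp: indicator_def)
    then show ?thesis
      using inner_indicator_mu[of s t T u] that assms(2,4) by (simp add: has_bochner_integral_iff subset_eq)
  qed
  have eq: "(\<lambda>x. stepg t S c x * stepg t S' c' x) = (\<lambda>x. \<Sum>s\<in>S. \<Sum>u\<in>S'. c s * c' u * (indicator {t<..s} x * indicator {t<..u} x))"
    by (auto simp: stepg_def sum_product algebra_simps)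
  show ?thesis unfolding eq by (rule has_bochner_integral_integral_eq) (intro has_bochner_integral_sum has_bochner_integral_mult_right hb)
qed

lemma (in prob_space) inner_stepX:
  assumes fi: "rc_filtration M F" and W: "wiener_process M F W" and t: "0 \<le> t"
    and S: "finite S" "S \<subseteq> {t..}" "finite S'" "S' \<subseteq> {t..}"
  shows "expectation (\<lambda>\<omega>. stepX W t S c \<omega> * stepX W t S' c' \<omega>) = (\<Sum>s\<in>S. \<Sum>u\<in>S'. c s * c' u * (min s u - t))"
proof -
  have hb: "has_bochner_integral M (\<lambda>\<omega>. (W s \<omega> - W t \<omega>) * (W u \<omega> - W t \<omega>)) (min s u - t)"
    if "s \<in> S" "u \<in> S'" for s u
    using wiener_covariance[OF fi W t, of s u] that S by (auto simp: has_bochner_integral_iff)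
  have eq: "(\<lambda>\<omega>. stepX W t S c \<omega> * stepX W t S' c' \<omega>) = (\<lambda>\<omega>. \<Sum>s\<in>S. \<Sum>u\<in>S'. c s * c' u * ((W s \<omega> - W t \<omega>) * (W u \<omega> - W t \<omega>)))"
    by (auto simp: stepX_def sum_product algebra_simps)
  show ?thesis unfolding eq by (rule has_bochner_integral_integral_eq) (intro has_bochner_integral_sum has_bochner_integral_mult_right hb)
qed

text \<open>Indicators and increments from \<open>t\<close> have the same Gram matrix
  \<open>min s u - t\<close>, so both sides are one and the same double sum.\<close>

lemma (in prob_space) spair_isometry:
  assumes fi: "rc_filtration M F" and W: "wiener_process M F W" and t: "0 \<le> t"
    and "spair W t T g X" "spair W t T h Y"
  shows "expectation (\<lambda>\<omega>. X \<omega> * Y \<omega>) = (\<integral>x. g x * h x \<partial>mu t T)"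
proof -
  obtain S c S' c' where *: "finite S" "S \<subseteq> {t..T}" "g = stepg t S c" "X = stepX W t S c"
    "finite S'" "S' \<subseteq> {t..T}" "h = stepg t S' c'" "Y = stepX W t S' c'"
    using assms(4,5) unfolding spair_def by blast
  show ?thesis
    unfolding *(3,4,7,8) inner_stepg[OF *(1,2,5,6)]
    using * by (intro inner_stepX[OF fi W t]) auto
qed

lemma (in prob_space) spair_l2:
  assumes fi: "rc_filtration M F" and W: "wiener_process M F W" and t: "0 \<le> t"
    and "spair W t T g X"
  shows "X \<in> borel_measurable M" "integrable M (\<lambda>\<omega>. X \<omega> ^ 4)" "l2 M X"
    "expectation (\<lambda>\<omega>. X \<omega> ^ 4) = 3 * (expectation (\<lambda>\<omega>. (X \<omega>)\<^sup>2))\<^sup>2"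
proof -
  obtain S c where *: "finite S" "S \<subseteq> {t..T}" "X = stepX W t S c"
    using assms(4) unfolding spair_def by blast
  have "S \<subseteq> {t..}" using * by auto
  note I = wiener_fourth_moment[OF fi W t *(1) this, of c, folded *(3)]
  show m: "X \<in> borel_measurable M"
    by (rule borel_measurable_subalgebra[OF _ _ conjunct1[OF I]]) (use filtrationD[OF fi] in auto)
  show "integrable M (\<lambda>\<omega>. X \<omega> ^ 4)" "expectation (\<lambda>\<omega>. X \<omega> ^ 4) = 3 * (expectation (\<lambda>\<omega>. (X \<omega>)\<^sup>2))\<^sup>2"
    using I by auto
  then show "l2 M X" using integrable_power_le_4[OF m, of 2] m by (simp add: l2_def)
qed

text \<open>\<open>V\<close> is the space of all step integrals over one Wiener process; afterwards
  the isometry turns covariances into inner products of integrands.\<close>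

lemma (in prob_space) spair_isserlis:
  assumes fi: "rc_filtration M F" and W: "wiener_process M F W" and t: "0 \<le> t"
    and p: "spair W t T g1 X1" "spair W t T g2 X2" "spair W t T g3 X3" "spair W t T g4 X4"
  defines "I \<equiv> (\<lambda>g h. \<integral>x. g x * h x \<partial>mu t T)"
  shows "has_bochner_integral M (\<lambda>\<omega>. X1 \<omega> * X2 \<omega> * (X3 \<omega> * X4 \<omega>)) (I g1 g2 * I g3 g4 + I g1 g3 * I g2 g4 + I g1 g4 * I g2 g3)"
proof -
  let ?V = "{X. \<exists>g. spair W t T g X}"
  note iso = spair_isometry[OF fi W t]
  have "has_bochner_integral M (\<lambda>\<omega>. X1 \<omega> * X2 \<omega> * (X3 \<omega> * X4 \<omega>))
    (expectation (\<lambda>\<omega>. X1 \<omega> * X2 \<omega>) * expectation (\<lambda>\<omega>. X3 \<omega> * X4 \<omega>)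
     + expectation (\<lambda>\<omega>. X1 \<omega> * X3 \<omega>) * expectation (\<lambda>\<omega>. X2 \<omega> * X4 \<omega>)
     + expectation (\<lambda>\<omega>. X1 \<omega> * X4 \<omega>) * expectation (\<lambda>\<omega>. X2 \<omega> * X3 \<omega>))"
  proof (rule isserlis[of ?V])
    fix Z assume "Z \<in> ?V"
    then obtain g where "spair W t T g Z" by blast
    note I = spair_l2[OF fi W t this]
    show "Z \<in> borel_measurable M" by (rule I)
    show "integrable M (\<lambda>\<omega>. Z \<omega> ^ 4)" by (rule I)
    show "expectation (\<lambda>\<omega>. Z \<omega> ^ 4) = 3 * (expectation (\<lambda>\<omega>. (Z \<omega>)\<^sup>2))\<^sup>2" by (rule I)
  next
    fix X Y k assume "X \<in> ?V" "Y \<in> ?V"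
    then obtain g h where "spair W t T g X" "spair W t T h Y" by blast
    from spair_lincomb[OF this] show "(\<lambda>\<omega>. X \<omega> + k * Y \<omega>) \<in> ?V" by blast
  qed (use p in blast)+
  then show ?thesis
    unfolding I_def using p by (simp add: iso[OF p(1,2)] iso[OF p(3,4)] iso[OF p(1,3)] iso[OF p(2,4)] iso[OF p(1,4)] iso[OF p(2,3)])
qed

text \<open>Independence is given for whole paths as points of the product space, hence passes to
  measurable functionals of them. Restriction to singleton index sets brings two single components
  into the form of \<open>indep_var\<close>.\<close>

lemma (in prob_space) indep_processes:
  fixes f :: "nat \<Rightarrow> real \<Rightarrow> 'a \<Rightarrow> real"
  assumes ind: "indep_vars (\<lambda>i. Pi\<^sub>M UNIV (\<lambda>_. borel)) (\<lambda>i \<omega>. \<lambda>s. f i s \<omega>) I"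
    and ij: "i \<in> I" "j \<in> I" "i \<noteq> j"
    and G: "G \<in> borel_measurable (Pi\<^sub>M UNIV (\<lambda>_. borel))" "H \<in> borel_measurable (Pi\<^sub>M UNIV (\<lambda>_. borel))"
  shows "indep_var borel (\<lambda>\<omega>. G (\<lambda>s. f i s \<omega>)) borel (\<lambda>\<omega>. H (\<lambda>s. f j s \<omega>))"
proof -
  let ?P = "Pi\<^sub>M UNIV (\<lambda>_::real. borel :: real measure)"
  have "indep_var (PiM {i} (\<lambda>_. ?P)) (\<lambda>\<omega>. restrict (\<lambda>i s. f i s \<omega>) {i}) (PiM {j} (\<lambda>_. ?P)) (\<lambda>\<omega>. restrict (\<lambda>i s. f i s \<omega>) {j})"
    using ij by (intro indep_var_restrict[OF ind]) auto
  moreover have "(\<lambda>h. G (h i)) \<in> borel_measurable (PiM {i} (\<lambda>_. ?P))"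
    by (rule measurable_compose[OF _ G(1)]) (rule measurable_component_singleton, simp)
  moreover have "(\<lambda>h. H (h j)) \<in> borel_measurable (PiM {j} (\<lambda>_. ?P))"
    by (rule measurable_compose[OF _ G(2)]) (rule measurable_component_singleton, simp)
  ultimately have "indep_var borel ((\<lambda>h. G (h i)) \<circ> (\<lambda>\<omega>. restrict (\<lambda>i s. f i s \<omega>) {i})) borel ((\<lambda>h. H (h j)) \<circ> (\<lambda>\<omega>. restrict (\<lambda>i s. f i s \<omega>) {j}))"
    by (rule indep_var_compose)
  then show ?thesis by (simp add: comp_def)
qed

text \<open>Regrouped by component, \<open>X1 X3\<close> depends on path \<open>i\<close> and
  \<open>X2 X4\<close> on path \<open>j\<close>. The expectation factors, so one of the three
  Isserlis pairings remains and no trace appears.\<close>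

lemma (in prob_space) spair_cross:
  fixes f :: "nat \<Rightarrow> real \<Rightarrow> 'a \<Rightarrow> real"
  assumes fi: "rc_filtration M F" and W: "wiener_process M F (f i)" "wiener_process M F (f j)" and t: "0 \<le> t"
    and ind: "indep_vars (\<lambda>i. Pi\<^sub>M UNIV (\<lambda>_. borel)) (\<lambda>i \<omega>. \<lambda>s. f i s \<omega>) {1..m}"
    and ij: "i \<in> {1..m}" "j \<in> {1..m}" "i \<noteq> j"
    and p: "spair (f i) t T g1 X1" "spair (f j) t T g2 X2" "spair (f i) t T g3 X3" "spair (f j) t T g4 X4"
  defines "I \<equiv> (\<lambda>g h. \<integral>x. g x * h x \<partial>mu t T)"
  shows "has_bochner_integral M (\<lambda>\<omega>. X1 \<omega> * X2 \<omega> * (X3 \<omega> * X4 \<omega>)) (I g1 g3 * I g2 g4)"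
proof -
  obtain S1 c1 S2 c2 S3 c3 S4 c4 where e: "X1 = stepX (f i) t S1 c1" "X2 = stepX (f j) t S2 c2"
    "X3 = stepX (f i) t S3 c3" "X4 = stepX (f j) t S4 c4"
    using p unfolding spair_def by blast
  let ?P = "Pi\<^sub>M UNIV (\<lambda>_::real. borel :: real measure)"
  \<comment> \<open>As functionals of a path these products read finitely many coordinates, which
    makes them measurable on the product space.\<close>
  define G where "G S c S' c' h = (\<Sum>s\<in>S. c s * (h s - h t)) * (\<Sum>s\<in>S'. c' s * (h s - h t :: real))" for S S' c c' h
  have [measurable]: "(\<lambda>h. h s) \<in> borel_measurable ?P" for s
    by (rule measurable_component_singleton) simp
  have G: "G S c S' c' \<in> borel_measurable ?P" for S c S' c'
    unfolding G_def[abs_def] by measurable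
  have "indep_var borel (\<lambda>\<omega>. G S1 c1 S3 c3 (\<lambda>s. f i s \<omega>)) borel (\<lambda>\<omega>. G S2 c2 S4 c4 (\<lambda>s. f j s \<omega>))"
    by (rule indep_processes[OF ind ij G G])
  then have iv: "indep_var borel (\<lambda>\<omega>. X1 \<omega> * X3 \<omega>) borel (\<lambda>\<omega>. X2 \<omega> * X4 \<omega>)"
    by (simp add: G_def e stepX_def)
  have i: "integrable M (\<lambda>\<omega>. X1 \<omega> * X3 \<omega>)" "integrable M (\<lambda>\<omega>. X2 \<omega> * X4 \<omega>)"
    using spair_l2(3)[OF fi W(1) t p(1)] spair_l2(3)[OF fi W(1) t p(3)]
      spair_l2(3)[OF fi W(2) t p(2)] spair_l2(3)[OF fi W(2) t p(4)] by (auto intro: l2_mult)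
  show ?thesis
    using indep_var_lebesgue_integral[OF iv i] indep_var_integrable[OF iv i]
      spair_isometry[OF fi W(1) t p(1,3)] spair_isometry[OF fi W(2) t p(2,4)]
    by (simp add: has_bochner_integral_iff I_def mult.assoc mult.left_commute[of "X2 _"])
qed

section \<open>Second moments of finite-rank quadratic forms\<close>

text \<open>The squared \<open>L2\<close> norm of the kernel \<open>\<Sum>j. a j x * b j y\<close>
  on the product space, expanded into inner products (see \<open>gram_eq_integral\<close>). In this
  form it meets the expectations directly, and the bounds below integrate one variable at a
  time.\<close>

definition gram :: "'b measure \<Rightarrow> 'j set \<Rightarrow> ('j \<Rightarrow> 'b \<Rightarrow> real) \<Rightarrow> ('j \<Rightarrow> 'b \<Rightarrow> real) \<Rightarrow> real" where
  "gram N J a b = (\<Sum>j\<in>J. \<Sum>k\<in>J. (\<integral>x. a j x * a k x \<partial>N) * (\<integral>x. b j x * b k x \<partial>N))"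

lemma gram_commute: "gram N J a b = gram N J b a"
  unfolding gram_def by (simp add: mult.commute)

lemma has_bochner_integral_double_sum:
  assumes "\<And>j. j \<in> J \<Longrightarrow> l2 N (g j)" "\<And>j. j \<in> J \<Longrightarrow> l2 N (h j)"
  shows "has_bochner_integral N (\<lambda>x. \<Sum>j\<in>J. \<Sum>k\<in>J. c j k * (g j x * h k x)) (\<Sum>j\<in>J. \<Sum>k\<in>J. c j k * (\<integral>x. g j x * h k x \<partial>N))"
  by (intro has_bochner_integral_sum has_bochner_integral_mult_right has_bochner_integral_inner assms)

lemma square_of_sum:
  fixes u v :: "'j \<Rightarrow> real"
  shows "(\<Sum>j\<in>J. u j * v j)\<^sup>2 = (\<Sum>j\<in>J. \<Sum>k\<in>J. (u j * u k) * (v j * v k))"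
  by (simp add: power2_eq_square sum_product algebra_simps)

context finite_measure
begin

lemma square_integral_le:
  assumes "l2 M g"
  shows "(\<integral>x. g x \<partial>M)\<^sup>2 \<le> measure M (space M) * (\<integral>x. (g x)\<^sup>2 \<partial>M)"
  using integral_cauchy_schwarz'[OF assms l2_const[of 1]] by (simp add: mult.commute)

lemma square_integral_lincomb_le:
  assumes l: "\<And>j. j \<in> J \<Longrightarrow> l2 M (a j)"
  shows "(\<Sum>j\<in>J. c j * (\<integral>x. a j x \<partial>M))\<^sup>2
    \<le> measure M (space M) * (\<Sum>j\<in>J. \<Sum>k\<in>J. (c j * c k) * (\<integral>x. a j x * a k x \<partial>M))"
proof -
  have "(\<Sum>j\<in>J. c j * (\<integral>x. a j x \<partial>M)) = (\<integral>x. (\<Sum>j\<in>J. c j * a j x) \<partial>M)"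
    using l l2_integrable by (subst Bochner_Integration.integral_sum) auto
  also have "(\<dots>)\<^sup>2 \<le> measure M (space M) * (\<integral>x. (\<Sum>j\<in>J. c j * a j x)\<^sup>2 \<partial>M)"
    by (intro square_integral_le l2_sum l2_scale l)
  also have "(\<integral>x. (\<Sum>j\<in>J. c j * a j x)\<^sup>2 \<partial>M) = (\<Sum>j\<in>J. \<Sum>k\<in>J. (c j * c k) * (\<integral>x. a j x * a k x \<partial>M))"
    unfolding square_of_sum
    by (rule has_bochner_integral_integral_eq[OF has_bochner_integral_double_sum]) (use l in auto)
  finally show ?thesis .
qed

text \<open>The left side is the squared norm of the kernel integrated over its first variable.
  Cauchy-Schwarz in that variable costs the total mass; then the second variable is integrated. It
  serves the case where one integrator is time.\<close>

lemma gram_left_mean_le: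
  assumes l: "\<And>j. j \<in> J \<Longrightarrow> l2 M (a j)" "\<And>j. j \<in> J \<Longrightarrow> l2 M (b j)"
  shows "(\<Sum>j\<in>J. \<Sum>k\<in>J. ((\<integral>x. a j x \<partial>M) * (\<integral>x. a k x \<partial>M)) * (\<integral>x. b j x * b k x \<partial>M))
     \<le> measure M (space M) * gram M J a b"
proof -
  let ?al = "\<lambda>j. \<integral>x. a j x \<partial>M" and ?I = "\<lambda>g h. \<integral>x. g x * h x \<partial>M"
  have h1: "has_bochner_integral M (\<lambda>y. \<Sum>j\<in>J. \<Sum>k\<in>J. (?al j * ?al k) * (b j y * b k y))
     (\<Sum>j\<in>J. \<Sum>k\<in>J. (?al j * ?al k) * ?I (b j) (b k))"
    by (rule has_bochner_integral_double_sum) (use l in auto)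
  have h2: "has_bochner_integral M (\<lambda>y. measure M (space M) * (\<Sum>j\<in>J. \<Sum>k\<in>J. ?I (a j) (a k) * (b j y * b k y)))
     (measure M (space M) * gram M J a b)"
    unfolding gram_def
    by (intro has_bochner_integral_mult_right has_bochner_integral_double_sum) (use l in auto)
  have le: "(\<Sum>j\<in>J. \<Sum>k\<in>J. (?al j * ?al k) * (b j y * b k y))
     \<le> measure M (space M) * (\<Sum>j\<in>J. \<Sum>k\<in>J. ?I (a j) (a k) * (b j y * b k y))" for y
    using square_integral_lincomb_le[where J=J and c="\<lambda>j. b j y", OF l(1)]
    by (simp add: square_of_sum mult.commute)
  show ?thesis
    using integral_mono[OF integrable.intros[OF h1] integrable.intros[OF h2] le]
    unfolding has_bochner_integral_integral_eq[OF h1] has_bochner_integral_integral_eq[OF h2] .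
qed

text \<open>The left side is the inner product of the kernel with its transpose. For fixed
  \<open>y\<close> the sections \<open>u = K (x, y)\<close> and \<open>v = K (y, x)\<close> satisfy
  \<open>2 u v \<le> u^2 + v^2\<close>, and both squares integrate to the same norm.\<close>

lemma gram_transpose_le:
  assumes l: "\<And>j. j \<in> J \<Longrightarrow> l2 M (a j)" "\<And>j. j \<in> J \<Longrightarrow> l2 M (b j)"
  shows "(\<Sum>j\<in>J. \<Sum>k\<in>J. (\<integral>x. a j x * b k x \<partial>M) * (\<integral>x. b j x * a k x \<partial>M)) \<le> gram M J a b"
proof -
  let ?I = "\<lambda>g h. \<integral>x. g x * h x \<partial>M"
  let ?A = "\<lambda>y. \<Sum>j\<in>J. \<Sum>k\<in>J. ?I (a j) (a k) * (b j y * b k y)"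
  let ?B = "\<lambda>y. \<Sum>j\<in>J. \<Sum>k\<in>J. ?I (b j) (b k) * (a j y * a k y)"
  let ?C = "\<lambda>y. \<Sum>j\<in>J. \<Sum>k\<in>J. ?I (a j) (b k) * (b j y * a k y)"
  have h: "has_bochner_integral M ?A (gram M J a b)" "has_bochner_integral M ?B (gram M J b a)"
    "has_bochner_integral M ?C (\<Sum>j\<in>J. \<Sum>k\<in>J. ?I (a j) (b k) * ?I (b j) (a k))"
    unfolding gram_def
    by (intro has_bochner_integral_double_sum; use l in auto)+
  have le: "2 * ?C y \<le> ?A y + ?B y" for y
  proof -
    let ?u = "\<lambda>x. \<Sum>j\<in>J. b j y * a j x" and ?v = "\<lambda>x. \<Sum>j\<in>J. a j y * b j x"
    have lu: "l2 M ?u" "l2 M ?v" by (intro l2_sum l2_scale l; simp)+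
    have hu: "has_bochner_integral M (\<lambda>x. (?u x)\<^sup>2) (\<Sum>j\<in>J. \<Sum>k\<in>J. (b j y * b k y) * ?I (a j) (a k))"
      unfolding square_of_sum by (intro has_bochner_integral_double_sum l)
    have hv: "has_bochner_integral M (\<lambda>x. (?v x)\<^sup>2) (\<Sum>j\<in>J. \<Sum>k\<in>J. (a j y * a k y) * ?I (b j) (b k))"
      unfolding square_of_sum by (intro has_bochner_integral_double_sum l)
    have huv: "has_bochner_integral M (\<lambda>x. ?u x * ?v x) (\<Sum>j\<in>J. \<Sum>k\<in>J. (b j y * a k y) * ?I (a j) (b k))"
    proof -
      have "(\<lambda>x. ?u x * ?v x) = (\<lambda>x. \<Sum>j\<in>J. \<Sum>k\<in>J. (b j y * a k y) * (a j x * b k x))"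
        by (auto simp: sum_product algebra_simps)
      then show ?thesis by (simp only:) (intro has_bochner_integral_double_sum l)
    qed
    have "(\<integral>x. 2 * (?u x * ?v x) \<partial>M) \<le> (\<integral>x. (?u x)\<^sup>2 + (?v x)\<^sup>2 \<partial>M)"
    proof (rule integral_mono)
      show "2 * (?u x * ?v x) \<le> (?u x)\<^sup>2 + (?v x)\<^sup>2" for x
        using sum_squares_bound[of "?u x" "?v x"] by (simp add: mult.assoc)
    qed (use l2_mult[OF lu] lu[THEN l2_square] in auto)
    then show ?thesis
      using has_bochner_integral_integral_eq[OF hu] has_bochner_integral_integral_eq[OF hv]
        has_bochner_integral_integral_eq[OF huv] lu[THEN l2_square]
      by (simp add: mult.commute)
  qed
  have "(\<integral>y. 2 * ?C y \<partial>M) \<le> (\<integral>y. ?A y + ?B y \<partial>M)"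
    using h le by (intro integral_mono) (auto intro: integrable.intros)
  moreover have "(\<integral>y. 2 * ?C y \<partial>M) = 2 * (\<Sum>j\<in>J. \<Sum>k\<in>J. ?I (a j) (b k) * ?I (b j) (a k))"
    using has_bochner_integral_integral_eq[OF h(3)] by simp
  moreover have "(\<integral>y. ?A y + ?B y \<partial>M) = 2 * gram M J a b"
    using has_bochner_integral_integral_eq[OF has_bochner_integral_add[OF h(1,2)]]
    by (simp add: gram_commute[of M J b a])
  ultimately show ?thesis by simp
qed

lemma gram_nonneg:
  assumes l: "\<And>j. j \<in> J \<Longrightarrow> l2 M (a j)" "\<And>j. j \<in> J \<Longrightarrow> l2 M (b j)"
  shows "0 \<le> gram M J a b"
proof -
  let ?I = "\<lambda>g h. \<integral>x. g x * h x \<partial>M"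
  let ?A = "\<lambda>y. \<Sum>j\<in>J. \<Sum>k\<in>J. ?I (a j) (a k) * (b j y * b k y)"
  have h: "has_bochner_integral M ?A (gram M J a b)"
    unfolding gram_def by (intro has_bochner_integral_double_sum l)
  have "0 \<le> ?A y" for y
  proof -
    have "has_bochner_integral M (\<lambda>x. (\<Sum>j\<in>J. b j y * a j x)\<^sup>2) (\<Sum>j\<in>J. \<Sum>k\<in>J. (b j y * b k y) * ?I (a j) (a k))"
      unfolding square_of_sum by (intro has_bochner_integral_double_sum l)
    from has_bochner_integral_integral_eq[OF this, symmetric] show ?thesis
      by (simp add: mult.commute)
  qed
  then show ?thesis
    unfolding has_bochner_integral_integral_eq[OF h, symmetric] by simp
qed

end

section \<open>Second moments of forms in step integrals\<close>

lemma wproc_Suc: "i \<noteq> 0 \<Longrightarrow> wproc f i = f i"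
  by (auto simp: wproc_def fun_eq_iff)

text \<open>With time as integrator the increments are interval lengths, so the step integral is a
  constant.\<close>

lemma spair_time:
  assumes "spair (wproc f 0) t T g X"
  shows "X = (\<lambda>\<omega>. \<integral>x. g x \<partial>mu t T)"
proof -
  obtain S c where *: "finite S" "S \<subseteq> {t..T}" "g = stepg t S c" "X = stepX (wproc f 0) t S c"
    using assms unfolding spair_def by blast
  show ?thesis unfolding *(3,4) integral_stepg[OF *(1,2)] by (auto simp: stepX_def wproc_def)
qed

lemma spair_l2_g: "spair w t T g X \<Longrightarrow> l2 (mu t T) g"
  unfolding spair_def using stepg_l2 by blast

text \<open>The trace appears exactly when both factors are integrals over the same Wiener
  component; a numerical weight lets one inequality cover all index pairs.\<close>

definition trace_on :: "nat \<Rightarrow> nat \<Rightarrow> real" where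
  "trace_on i1 i2 = (if i1 = i2 \<and> i1 \<noteq> 0 then 1 else 0)"

lemma (in prob_space) spair_wproc_l2:
  assumes fi: "rc_filtration M F" and W: "wiener_process_m M F m f" and t: "0 \<le> t"
    and i: "i \<le> m" and p: "spair (wproc f i) t T g X"
  shows "l2 M X"
proof (cases "i = 0")
  case True
  then have "X = (\<lambda>\<omega>. \<integral>x. g x \<partial>mu t T)" using spair_time p by blast
  then show ?thesis using l2_const by simp
next
  case False
  then have "wiener_process M F (f i)" using W i by (auto simp: wiener_process_m_def)
  then show ?thesis using spair_l2[OF fi _ t] p False by (auto simp: wproc_Suc)
qed

text \<open>The constant adds up the cases: 2 for the traceless pairings over Wiener components,
  \<open>T - t\<close> if one integrator is time, \<open>(T - t)^2\<close> if both are. In each case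
  the other summands are nonnegative.\<close>

lemma (in prob_space) quad_step:
  fixes a b :: "'j \<Rightarrow> real \<Rightarrow> real"
  assumes fi: "rc_filtration M F" and W: "wiener_process_m M F m f" and t: "0 \<le> t" "t \<le> T"
    and i: "i1 \<le> m" "i2 \<le> m"
    and p: "\<And>j. j \<in> J \<Longrightarrow> spair (wproc f i1) t T (a j) (X j)"
      "\<And>j. j \<in> J \<Longrightarrow> spair (wproc f i2) t T (b j) (Y j)"
  shows "integrable M (\<lambda>\<omega>. (\<Sum>j\<in>J. X j \<omega> * Y j \<omega>)\<^sup>2) \<and>
    expectation (\<lambda>\<omega>. (\<Sum>j\<in>J. X j \<omega> * Y j \<omega>)\<^sup>2) \<le> (2 + (T - t) + (T - t)\<^sup>2) * gram (mu t T) J a b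
      + trace_on i1 i2 * (\<Sum>j\<in>J. \<integral>x. a j x * b j x \<partial>mu t T)\<^sup>2"
proof -
  interpret mu: finite_measure "mu t T" by (rule finite_measure_mu)
  let ?I = "\<lambda>g h. \<integral>x. g x * h x \<partial>mu t T" and ?al = "\<lambda>g. \<integral>x. g x \<partial>mu t T"
  have l: "\<And>j. j \<in> J \<Longrightarrow> l2 (mu t T) (a j)" "\<And>j. j \<in> J \<Longrightarrow> l2 (mu t T) (b j)"
    using p spair_l2_g by blast+
  have m: "measure (mu t T) (space (mu t T)) = T - t" using t by (simp add: measure_mu)
  define N where "N = gram (mu t T) J a b"
  have N0: "0 \<le> N" unfolding N_def by (rule mu.gram_nonneg[OF l])
  have N1: "0 \<le> (T - t) * N" "0 \<le> (T - t)\<^sup>2 * N" using N0 t by auto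
  have ex: "(\<lambda>\<omega>. (\<Sum>j\<in>J. X j \<omega> * Y j \<omega>)\<^sup>2) = (\<lambda>\<omega>. \<Sum>j\<in>J. \<Sum>k\<in>J. X j \<omega> * Y j \<omega> * (X k \<omega> * Y k \<omega>))"
    by (simp add: power2_eq_square sum_product)
  \<comment> \<open>It remains in each case to name the mixed moments \<open>e j k\<close> and to
    bound their double sum.\<close>
  have reduce: ?thesis
    if e: "\<And>j k. j \<in> J \<Longrightarrow> k \<in> J \<Longrightarrow> has_bochner_integral M (\<lambda>\<omega>. X j \<omega> * Y j \<omega> * (X k \<omega> * Y k \<omega>)) (e j k)"
      and le: "(\<Sum>j\<in>J. \<Sum>k\<in>J. e j k) \<le> (2 + (T - t) + (T - t)\<^sup>2) * N + trace_on i1 i2 * (\<Sum>j\<in>J. ?I (a j) (b j))\<^sup>2" for e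
  proof -
    have h: "has_bochner_integral M (\<lambda>\<omega>. (\<Sum>j\<in>J. X j \<omega> * Y j \<omega>)\<^sup>2) (\<Sum>j\<in>J. \<Sum>k\<in>J. e j k)"
      unfolding ex by (intro has_bochner_integral_sum e)
    have "integrable M (\<lambda>\<omega>. (\<Sum>j\<in>J. X j \<omega> * Y j \<omega>)\<^sup>2)" using h by (rule integrable.intros)
    moreover have "expectation (\<lambda>\<omega>. (\<Sum>j\<in>J. X j \<omega> * Y j \<omega>)\<^sup>2) \<le> (2 + (T - t) + (T - t)\<^sup>2) * gram (mu t T) J a b
      + trace_on i1 i2 * (\<Sum>j\<in>J. ?I (a j) (b j))\<^sup>2"
      using le unfolding has_bochner_integral_integral_eq[OF h] N_def .
    ultimately show ?thesis ..
  qed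
  have le_drop: "x \<le> (2 + (T - t) + (T - t)\<^sup>2) * N + trace_on i1 i2 * (\<Sum>j\<in>J. ?I (a j) (b j))\<^sup>2"
    if "x \<le> 2 * N \<or> x \<le> (T - t) * N \<or> x \<le> (T - t)\<^sup>2 * N" for x
  proof -
    have "0 \<le> trace_on i1 i2 * (\<Sum>j\<in>J. ?I (a j) (b j))\<^sup>2" by (simp add: trace_on_def)
    then show ?thesis using that N0 N1 unfolding distrib_right by linarith
  qed
  have Wi: "wiener_process M F (f i)" if "i \<noteq> 0" "i \<le> m" for i
    using W that by (auto simp: wiener_process_m_def)
  have ind: "indep_vars (\<lambda>i. Pi\<^sub>M UNIV (\<lambda>_. borel)) (\<lambda>i \<omega>. \<lambda>s. f i s \<omega>) {1..m}"
    using W by (auto simp: wiener_process_m_def)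
  consider "i1 = 0" "i2 = 0" | "i1 = 0" "i2 \<noteq> 0" | "i1 \<noteq> 0" "i2 = 0" | "i1 \<noteq> 0" "i2 = i1" | "i1 \<noteq> 0" "i2 \<noteq> 0" "i1 \<noteq> i2"
    by blast
  then show ?thesis
  proof cases
    case 1
    have XY: "X j = (\<lambda>\<omega>. ?al (a j))" "Y j = (\<lambda>\<omega>. ?al (b j))" if "j \<in> J" for j
      using spair_time p[OF that] 1 by blast+
    show ?thesis
    proof (rule reduce[of "\<lambda>j k. ?al (a j) * ?al (b j) * (?al (a k) * ?al (b k))"])
      show "has_bochner_integral M (\<lambda>\<omega>. X j \<omega> * Y j \<omega> * (X k \<omega> * Y k \<omega>)) (?al (a j) * ?al (b j) * (?al (a k) * ?al (b k)))"
        if "j \<in> J" "k \<in> J" for j k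
        unfolding XY[OF that(1)] XY[OF that(2)] by (simp add: has_bochner_integral_iff prob_space)
      \<comment> \<open>The form is the constant double integral of the kernel; integrating over
        each of the two variables costs a factor \<open>T - t\<close>.\<close>
      have "(\<Sum>j\<in>J. \<Sum>k\<in>J. ?al (a j) * ?al (b j) * (?al (a k) * ?al (b k))) = (\<Sum>j\<in>J. ?al (b j) * ?al (a j))\<^sup>2"
        by (simp add: power2_eq_square sum_product algebra_simps)
      also have "\<dots> \<le> (T - t) * (\<Sum>j\<in>J. \<Sum>k\<in>J. (?al (b j) * ?al (b k)) * ?I (a j) (a k))"
        using mu.square_integral_lincomb_le[where J=J and c="\<lambda>j. ?al (b j)", OF l(1)] unfolding m by simp
      also have "\<dots> \<le> (T - t) * ((T - t) * gram (mu t T) J b a)"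
        using mu.gram_left_mean_le[where J=J and a=b and b=a, OF l(2,1)] t unfolding m by (intro mult_left_mono) auto
      also have "\<dots> = (T - t)\<^sup>2 * N" by (simp add: N_def gram_commute[of _ _ b] power2_eq_square)
      finally show "(\<Sum>j\<in>J. \<Sum>k\<in>J. ?al (a j) * ?al (b j) * (?al (a k) * ?al (b k)))
        \<le> (2 + (T - t) + (T - t)\<^sup>2) * N + trace_on i1 i2 * (\<Sum>j\<in>J. ?I (a j) (b j))\<^sup>2"
        by (intro le_drop) simp
    qed
  next
    case 2
    note W2 = Wi[OF 2(2) i(2)]
    have p2: "spair (f i2) t T (b j) (Y j)" if "j \<in> J" for j using p(2)[OF that] 2 by (simp add: wproc_Suc)
    have XY: "X j = (\<lambda>\<omega>. ?al (a j))" if "j \<in> J" for j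
      using spair_time p[OF that] 2 by blast
    \<comment> \<open>The factors integrated against time are constants, the other two contribute
      through the isometry, and the result is the norm of the kernel integrated over its first
      variable.\<close>
    show ?thesis
    proof (rule reduce[of "\<lambda>j k. (?al (a j) * ?al (a k)) * ?I (b j) (b k)"])
      show "has_bochner_integral M (\<lambda>\<omega>. X j \<omega> * Y j \<omega> * (X k \<omega> * Y k \<omega>)) ((?al (a j) * ?al (a k)) * ?I (b j) (b k))"
        if "j \<in> J" "k \<in> J" for j k
      proof -
        have "has_bochner_integral M (\<lambda>\<omega>. Y j \<omega> * Y k \<omega>) (?I (b j) (b k))"
          using has_bochner_integral_inner[OF spair_l2(3)[OF fi W2 t(1) p2[OF that(1)]] spair_l2(3)[OF fi W2 t(1) p2[OF that(2)]]]
            spair_isometry[OF fi W2 t(1) p2[OF that(1)] p2[OF that(2)]] by simp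
        from has_bochner_integral_mult_right[OF this, of "?al (a j) * ?al (a k)"]
        show ?thesis unfolding XY[OF that(1)] XY[OF that(2)] by (simp add: mult_ac)
      qed
      show "(\<Sum>j\<in>J. \<Sum>k\<in>J. (?al (a j) * ?al (a k)) * ?I (b j) (b k))
        \<le> (2 + (T - t) + (T - t)\<^sup>2) * N + trace_on i1 i2 * (\<Sum>j\<in>J. ?I (a j) (b j))\<^sup>2"
        using mu.gram_left_mean_le[where J=J and a=a and b=b, OF l] unfolding m by (intro le_drop) (simp add: N_def)
    qed
  next
    case 3
    note W2 = Wi[OF 3(1) i(1)]
    have p2: "spair (f i1) t T (a j) (X j)" if "j \<in> J" for j using p(1)[OF that] 3 by (simp add: wproc_Suc)
    have XY: "Y j = (\<lambda>\<omega>. ?al (b j))" if "j \<in> J" for j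
      using spair_time p[OF that] 3 by blast
    show ?thesis
    proof (rule reduce[of "\<lambda>j k. (?al (b j) * ?al (b k)) * ?I (a j) (a k)"])
      show "has_bochner_integral M (\<lambda>\<omega>. X j \<omega> * Y j \<omega> * (X k \<omega> * Y k \<omega>)) ((?al (b j) * ?al (b k)) * ?I (a j) (a k))"
        if "j \<in> J" "k \<in> J" for j k
      proof -
        have "has_bochner_integral M (\<lambda>\<omega>. X j \<omega> * X k \<omega>) (?I (a j) (a k))"
          using has_bochner_integral_inner[OF spair_l2(3)[OF fi W2 t(1) p2[OF that(1)]] spair_l2(3)[OF fi W2 t(1) p2[OF that(2)]]]
            spair_isometry[OF fi W2 t(1) p2[OF that(1)] p2[OF that(2)]] by simp
        from has_bochner_integral_mult_right[OF this, of "?al (b j) * ?al (b k)"]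
        show ?thesis unfolding XY[OF that(1)] XY[OF that(2)] by (simp add: mult_ac)
      qed
      show "(\<Sum>j\<in>J. \<Sum>k\<in>J. (?al (b j) * ?al (b k)) * ?I (a j) (a k))
        \<le> (2 + (T - t) + (T - t)\<^sup>2) * N + trace_on i1 i2 * (\<Sum>j\<in>J. ?I (a j) (b j))\<^sup>2"
        \<comment> \<open>The same bound with the two variables exchanged; the norm is symmetric in
          them.\<close>
        using mu.gram_left_mean_le[where J=J and a=b and b=a, OF l(2,1)] unfolding m
        by (intro le_drop) (simp add: N_def gram_commute[of _ _ b])
    qed
  next
    case 4
    note W2 = Wi[OF 4(1) i(1)]
    have p2: "spair (f i1) t T (a j) (X j)" "spair (f i1) t T (b j) (Y j)" if "j \<in> J" for j
      using p[OF that] 4 by (auto simp: wproc_Suc)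
    show ?thesis
    proof (rule reduce[of "\<lambda>j k. ?I (a j) (b j) * ?I (a k) (b k) + ?I (a j) (a k) * ?I (b j) (b k) + ?I (a j) (b k) * ?I (b j) (a k)"])
      show "has_bochner_integral M (\<lambda>\<omega>. X j \<omega> * Y j \<omega> * (X k \<omega> * Y k \<omega>))
         (?I (a j) (b j) * ?I (a k) (b k) + ?I (a j) (a k) * ?I (b j) (b k) + ?I (a j) (b k) * ?I (b j) (a k))"
        if "j \<in> J" "k \<in> J" for j k
        by (rule spair_isserlis[OF fi W2 t(1) p2[OF that(1)] p2[OF that(2)]])
      \<comment> \<open>The three pairings yield, in order, the squared trace, the squared norm and
        the product with the transpose.\<close>
      have "(\<Sum>j\<in>J. \<Sum>k\<in>J. ?I (a j) (b j) * ?I (a k) (b k) + ?I (a j) (a k) * ?I (b j) (b k) + ?I (a j) (b k) * ?I (b j) (a k))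
        = (\<Sum>j\<in>J. ?I (a j) (b j))\<^sup>2 + N + (\<Sum>j\<in>J. \<Sum>k\<in>J. ?I (a j) (b k) * ?I (b j) (a k))"
        unfolding power2_eq_square sum_product N_def gram_def by (simp add: sum.distrib)
      also have "\<dots> \<le> (\<Sum>j\<in>J. ?I (a j) (b j))\<^sup>2 + N + N"
        using mu.gram_transpose_le[where J=J and a=a and b=b, OF l] unfolding N_def by simp
      also have "\<dots> \<le> (2 + (T - t) + (T - t)\<^sup>2) * N + trace_on i1 i2 * (\<Sum>j\<in>J. ?I (a j) (b j))\<^sup>2"
        using N1 4 unfolding distrib_right by (simp add: trace_on_def)
      finally show "(\<Sum>j\<in>J. \<Sum>k\<in>J. ?I (a j) (b j) * ?I (a k) (b k) + ?I (a j) (a k) * ?I (b j) (b k) + ?I (a j) (b k) * ?I (b j) (a k))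
        \<le> (2 + (T - t) + (T - t)\<^sup>2) * N + trace_on i1 i2 * (\<Sum>j\<in>J. ?I (a j) (b j))\<^sup>2" .
    qed
  next
    case 5
    have mem: "i1 \<in> {1..m}" "i2 \<in> {1..m}" using 5 i by auto
    have p2: "spair (f i1) t T (a j) (X j)" "spair (f i2) t T (b j) (Y j)" if "j \<in> J" for j
      using p[OF that] 5 by (auto simp: wproc_Suc)
    show ?thesis
    proof (rule reduce[of "\<lambda>j k. ?I (a j) (a k) * ?I (b j) (b k)"])
      show "has_bochner_integral M (\<lambda>\<omega>. X j \<omega> * Y j \<omega> * (X k \<omega> * Y k \<omega>)) (?I (a j) (a k) * ?I (b j) (b k))"
        if "j \<in> J" "k \<in> J" for j k
        by (rule spair_cross[OF fi Wi[OF 5(1) i(1)] Wi[OF 5(2) i(2)] t(1) ind mem 5(3) p2[OF that(1)] p2[OF that(2)]])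
      show "(\<Sum>j\<in>J. \<Sum>k\<in>J. ?I (a j) (a k) * ?I (b j) (b k))
        \<le> (2 + (T - t) + (T - t)\<^sup>2) * N + trace_on i1 i2 * (\<Sum>j\<in>J. ?I (a j) (b j))\<^sup>2"
        using N0 by (intro le_drop) (simp add: N_def gram_def)
    qed
  qed
qed

text \<open>Pairs (integrand, integral) in the \<open>L\<^sub>2\<close> closure of the step pairs; for \<open>w = wproc f 0\<close> the integral
  is almost surely constant.\<close>

definition wint :: "'a measure \<Rightarrow> (real \<Rightarrow> 'a \<Rightarrow> real) \<Rightarrow> real \<Rightarrow> real \<Rightarrow> (real \<Rightarrow> real) \<Rightarrow> ('a \<Rightarrow> real) \<Rightarrow> bool" where
  "wint M w t T g X \<longleftrightarrow> (\<exists>gn Xn. (\<forall>n. spair w t T (gn n) (Xn n)) \<and> l2conv (mu t T) gn g \<and> l2conv M Xn X)"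

section \<open>Closing the moment bound under mean-square limits\<close>

lemma wint_l2: "wint M w t T g X \<Longrightarrow> l2 (mu t T) g \<and> l2 M X"
  unfolding wint_def l2conv_def by blast

lemma wint_lincomb:
  assumes "wint M w t T g X" "wint M w t T h Y"
  shows "wint M w t T (\<lambda>x. g x + k * h x) (\<lambda>x. X x + k * Y x)"
proof -
  obtain gn Xn hn Yn where *: "\<And>n::nat. spair w t T (gn n) (Xn n)" "l2conv (mu t T) gn g" "l2conv M Xn X"
    "\<And>n::nat. spair w t T (hn n) (Yn n)" "l2conv (mu t T) hn h" "l2conv M Yn Y"
    using assms unfolding wint_def by blast
  show ?thesis
    unfolding wint_def
    by (intro exI[of _ "\<lambda>n x. gn n x + k * hn n x"] exI[of _ "\<lambda>n x. Xn n x + k * Yn n x"] conjI allI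
       spair_lincomb l2conv_add l2conv_scale *)
qed

lemma spair_zero: "spair w t T (\<lambda>x. 0) (\<lambda>x. 0)"
  unfolding spair_def by (intro exI[of _ "{}"]) (auto simp: stepg_def stepX_def fun_eq_iff)

lemma wint_zero: "wint M w t T (\<lambda>x. 0) (\<lambda>x. 0)"
  unfolding wint_def
  by (intro exI[of _ "\<lambda>n x. 0"] conjI allI spair_zero) (auto simp: l2conv_zero)

lemma wint_scale: "wint M w t T g X \<Longrightarrow> wint M w t T (\<lambda>x. k * g x) (\<lambda>x. k * X x)"
  using wint_lincomb[OF wint_zero] by simp

text \<open>Every factor has its own step approximation. The products converge only in
  \<open>L1\<close>, so \<open>L1_fatou_square\<close> carries the second-moment bound over, while
  the right side is continuous under \<open>L2\<close> convergence of the integrands.\<close>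

lemma (in prob_space) quad_wint_gram:
  fixes a b :: "'j \<Rightarrow> real \<Rightarrow> real"
  assumes fi: "rc_filtration M F" and W: "wiener_process_m M F m f" and t: "0 \<le> t" "t \<le> T"
    and i: "i1 \<le> m" "i2 \<le> m"
    and p: "\<And>j. j \<in> J \<Longrightarrow> wint M (wproc f i1) t T (a j) (X j)"
      "\<And>j. j \<in> J \<Longrightarrow> wint M (wproc f i2) t T (b j) (Y j)"
  shows "l2 M (\<lambda>\<omega>. \<Sum>j\<in>J. X j \<omega> * Y j \<omega>)"
    and "expectation (\<lambda>\<omega>. (\<Sum>j\<in>J. X j \<omega> * Y j \<omega>)\<^sup>2) \<le> (2 + (T - t) + (T - t)\<^sup>2) * gram (mu t T) J a b
      + trace_on i1 i2 * (\<Sum>j\<in>J. \<integral>x. a j x * b j x \<partial>mu t T)\<^sup>2"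
proof -
  \<comment> \<open>Choice is applied twice per factor, first to the integrands and then to their
    integrals, since \<open>wint\<close> hides both under existentials.\<close>
  have "\<forall>j\<in>J. \<exists>gn Zn. (\<forall>n. spair (wproc f i1) t T (gn n) (Zn n)) \<and> l2conv (mu t T) gn (a j) \<and> l2conv M Zn (X j)"
    using p(1) unfolding wint_def by blast
  then obtain an where "\<forall>j\<in>J. \<exists>Zn. (\<forall>n. spair (wproc f i1) t T (an j n) (Zn n)) \<and> l2conv (mu t T) (an j) (a j) \<and> l2conv M Zn (X j)"
    unfolding bchoice_iff by blast
  then obtain Xn where A: "\<And>j n. j \<in> J \<Longrightarrow> spair (wproc f i1) t T (an j n) (Xn j n)"
    "\<And>j. j \<in> J \<Longrightarrow> l2conv (mu t T) (an j) (a j)" "\<And>j. j \<in> J \<Longrightarrow> l2conv M (Xn j) (X j)"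
    unfolding bchoice_iff by blast
  have "\<forall>j\<in>J. \<exists>gn Zn. (\<forall>n. spair (wproc f i2) t T (gn n) (Zn n)) \<and> l2conv (mu t T) gn (b j) \<and> l2conv M Zn (Y j)"
    using p(2) unfolding wint_def by blast
  then obtain bn where "\<forall>j\<in>J. \<exists>Zn. (\<forall>n. spair (wproc f i2) t T (bn j n) (Zn n)) \<and> l2conv (mu t T) (bn j) (b j) \<and> l2conv M Zn (Y j)"
    unfolding bchoice_iff by blast
  then obtain Yn where B: "\<And>j n. j \<in> J \<Longrightarrow> spair (wproc f i2) t T (bn j n) (Yn j n)"
    "\<And>j. j \<in> J \<Longrightarrow> l2conv (mu t T) (bn j) (b j)" "\<And>j. j \<in> J \<Longrightarrow> l2conv M (Yn j) (Y j)"
    unfolding bchoice_iff by blast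
  have l: "j \<in> J \<Longrightarrow> l2 M (Xn j n)" "j \<in> J \<Longrightarrow> l2 M (X j)" "j \<in> J \<Longrightarrow> l2 M (Yn j n)" "j \<in> J \<Longrightarrow> l2 M (Y j)" for j n
    using A(3) B(3) by (auto simp: l2conv_def)
  note q = quad_step[OF fi W t i, of J "\<lambda>j. an j n" "\<lambda>j. Xn j n" "\<lambda>j. bn j n" "\<lambda>j. Yn j n" for n, OF A(1) B(1)]
  let ?Z = "\<lambda>n \<omega>. \<Sum>j\<in>J. Xn j n \<omega> * Yn j n \<omega>"
  have iZ: "integrable M (?Z n)" for n
    by (intro Bochner_Integration.integrable_sum l2_mult l)
  have iL: "integrable M (\<lambda>\<omega>. \<Sum>j\<in>J. X j \<omega> * Y j \<omega>)"
    by (intro Bochner_Integration.integrable_sum l2_mult l)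
  have conv: "(\<lambda>n. \<integral>x. \<bar>?Z n x - (\<Sum>j\<in>J. X j x * Y j x)\<bar> \<partial>M) \<longlonglongrightarrow> 0"
  proof (rule Lim_null_comparison[OF always_eventually, OF allI])
    show "(\<lambda>n. \<Sum>j\<in>J. \<integral>x. \<bar>Xn j n x * Yn j n x - X j x * Y j x\<bar> \<partial>M) \<longlonglongrightarrow> 0"
      by (rule tendsto_null_sum) (intro l2conv_product_L1 A B)
    fix n
    have id: "integrable M (\<lambda>x. \<bar>Xn j n x * Yn j n x - X j x * Y j x\<bar>)" if "j \<in> J" for j
      using that by (intro integrable_abs Bochner_Integration.integrable_diff l2_mult l)
    have "(\<integral>x. \<bar>?Z n x - (\<Sum>j\<in>J. X j x * Y j x)\<bar> \<partial>M) \<le> (\<integral>x. (\<Sum>j\<in>J. \<bar>Xn j n x * Yn j n x - X j x * Y j x\<bar>) \<partial>M)"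
    proof (rule integral_mono)
      show "\<bar>?Z n x - (\<Sum>j\<in>J. X j x * Y j x)\<bar> \<le> (\<Sum>j\<in>J. \<bar>Xn j n x * Yn j n x - X j x * Y j x\<bar>)" for x
        unfolding sum_subtractf[symmetric] by (rule sum_abs)
    qed (use iZ iL id in auto)
    also have "\<dots> = (\<Sum>j\<in>J. \<integral>x. \<bar>Xn j n x * Yn j n x - X j x * Y j x\<bar> \<partial>M)"
      using id by (rule Bochner_Integration.integral_sum)
    finally show "norm (\<integral>x. \<bar>?Z n x - (\<Sum>j\<in>J. X j x * Y j x)\<bar> \<partial>M) \<le> (\<Sum>j\<in>J. \<integral>x. \<bar>Xn j n x * Yn j n x - X j x * Y j x\<bar> \<partial>M)"
      by simp
  qed
  have lim: "(\<lambda>n. (2 + (T - t) + (T - t)\<^sup>2) * gram (mu t T) J (\<lambda>j. an j n) (\<lambda>j. bn j n)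
      + trace_on i1 i2 * (\<Sum>j\<in>J. \<integral>x. an j n x * bn j n x \<partial>mu t T)\<^sup>2)
     \<longlonglongrightarrow> (2 + (T - t) + (T - t)\<^sup>2) * gram (mu t T) J a b + trace_on i1 i2 * (\<Sum>j\<in>J. \<integral>x. a j x * b j x \<partial>mu t T)\<^sup>2"
    unfolding gram_def
    by (intro tendsto_add tendsto_mult tendsto_const tendsto_sum tendsto_power l2conv_inner A B)
  show "l2 M (\<lambda>\<omega>. \<Sum>j\<in>J. X j \<omega> * Y j \<omega>)"
    by (rule L1_fatou_square(1)[OF iZ iL conv conjunct1[OF q] conjunct2[OF q] lim])
  show "expectation (\<lambda>\<omega>. (\<Sum>j\<in>J. X j \<omega> * Y j \<omega>)\<^sup>2) \<le> (2 + (T - t) + (T - t)\<^sup>2) * gram (mu t T) J a b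
      + trace_on i1 i2 * (\<Sum>j\<in>J. \<integral>x. a j x * b j x \<partial>mu t T)\<^sup>2"
    by (rule L1_fatou_square(2)[OF iZ iL conv conjunct1[OF q] conjunct2[OF q] lim])
qed

section \<open>Integrals as limits along partitions\<close>

lemma partition_mono:
  assumes "is_partition a b n \<tau>" "i \<le> j" "j \<le> n"
  shows "\<tau> i \<le> \<tau> j"
  using assms(2,3)
proof (induction j rule: dec_induct)
  case (step k)
  then have "\<tau> k < \<tau> (Suc k)" "\<tau> i \<le> \<tau> k" using assms(1) by (auto simp: is_partition_def)
  then show ?case by linarith
qed simp

lemma partition_mem:
  assumes "is_partition a b n \<tau>" "k \<le> n"
  shows "\<tau> k \<in> {a..b}"
  using partition_mono[OF assms(1), of 0 k] partition_mono[OF assms(1), of k n] assms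
  by (auto simp: is_partition_def)

text \<open>The first partition point not below \<open>x\<close> is the right end of the cell; it
  has a predecessor because \<open>a < x\<close>.\<close>

lemma partition_cover:
  assumes p: "is_partition a b n \<tau>" and x: "a < x" "x \<le> b"
  obtains k where "k < n" "\<tau> k < x" "x \<le> \<tau> (Suc k)"
proof -
  define k where "k = (LEAST k. x \<le> \<tau> k)"
  have xn: "x \<le> \<tau> n" using p x by (simp add: is_partition_def)
  have k: "x \<le> \<tau> k" unfolding k_def by (rule LeastI[of _ n]) (rule xn)
  have kn: "k \<le> n" unfolding k_def by (rule Least_le) (rule xn)
  have "k \<noteq> 0"
  proof
    assume "k = 0"
    then have "x \<le> a" using k p by (simp add: is_partition_def)
    then show False using x by simp
  qed
  then obtain l where l: "k = Suc l" by (cases k) auto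
  have "\<not> x \<le> \<tau> l" using not_less_Least[of l "\<lambda>k. x \<le> \<tau> k"] l unfolding k_def by auto
  then show ?thesis using that[of l] k kn l by auto
qed

lemma partition_unique:
  assumes p: "is_partition a b n \<tau>" and "k < n" "j < n" "\<tau> k < x" "x \<le> \<tau> (Suc k)" "\<tau> j < x" "x \<le> \<tau> (Suc j)"
  shows "j = k"
proof (rule ccontr)
  assume "j \<noteq> k"
  then consider "Suc j \<le> k" | "Suc k \<le> j" by linarith
  then show False
    using partition_mono[OF p, of "Suc j" k] partition_mono[OF p, of "Suc k" j] assms
    by cases auto
qed

text \<open>Left-open cells agree with the basis \<open>{t<..s}\<close>; at the initial point of a
  partition the value is therefore 0.\<close>

definition pstep :: "nat \<Rightarrow> (nat \<Rightarrow> real) \<Rightarrow> (nat \<Rightarrow> real) \<Rightarrow> real \<Rightarrow> real" where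
  "pstep n \<tau> h x = (\<Sum>k<n. h k * indicator {\<tau> k<..\<tau> (Suc k)} x)"

lemma pstep_eq:
  assumes p: "is_partition a b n \<tau>" and k: "k < n" "\<tau> k < x" "x \<le> \<tau> (Suc k)"
  shows "pstep n \<tau> h x = h k"
proof -
  have "pstep n \<tau> h x = (\<Sum>j<n. if j = k then h k else 0)"
    unfolding pstep_def
  proof (intro sum.cong refl)
    fix j assume j: "j \<in> {..<n}"
    show "h j * indicator {\<tau> j<..\<tau> (Suc j)} x = (if j = k then h k else 0)"
      using partition_unique[OF p k(1), of j x] j k by (cases "j = k") (auto simp: indicator_def)
  qed
  then show ?thesis using k by simp
qed

lemma pstep_outside:
  assumes p: "is_partition a b n \<tau>" and x: "x \<notin> {a<..b}"
  shows "pstep n \<tau> h x = 0"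
  unfolding pstep_def
proof (intro sum.neutral ballI)
  fix k assume "k \<in> {..<n}"
  then have "\<tau> k \<in> {a..b}" "\<tau> (Suc k) \<in> {a..b}" using partition_mem[OF p] by auto
  then have "x \<notin> {\<tau> k<..\<tau> (Suc k)}" using x by auto
  then show "h k * indicator {\<tau> k<..\<tau> (Suc k)} x = 0" by simp
qed

text \<open>The empty partition \<open>n = 0\<close> serves the degenerate interval, which occurs as
  the inner integral at its lower end.\<close>

lemma ex_fine_partition:
  assumes "a \<le> b" "\<delta> > 0"
  shows "\<exists>n \<tau>. is_partition a b n \<tau> \<and> (\<forall>k<n. \<tau> (Suc k) - \<tau> k < \<delta>)"
proof (cases "a = b")
  case True
  then show ?thesis by (intro exI[of _ 0] exI[of _ "\<lambda>_. a"]) (simp add: is_partition_def)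
next
  case False
  then have ab: "a < b" using assms by simp
  obtain n :: nat where n: "(b - a) / \<delta> < real n" using reals_Archimedean2 by blast
  have n0: "0 < real n" using n ab assms by (smt (verit) divide_nonneg_pos)
  define \<tau> where "\<tau> k = a + real k * ((b - a) / real n)" for k
  have d: "\<tau> (Suc k) - \<tau> k = (b - a) / real n" for k
    unfolding \<tau>_def of_nat_Suc distrib_right by linarith
  have "(b - a) / real n < \<delta>" using n n0 assms by (simp add: field_simps)
  moreover have "0 < (b - a) / real n" using ab n0 by simp
  moreover have "\<tau> k < \<tau> (Suc k)" for k using d[of k] calculation by linarith
  moreover have "\<tau> 0 = a" "\<tau> n = b" using n0 by (auto simp: \<tau>_def)
  ultimately show ?thesis
    using d by (intro exI[of _ n] exI[of _ \<tau>]) (auto simp: is_partition_def)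
qed

text \<open>A Cauchy condition over pairs of fine partitions becomes a limit over all fine
  partitions: one sequence of partitions supplies the limit by completeness, and any other fine
  partition is compared with it.\<close>

lemma (in prob_space) mesh_limit_exists:
  assumes ab: "a \<le> b"
    and c: "\<And>e. e > 0 \<Longrightarrow> \<exists>\<delta>>0. \<forall>n \<tau> n' \<tau>'. is_partition a b n \<tau> \<and> (\<forall>k<n. \<tau> (Suc k) - \<tau> k < \<delta>) \<and>
       is_partition a b n' \<tau>' \<and> (\<forall>k<n'. \<tau>' (Suc k) - \<tau>' k < \<delta>) \<longrightarrow>
       l2 M (S n \<tau>) \<and> l2 M (S n' \<tau>') \<and> expectation (\<lambda>\<omega>. (S n \<tau> \<omega> - S n' \<tau>' \<omega>)\<^sup>2) < e"
  shows "\<exists>X. ms_limit_mesh M a b S X"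
proof -
  let ?fine = "\<lambda>\<delta> n \<tau>. is_partition a b n \<tau> \<and> (\<forall>k<n. \<tau> (Suc k) - \<tau> k < \<delta>)"
  have "\<forall>N::nat. \<exists>\<delta>>0. \<forall>n \<tau> n' \<tau>'. ?fine \<delta> n \<tau> \<and> ?fine \<delta> n' \<tau>' \<longrightarrow>
     l2 M (S n \<tau>) \<and> l2 M (S n' \<tau>') \<and> expectation (\<lambda>\<omega>. (S n \<tau> \<omega> - S n' \<tau>' \<omega>)\<^sup>2) < inverse (real (Suc N))"
    using c by (intro allI) (simp add: conj_assoc)
  then obtain \<delta> where \<delta>: "\<And>N. \<delta> N > 0" and \<delta>2: "\<And>N n \<tau> n' \<tau>'. ?fine (\<delta> N) n \<tau> \<Longrightarrow> ?fine (\<delta> N) n' \<tau>' \<Longrightarrow>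
     l2 M (S n \<tau>) \<and> l2 M (S n' \<tau>') \<and> expectation (\<lambda>\<omega>. (S n \<tau> \<omega> - S n' \<tau>' \<omega>)\<^sup>2) < inverse (real (Suc N))"
    unfolding choice_iff by blast
  \<comment> \<open>Minima over initial segments make the thresholds decrease, so the partition
    chosen at stage \<open>N\<close> is admissible at every earlier stage.\<close>
  define d where "d N = Min (\<delta> ` {..N})" for N
  have d0: "d N > 0" for N using \<delta> by (simp add: d_def)
  have d1: "d N \<le> \<delta> i" if "i \<le> N" for N i using that by (simp add: d_def)
  have "\<forall>N. \<exists>n \<tau>. ?fine (d N) n \<tau>" using ex_fine_partition[OF ab d0] by blast
  then obtain n \<tau> where P: "\<And>N. ?fine (d N) (n N) (\<tau> N)" unfolding choice_iff by blast
  have P': "?fine (\<delta> i) (n N) (\<tau> N)" if "i \<le> N" for i N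
    using P[of N] d1[OF that] by fastforce
  define X where "X N = S (n N) (\<tau> N)" for N
  have l: "l2 M (X N)" for N using \<delta>2[OF P'[OF order_refl] P'[OF order_refl]] by (simp add: X_def)
  have "\<exists>Z. l2conv M X Z"
  proof (rule l2_complete[OF l])
    fix e :: real assume "e > 0"
    then obtain N where N: "inverse (real (Suc N)) < e" using reals_Archimedean by blast
    have "expectation (\<lambda>x. (X i x - X j x)\<^sup>2) < e" if "i \<ge> N" "j \<ge> N" for i j
      using \<delta>2[OF P'[OF that(1)] P'[OF that(2)]] N by (simp add: X_def)
    then show "\<exists>N. \<forall>i\<ge>N. \<forall>j\<ge>N. expectation (\<lambda>x. (X i x - X j x)\<^sup>2) < e" by blast
  qed
  then obtain Z where Z: "l2conv M X Z" by blast
  then have lZ: "l2 M Z" and Zc: "(\<lambda>N. expectation (\<lambda>x. (X N x - Z x)\<^sup>2)) \<longlonglongrightarrow> 0" by (auto simp: l2conv_def)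
  have "\<exists>\<delta>>0. \<forall>n \<tau>. ?fine \<delta> n \<tau> \<longrightarrow> l2 M (S n \<tau>) \<and> expectation (\<lambda>\<omega>. (S n \<tau> \<omega> - Z \<omega>)\<^sup>2) < e" if e: "e > 0" for e
  proof -
    \<comment> \<open>Half of \<open>e\<close> for each of two distances, halved again by the factor
      2 of the triangle inequality.\<close>
    have "0 < e / 4" using e by simp
    then obtain N where N: "inverse (real (Suc N)) < e / 4" using reals_Archimedean by blast
    have "\<forall>\<^sub>F k in sequentially. expectation (\<lambda>x. (X k x - Z x)\<^sup>2) < e / 4"
      using order_tendstoD(2)[OF Zc \<open>0 < e / 4\<close>] .
    then obtain K where K: "\<And>k. k \<ge> K \<Longrightarrow> expectation (\<lambda>x. (X k x - Z x)\<^sup>2) < e / 4"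
      unfolding eventually_sequentially by blast
    define k where "k = max K N"
    have "l2 M (S n' \<tau>') \<and> expectation (\<lambda>\<omega>. (S n' \<tau>' \<omega> - Z \<omega>)\<^sup>2) < e" if f: "?fine (\<delta> N) n' \<tau>'" for n' \<tau>'
    proof -
      have *: "l2 M (S n' \<tau>')" "expectation (\<lambda>\<omega>. (S n' \<tau>' \<omega> - X k \<omega>)\<^sup>2) < inverse (real (Suc N))"
        using \<delta>2[OF f P'[of N k]] by (auto simp: k_def X_def)
      show ?thesis
        using integral_square_triangle[OF *(1) l[of k] lZ] *  K[of k] N by (auto simp: k_def)
    qed
    then show ?thesis using \<delta>[of N] by blast
  qed
  note conv = this
  have "ms_limit_mesh M a b S Z"
    unfolding ms_limit_mesh_def
  proof (intro conjI allI impI)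
    show "Z \<in> borel_measurable M" "integrable M (\<lambda>\<omega>. (Z \<omega>)\<^sup>2)" using lZ by (auto simp: l2_def)
    fix e :: real assume "e > 0"
    from conv[OF this] obtain \<delta> where \<delta>: "\<delta> > 0" "\<And>n \<tau>. ?fine \<delta> n \<tau> \<Longrightarrow> l2 M (S n \<tau>) \<and> expectation (\<lambda>\<omega>. (S n \<tau> \<omega> - Z \<omega>)\<^sup>2) < e" by blast
    show "\<exists>\<delta>>0. \<forall>n \<tau>. ?fine \<delta> n \<tau> \<longrightarrow> S n \<tau> \<in> borel_measurable M \<and> integrable M (\<lambda>\<omega>. (S n \<tau> \<omega> - Z \<omega>)\<^sup>2) \<and>
       expectation (\<lambda>\<omega>. (S n \<tau> \<omega> - Z \<omega>)\<^sup>2) < e"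
      using \<delta> l2_square[OF l2_diff[OF _ lZ]] l2_measurable by (intro exI[of _ \<delta>]) blast
  qed
  then show ?thesis by (rule exI[of _ Z])
qed

lemma ms_limit_mesh_l2:
  assumes "ms_limit_mesh M a b S X"
  shows "l2 M X"
  using assms by (simp add: ms_limit_mesh_def l2_def)

text \<open>The definition controls only the difference from \<open>X\<close>; adding
  \<open>X\<close> back shows that the sums themselves are square integrable.\<close>

lemma ms_limit_meshD:
  assumes L: "ms_limit_mesh M a b S X" and e: "e > 0"
  obtains \<delta> where "\<delta> > 0" "\<And>n \<tau>. is_partition a b n \<tau> \<Longrightarrow> (\<And>k. k < n \<Longrightarrow> \<tau> (Suc k) - \<tau> k < \<delta>) \<Longrightarrow>
    l2 M (S n \<tau>) \<and> (\<integral>\<omega>. (S n \<tau> \<omega> - X \<omega>)\<^sup>2 \<partial>M) < e"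
proof -
  obtain \<delta> where \<delta>: "\<delta> > 0" "\<And>n \<tau>. is_partition a b n \<tau> \<and> (\<forall>k<n. \<tau> (Suc k) - \<tau> k < \<delta>) \<longrightarrow>
     S n \<tau> \<in> borel_measurable M \<and> integrable M (\<lambda>\<omega>. (S n \<tau> \<omega> - X \<omega>)\<^sup>2) \<and> (\<integral>\<omega>. (S n \<tau> \<omega> - X \<omega>)\<^sup>2 \<partial>M) < e"
    using L e unfolding ms_limit_mesh_def by blast
  have lX: "l2 M X" using ms_limit_mesh_l2[OF L] .
  show ?thesis
  proof (rule that[OF \<delta>(1)])
    fix n \<tau> assume "is_partition a b n \<tau>" "\<And>k. k < n \<Longrightarrow> \<tau> (Suc k) - \<tau> k < \<delta>"
    then have *: "S n \<tau> \<in> borel_measurable M" "integrable M (\<lambda>\<omega>. (S n \<tau> \<omega> - X \<omega>)\<^sup>2)" "(\<integral>\<omega>. (S n \<tau> \<omega> - X \<omega>)\<^sup>2 \<partial>M) < e"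
      using \<delta>(2)[of n \<tau>] by blast+
    have "l2 M (\<lambda>\<omega>. S n \<tau> \<omega> - X \<omega>)" using * l2_measurable[OF lX] by (auto simp: l2_def)
    from l2_add[OF this lX] show "l2 M (S n \<tau>) \<and> (\<integral>\<omega>. (S n \<tau> \<omega> - X \<omega>)\<^sup>2 \<partial>M) < e" using * by simp
  qed
qed

text \<open>A cell indicator is the difference of two basis indicators, so a Riemann sum is exactly
  the integral of a step function. Partitions of \<open>[t, s]\<close> are placed inside the fixed
  interval \<open>[t, T]\<close>.\<close>

lemma spair_riemann:
  assumes p: "is_partition t s n \<tau>" and s: "s \<le> T"
  shows "spair w t T (pstep n \<tau> h) (\<lambda>\<omega>. \<Sum>k<n. h k * (w (\<tau> (Suc k)) \<omega> - w (\<tau> k) \<omega>))"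
proof -
  have one: "spair w t T (\<lambda>x. h k * indicator {\<tau> k<..\<tau> (Suc k)} x) (\<lambda>\<omega>. h k * (w (\<tau> (Suc k)) \<omega> - w (\<tau> k) \<omega>))" if "k < n" for k
  proof -
    have m: "\<tau> k \<in> {t..T}" "\<tau> (Suc k) \<in> {t..T}" "\<tau> k < \<tau> (Suc k)"
      using partition_mem[OF p, of k] partition_mem[OF p, of "Suc k"] that s p by (auto simp: is_partition_def)
    define c where "c x = (if x = \<tau> k then - h k else h k)" for x
    have "(\<lambda>x. h k * indicator {\<tau> k<..\<tau> (Suc k)} x) = stepg t {\<tau> k, \<tau> (Suc k)} c"
    proof
      fix x
      have "stepg t {\<tau> k, \<tau> (Suc k)} c x = c (\<tau> k) * indicator {t<..\<tau> k} x + c (\<tau> (Suc k)) * indicator {t<..\<tau> (Suc k)} x"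
        unfolding stepg_def using m
        by (subst sum.insert, simp, simp, subst sum.insert, simp, simp, simp only: sum.empty add_0_right)
      then show "h k * indicator {\<tau> k<..\<tau> (Suc k)} x = stepg t {\<tau> k, \<tau> (Suc k)} c x"
        using m by (auto simp: c_def indicator_def)
    qed
    moreover have "(\<lambda>\<omega>. h k * (w (\<tau> (Suc k)) \<omega> - w (\<tau> k) \<omega>)) = stepX w t {\<tau> k, \<tau> (Suc k)} c"
      using m by (auto simp: stepX_def fun_eq_iff c_def algebra_simps)
    ultimately show ?thesis
      using m unfolding spair_def by (intro exI[of _ "{\<tau> k, \<tau> (Suc k)}"] exI[of _ c]) auto
  qed
  have "j \<le> n \<Longrightarrow> spair w t T (pstep j \<tau> h) (\<lambda>\<omega>. \<Sum>k<j. h k * (w (\<tau> (Suc k)) \<omega> - w (\<tau> k) \<omega>))" for j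
  proof (induction j)
    case 0
    then show ?case using spair_zero by (simp add: pstep_def[abs_def])
  next
    case (Suc j)
    then have "j \<le> n" "j < n" by auto
    from spair_lincomb[OF Suc.IH[OF this(1)] one[OF this(2)], of 1]
    show ?case by (simp only: pstep_def[abs_def] sum.lessThan_Suc mult_1)
  qed
  then show ?thesis by simp
qed

text \<open>The 1 comes from the isometry for a Wiener component, the \<open>T - t\<close> from
  Cauchy-Schwarz for time.\<close>

lemma (in prob_space) spair_second_moment_le:
  assumes fi: "rc_filtration M F" and W: "wiener_process_m M F m f" and t: "0 \<le> t" "t \<le> T"
    and i: "i \<le> m" and p: "spair (wproc f i) t T g X"
  shows "expectation (\<lambda>\<omega>. (X \<omega>)\<^sup>2) \<le> (1 + (T - t)) * (\<integral>x. (g x)\<^sup>2 \<partial>mu t T)"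
proof -
  interpret mu: finite_measure "mu t T" by (rule finite_measure_mu)
  have pos: "0 \<le> (\<integral>x. (g x)\<^sup>2 \<partial>mu t T)" by simp
  show ?thesis
  proof (cases "i = 0")
    case True
    have X: "X = (\<lambda>\<omega>. \<integral>x. g x \<partial>mu t T)" using spair_time p True by blast
    have "expectation (\<lambda>\<omega>. (X \<omega>)\<^sup>2) = (\<integral>x. g x \<partial>mu t T)\<^sup>2" by (simp add: X prob_space)
    also have "\<dots> \<le> (T - t) * (\<integral>x. (g x)\<^sup>2 \<partial>mu t T)"
      using mu.square_integral_le[OF spair_l2_g[OF p]] t by (simp add: measure_mu)
    finally show ?thesis using pos unfolding distrib_right by linarith
  next
    case False
    then have "wiener_process M F (f i)" using W i by (auto simp: wiener_process_m_def)
    then have "expectation (\<lambda>\<omega>. X \<omega> * X \<omega>) = (\<integral>x. g x * g x \<partial>mu t T)"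
      using p False by (intro spair_isometry[OF fi _ t(1)]) (auto simp: wproc_Suc)
    moreover have "0 \<le> (T - t) * (\<integral>x. (g x)\<^sup>2 \<partial>mu t T)" using pos t by simp
    ultimately show ?thesis unfolding distrib_right by (simp add: power2_eq_square)
  qed
qed

text \<open>\<open>spair_second_moment_le\<close> turns convergence of the integrands into the
  Cauchy property of the sums. The second claim treats an arbitrary mesh limit \<open>X\<close>: it
  is also the limit along one sequence of partitions, which is the form \<open>wint\<close> asks
  for.\<close>

lemma (in prob_space) wint_mesh:
  fixes h :: "nat \<Rightarrow> (nat \<Rightarrow> real) \<Rightarrow> nat \<Rightarrow> real"
  assumes fi: "rc_filtration M F" and W: "wiener_process_m M F m f" and t: "0 \<le> t" "t \<le> s" "s \<le> T"
    and i: "i \<le> m" and G: "l2 (mu t T) G"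
    and conv: "\<And>e. e > 0 \<Longrightarrow> \<exists>\<delta>>0. \<forall>n \<tau>. is_partition t s n \<tau> \<and> (\<forall>k<n. \<tau> (Suc k) - \<tau> k < \<delta>) \<longrightarrow>
      (\<integral>x. (pstep n \<tau> (h n \<tau>) x - G x)\<^sup>2 \<partial>mu t T) < e"
  defines "S \<equiv> (\<lambda>n \<tau> \<omega>. \<Sum>k<n. h n \<tau> k * (wproc f i (\<tau> (Suc k)) \<omega> - wproc f i (\<tau> k) \<omega>))"
  shows "\<exists>X. ms_limit_mesh M t s S X"
    and "ms_limit_mesh M t s S X \<Longrightarrow> wint M (wproc f i) t T G X"
proof -
  let ?fine = "\<lambda>\<delta> n \<tau>. is_partition t s n \<tau> \<and> (\<forall>k<n. \<tau> (Suc k) - \<tau> k < \<delta>)"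
  have tT: "t \<le> T" using t by simp
  have sp: "spair (wproc f i) t T (pstep n \<tau> (h n \<tau>)) (S n \<tau>)" if "is_partition t s n \<tau>" for n \<tau>
    unfolding S_def by (rule spair_riemann[OF that t(3)])
  have lS: "l2 M (S n \<tau>)" if "is_partition t s n \<tau>" for n \<tau>
    using spair_wproc_l2[OF fi W t(1) i sp[OF that]] .
  show "\<exists>X. ms_limit_mesh M t s S X"
  proof (rule mesh_limit_exists[OF t(2)])
    fix e :: real assume e: "e > 0"
    define C where "C = 1 + (T - t)"
    have C: "C > 0" using tT by (simp add: C_def)
    \<comment> \<open>The moment bound costs \<open>C\<close>, and passing through \<open>G\<close>
      costs a factor 2 on each of two errors; hence \<open>e / (4 * C)\<close>.\<close>
    obtain \<delta> where \<delta>: "\<delta> > 0" "\<And>n \<tau>. ?fine \<delta> n \<tau> \<Longrightarrow> (\<integral>x. (pstep n \<tau> (h n \<tau>) x - G x)\<^sup>2 \<partial>mu t T) < e / (4 * C)"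
      using conv[of "e / (4 * C)"] e C by auto
    have "l2 M (S n \<tau>) \<and> l2 M (S n' \<tau>') \<and> expectation (\<lambda>\<omega>. (S n \<tau> \<omega> - S n' \<tau>' \<omega>)\<^sup>2) < e"
      if f: "?fine \<delta> n \<tau>" "?fine \<delta> n' \<tau>'" for n \<tau> n' \<tau>'
    proof (intro conjI)
      show "l2 M (S n \<tau>)" "l2 M (S n' \<tau>')" using lS f by auto
      let ?g = "pstep n \<tau> (h n \<tau>)" and ?g' = "pstep n' \<tau>' (h n' \<tau>')"
      have sp2: "spair (wproc f i) t T (\<lambda>x. ?g x + (-1) * ?g' x) (\<lambda>\<omega>. S n \<tau> \<omega> + (-1) * S n' \<tau>' \<omega>)"
        using f by (intro spair_lincomb sp) auto
      have lg: "l2 (mu t T) ?g" "l2 (mu t T) ?g'" using spair_l2_g[OF sp] f by auto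
      have "expectation (\<lambda>\<omega>. (S n \<tau> \<omega> - S n' \<tau>' \<omega>)\<^sup>2) \<le> C * (\<integral>x. (?g x - ?g' x)\<^sup>2 \<partial>mu t T)"
        using spair_second_moment_le[OF fi W t(1) tT i sp2] by (simp add: C_def)
      also have "(\<integral>x. (?g x - ?g' x)\<^sup>2 \<partial>mu t T) \<le> 2 * (\<integral>x. (?g x - G x)\<^sup>2 \<partial>mu t T) + 2 * (\<integral>x. (G x - ?g' x)\<^sup>2 \<partial>mu t T)"
        by (rule integral_square_triangle[OF lg(1) G lg(2)])
      also have "\<dots> < 2 * (e / (4 * C)) + 2 * (e / (4 * C))"
        using \<delta>(2)[OF f(1)] \<delta>(2)[OF f(2)] by (simp add: power2_commute[of "G _"])
      also have "C * (2 * (e / (4 * C)) + 2 * (e / (4 * C))) = e" using C by (simp add: field_simps)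
      finally show "expectation (\<lambda>\<omega>. (S n \<tau> \<omega> - S n' \<tau>' \<omega>)\<^sup>2) < e" using C by simp
    qed
    then show "\<exists>\<delta>>0. \<forall>n \<tau> n' \<tau>'. is_partition t s n \<tau> \<and> (\<forall>k<n. \<tau> (Suc k) - \<tau> k < \<delta>) \<and>
       is_partition t s n' \<tau>' \<and> (\<forall>k<n'. \<tau>' (Suc k) - \<tau>' k < \<delta>) \<longrightarrow>
       l2 M (S n \<tau>) \<and> l2 M (S n' \<tau>') \<and> expectation (\<lambda>\<omega>. (S n \<tau> \<omega> - S n' \<tau>' \<omega>)\<^sup>2) < e"
      using \<delta>(1) by blast
  qed
  assume L: "ms_limit_mesh M t s S X"
  have "\<forall>N. \<exists>n \<tau>. ?fine (inverse (real (Suc N))) n \<tau> \<and> (\<integral>x. (pstep n \<tau> (h n \<tau>) x - G x)\<^sup>2 \<partial>mu t T) < inverse (real (Suc N))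
     \<and> expectation (\<lambda>\<omega>. (S n \<tau> \<omega> - X \<omega>)\<^sup>2) < inverse (real (Suc N))"
  proof
    fix N
    let ?e = "inverse (real (Suc N))"
    have e: "?e > 0" by simp
    obtain \<delta> where \<delta>: "\<delta> > 0" "\<And>n \<tau>. ?fine \<delta> n \<tau> \<Longrightarrow> (\<integral>x. (pstep n \<tau> (h n \<tau>) x - G x)\<^sup>2 \<partial>mu t T) < ?e"
      using conv[OF e] by blast
    obtain \<delta>' where \<delta>': "\<delta>' > 0" "\<And>n \<tau>. is_partition t s n \<tau> \<Longrightarrow> (\<And>k. k < n \<Longrightarrow> \<tau> (Suc k) - \<tau> k < \<delta>') \<Longrightarrow>
       l2 M (S n \<tau>) \<and> expectation (\<lambda>\<omega>. (S n \<tau> \<omega> - X \<omega>)\<^sup>2) < ?e"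
      using ms_limit_meshD[OF L e] by blast
    define d where "d = min ?e (min \<delta> \<delta>')"
    have "d > 0" using e \<delta> \<delta>' by (simp add: d_def)
    from ex_fine_partition[OF t(2) this] obtain n \<tau> where "?fine d n \<tau>" by blast
    then have "?fine ?e n \<tau>" "?fine \<delta> n \<tau>" "?fine \<delta>' n \<tau>" by (auto simp: d_def)
    then show "\<exists>n \<tau>. ?fine ?e n \<tau> \<and> (\<integral>x. (pstep n \<tau> (h n \<tau>) x - G x)\<^sup>2 \<partial>mu t T) < ?e
      \<and> expectation (\<lambda>\<omega>. (S n \<tau> \<omega> - X \<omega>)\<^sup>2) < ?e"
      using \<delta>(2) \<delta>'(2) by blast
  qed
  then obtain n \<tau> where P: "\<And>N. ?fine (inverse (real (Suc N))) (n N) (\<tau> N)"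
    "\<And>N. (\<integral>x. (pstep (n N) (\<tau> N) (h (n N) (\<tau> N)) x - G x)\<^sup>2 \<partial>mu t T) < inverse (real (Suc N))"
    "\<And>N. expectation (\<lambda>\<omega>. (S (n N) (\<tau> N) \<omega> - X \<omega>)\<^sup>2) < inverse (real (Suc N))"
    unfolding choice_iff by blast
  have lim: "a \<longlonglongrightarrow> 0" if "\<And>N. 0 \<le> a N" "\<And>N. a N < inverse (real (Suc N))" for a :: "nat \<Rightarrow> real"
    by (rule tendsto_sandwich[OF _ _ tendsto_const LIMSEQ_inverse_real_of_nat])
       (use that in \<open>auto intro!: always_eventually less_imp_le\<close>)
  show "wint M (wproc f i) t T G X"
    unfolding wint_def
  proof (intro exI conjI allI)
    show "spair (wproc f i) t T (pstep (n N) (\<tau> N) (h (n N) (\<tau> N))) (S (n N) (\<tau> N))" for N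
      using P(1)[of N] by (intro sp) auto
    show "l2conv (mu t T) (\<lambda>N. pstep (n N) (\<tau> N) (h (n N) (\<tau> N))) G"
      unfolding l2conv_def using G P(1) spair_l2_g[OF sp] by (intro conjI allI lim P(2)) auto
    show "l2conv M (\<lambda>N. S (n N) (\<tau> N)) X"
      unfolding l2conv_def using ms_limit_mesh_l2[OF L] P(1) lS by (intro conjI allI lim P(3)) auto
  qed
qed

section \<open>Riemann sums of continuous integrands\<close>

lemma continuous_measurable_mu:
  assumes "continuous_on {t..T} g"
  shows "g \<in> borel_measurable (mu t T)"
proof -
  have "sets (mu t T) = sets (restrict_space borel {t..T})" by (rule sets_restrict_space_cong) simp
  from measurable_cong_sets[OF this refl] show ?thesis
    using borel_measurable_continuous_on_restrict[OF assms] by blast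
qed

lemma continuous_bounded_interval:
  fixes g :: "real \<Rightarrow> real"
  assumes "continuous_on {t..T} g"
  obtains B where "B \<ge> 0" "\<And>x. x \<in> {t..T} \<Longrightarrow> \<bar>g x\<bar> \<le> B"
proof -
  have "bounded (g ` {t..T})" using assms compact_continuous_image compact_imp_bounded by blast
  then obtain B where "\<forall>x\<in>{t..T}. \<bar>g x\<bar> \<le> B" unfolding bounded_iff by auto
  then show ?thesis using that[of "max B 0"] by fastforce
qed

lemma indicator_measurable_mu [measurable]: "(indicator {a<..b} :: real \<Rightarrow> real) \<in> borel_measurable (mu t T)"
  by (rule measurable_mu_borel) simp

lemma l2_cutoff:
  assumes c: "continuous_on {t..T} g"
  shows "l2 (mu t T) (\<lambda>x. g x * indicator {a<..b} x)"
proof -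
  interpret mu: finite_measure "mu t T" by (rule finite_measure_mu)
  obtain B where "B \<ge> 0" "\<And>x. x \<in> {t..T} \<Longrightarrow> \<bar>g x\<bar> \<le> B"
    using continuous_bounded_interval[OF c] by blast
  moreover have [measurable]: "g \<in> borel_measurable (mu t T)" by (rule continuous_measurable_mu[OF c])
  have "(\<lambda>x. g x * indicator {a<..b} x) \<in> borel_measurable (mu t T)" by measurable
  ultimately show ?thesis
    by (intro mu.l2_bounded[of _ B]) (auto simp: abs_mult indicator_def)
qed

lemma l2_continuous:
  assumes c: "continuous_on {t..T} g"
  shows "l2 (mu t T) g"
proof -
  interpret mu: finite_measure "mu t T" by (rule finite_measure_mu)
  obtain B where "B \<ge> 0" "\<And>x. x \<in> {t..T} \<Longrightarrow> \<bar>g x\<bar> \<le> B"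
    using continuous_bounded_interval[OF c] by blast
  then show ?thesis
    using continuous_measurable_mu[OF c] by (intro mu.l2_bounded[of _ B]) auto
qed

lemma pstep_measurable [measurable]: "pstep n \<tau> h \<in> borel_measurable (mu t T)"
  unfolding pstep_def[abs_def] by measurable

lemma uniform_modulus:
  fixes g :: "real \<Rightarrow> real"
  assumes c: "continuous_on {a..b} g" and e: "e > 0"
  obtains \<delta> where "\<delta> > 0" "\<And>x y. x \<in> {a..b} \<Longrightarrow> y \<in> {a..b} \<Longrightarrow> \<bar>x - y\<bar> < \<delta> \<Longrightarrow> \<bar>g x - g y\<bar> < e"
proof -
  have "uniformly_continuous_on {a..b} g" using c by (intro compact_uniformly_continuous) auto
  then show ?thesis using e that unfolding uniformly_continuous_on_def dist_real_def
    by (metis abs_minus_commute)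
qed

lemma pstep_approx:
  fixes h :: "nat \<Rightarrow> (nat \<Rightarrow> real) \<Rightarrow> nat \<Rightarrow> real"
  assumes t: "t \<le> s" "s \<le> T" and c: "continuous_on {t..T} g"
    and h: "\<And>n \<tau> k. h n \<tau> k = g (\<tau> k) \<or> h n \<tau> k = (g (\<tau> k) + g (\<tau> (Suc k))) / 2 \<or> h n \<tau> k = g (\<tau> (Suc k))"
    and e: "e > 0"
  shows "\<exists>\<delta>>0. \<forall>n \<tau>. is_partition t s n \<tau> \<and> (\<forall>k<n. \<tau> (Suc k) - \<tau> k < \<delta>) \<longrightarrow>
      (\<integral>x. (pstep n \<tau> (h n \<tau>) x - g x * indicator {t<..s} x)\<^sup>2 \<partial>mu t T) < e"
proof -
  interpret mu: finite_measure "mu t T" by (rule finite_measure_mu)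
  \<comment> \<open>Here \<open>r^2 (T - t + 1) = e\<close>; the added 1 avoids division by 0 and
    makes the final inequality strict.\<close>
  define r where "r = sqrt (e / (T - t + 1))"
  have r: "r > 0" "r\<^sup>2 = e / (T - t + 1)" using e t by (auto simp: r_def)
  obtain \<delta> where \<delta>: "\<delta> > 0" "\<And>x y. x \<in> {t..T} \<Longrightarrow> y \<in> {t..T} \<Longrightarrow> \<bar>x - y\<bar> < \<delta> \<Longrightarrow> \<bar>g x - g y\<bar> < r"
    using uniform_modulus[OF c r(1)] by blast
  have "(\<integral>x. (pstep n \<tau> (h n \<tau>) x - g x * indicator {t<..s} x)\<^sup>2 \<partial>mu t T) < e"
    if p: "is_partition t s n \<tau>" and f: "\<forall>k<n. \<tau> (Suc k) - \<tau> k < \<delta>" for n \<tau>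
  proof -
    have le: "\<bar>pstep n \<tau> (h n \<tau>) x - g x * indicator {t<..s} x\<bar> \<le> r" if x: "x \<in> {t..T}" for x
    proof (cases "x \<in> {t<..s}")
      case True
      then obtain k where k: "k < n" "\<tau> k < x" "x \<le> \<tau> (Suc k)" using partition_cover[OF p] by auto
      have m: "\<tau> k \<in> {t..T}" "\<tau> (Suc k) \<in> {t..T}" using partition_mem[OF p, of k] partition_mem[OF p, of "Suc k"] k t by auto
      have "\<bar>\<tau> k - x\<bar> < \<delta>" "\<bar>\<tau> (Suc k) - x\<bar> < \<delta>" using k f by (auto simp: abs_if)
      then have "\<bar>g (\<tau> k) - g x\<bar> < r" "\<bar>g (\<tau> (Suc k)) - g x\<bar> < r" using \<delta>(2) m x by auto
      then show ?thesis using True h[of n \<tau> k] pstep_eq[OF p k, of "h n \<tau>"] by (auto simp: abs_if split: if_splits)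
    next
      case False
      then show ?thesis using pstep_outside[OF p False] r by simp
    qed
    have "(\<integral>x. (pstep n \<tau> (h n \<tau>) x - g x * indicator {t<..s} x)\<^sup>2 \<partial>mu t T) \<le> (\<integral>x. r\<^sup>2 \<partial>mu t T)"
    proof (rule integral_mono_AE)
      have [measurable]: "g \<in> borel_measurable (mu t T)" by (rule continuous_measurable_mu[OF c])
      show "integrable (mu t T) (\<lambda>x. (pstep n \<tau> (h n \<tau>) x - g x * indicator {t<..s} x)\<^sup>2)"
        by (rule l2_square, rule mu.l2_bounded[of _ r]) (use le in auto)
      show "AE x in mu t T. (pstep n \<tau> (h n \<tau>) x - g x * indicator {t<..s} x)\<^sup>2 \<le> r\<^sup>2"
        by (rule AE_I2) (use power_mono[OF le, of _ 2] in auto)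
    qed simp
    also have "\<dots> = (T - t) * r\<^sup>2" using t by (simp add: measure_mu)
    also have "\<dots> < (T - t + 1) * r\<^sup>2" using r e t by (intro mult_strict_right_mono) auto
    also have "\<dots> = e" using r t by simp
    finally show ?thesis .
  qed
  then show ?thesis using \<delta>(1) by blast
qed

text \<open>Left-open cells produce integrands cut off at the point \<open>t\<close>; this lemma
  removes the cut.\<close>

lemma wint_cong_AE:
  assumes W: "wint M w t T g X" and g': "g' \<in> borel_measurable (mu t T)" and ae: "AE x in mu t T. g x = g' x"
  shows "wint M w t T g' X"
proof -
  obtain gn Xn where *: "\<forall>n. spair w t T (gn n) (Xn n)" "l2conv (mu t T) gn g" "l2conv M Xn X"
    using W unfolding wint_def by blast
  have g: "l2 (mu t T) g" and gn: "l2 (mu t T) (gn n)" for n using *(2) by (auto simp: l2conv_def)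
  note m = l2_measurable[OF g] l2_measurable[OF gn]
  have "integrable (mu t T) (\<lambda>x. (g' x)\<^sup>2)"
    using l2_square[OF g] by (rule integrable_cong_AE_imp) (use ae g' in auto)
  then have g'2: "l2 (mu t T) g'" using g' by (simp add: l2_def)
  have "(\<integral>x. (gn n x - g x)\<^sup>2 \<partial>mu t T) = (\<integral>x. (gn n x - g' x)\<^sup>2 \<partial>mu t T)" for n
    by (rule integral_cong_AE) (use ae m g' in \<open>auto elim: eventually_mono\<close>)
  then have "l2conv (mu t T) gn g'" using *(2) g'2 by (simp add: l2conv_def)
  then show ?thesis using * unfolding wint_def by blast
qed

lemma AE_mu_neq: "AE x in mu t T. x \<noteq> t"
  by (subst AE_restrict_space_iff) (auto intro: AE_mp[OF AE_lborel_singleton])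

lemma (in prob_space) ito_integral_wint:
  assumes fi: "rc_filtration M F" and W: "wiener_process_m M F m f" and t: "0 \<le> t" "t \<le> T"
    and i: "i \<le> m" and c: "continuous_on {t..T} g"
  shows "\<exists>X. ito_integral M (wproc f i) g t T X"
    and "ito_integral M (wproc f i) g t T X \<Longrightarrow> wint M (wproc f i) t T g X"
proof -
  note W = wint_mesh[where h="\<lambda>n \<tau> k. g (\<tau> k)", OF fi W t order_refl i l2_cutoff[OF c]
      pstep_approx[where h="\<lambda>n \<tau> k. g (\<tau> k)", OF t(2) order_refl c]]
  show "\<exists>X. ito_integral M (wproc f i) g t T X"
    unfolding ito_integral_def by (rule W(1)) auto
  assume "ito_integral M (wproc f i) g t T X"
  then have "wint M (wproc f i) t T (\<lambda>x. g x * indicator {t<..T} x) X"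
    unfolding ito_integral_def by (intro W(2)) auto
  then show "wint M (wproc f i) t T g X"
  proof (rule wint_cong_AE)
    show "g \<in> borel_measurable (mu t T)" by (rule continuous_measurable_mu[OF c])
    show "AE x in mu t T. g x * indicator {t<..T} x = g x"
      using AE_mu_neq AE_space by eventually_elim (auto simp: indicator_def)
  qed
qed

text \<open>For a deterministic integrand the averaged values approximate as well as the left ones.
  The integral over \<open>[t, s]\<close> is read as one over \<open>[t, T]\<close> with a cut-off
  integrand, so that all inner integrals live in one \<open>L2\<close> space.\<close>

lemma (in prob_space) strat_integral_wint:
  assumes fi: "rc_filtration M F" and W: "wiener_process_m M F m f" and t: "0 \<le> t" "t \<le> s" "s \<le> T"
    and i: "i \<le> m" and c: "continuous_on {t..T} g"
  shows "\<exists>X. strat_integral M (wproc f i) (\<lambda>u \<omega>. g u) t s X"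
    and "strat_integral M (wproc f i) (\<lambda>u \<omega>. g u) t s X \<Longrightarrow> wint M (wproc f i) t T (\<lambda>x. g x * indicator {t<..s} x) X"
proof -
  let ?h = "\<lambda>(n::nat) \<tau> (k::nat). (g (\<tau> k) + g (\<tau> (Suc k))) / 2"
  note W = wint_mesh[where h="?h", OF fi W t i l2_cutoff[OF c] pstep_approx[where h="?h", OF t(2,3) c]]
  show "\<exists>X. strat_integral M (wproc f i) (\<lambda>u \<omega>. g u) t s X"
    unfolding strat_integral_def by (rule W(1)) auto
  assume "strat_integral M (wproc f i) (\<lambda>u \<omega>. g u) t s X"
  then show "wint M (wproc f i) t T (\<lambda>x. g x * indicator {t<..s} x) X"
    unfolding strat_integral_def by (intro W(2)) auto
qed

text \<open>The outer increments thereby count as integrals, which makes a Stratonovich sum a form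
  to which the moment bound applies.\<close>

lemma wint_increment:
  assumes p: "is_partition t T n \<tau>" and k: "k < n" and l: "\<And>X g. spair w t T g X \<Longrightarrow> l2 M X"
  shows "wint M w t T (indicator {\<tau> k<..\<tau> (Suc k)}) (\<lambda>\<omega>. w (\<tau> (Suc k)) \<omega> - w (\<tau> k) \<omega>)"
proof -
  have delta: "(\<Sum>j<n. (if j = k then 1 else 0) * F j) = F k" for F :: "nat \<Rightarrow> real"
  proof -
    have "(\<Sum>j<n. (if j = k then 1 else 0) * F j) = (\<Sum>j<n. if j = k then F j else 0)"
      by (intro sum.cong) auto
    then show ?thesis using k by (simp add: sum.delta)
  qed
  have *: "spair w t T (indicator {\<tau> k<..\<tau> (Suc k)}) (\<lambda>\<omega>. w (\<tau> (Suc k)) \<omega> - w (\<tau> k) \<omega>)"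
    using spair_riemann[OF p order_refl, of w "\<lambda>j. if j = k then 1 else 0"]
    unfolding pstep_def[abs_def] delta .
  show ?thesis
    unfolding wint_def using * l[OF *] spair_l2_g[OF *]
    by (intro exI[of _ "\<lambda>n. indicator {\<tau> k<..\<tau> (Suc k)}"] exI[of _ "\<lambda>n \<omega>. w (\<tau> (Suc k)) \<omega> - w (\<tau> k) \<omega>"])
       (auto simp: l2conv_def)
qed

section \<open>Orthonormal bases and the trace\<close>

text \<open>The bridge from Lebesgue integrals over \<open>mu\<close> to the gauge integral, for
  which the fundamental theorem is used; the left end of the cell is a null set.\<close>

lemma integral_mu_cutoff:
  fixes g :: "real \<Rightarrow> real"
  assumes c: "continuous_on {t..T} g" and uv: "t \<le> u" "u \<le> v" "v \<le> T"
  shows "(\<integral>x. g x * indicator {u<..v} x \<partial>mu t T) = integral {u..v} g"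
proof -
  have [measurable]: "g \<in> borel_measurable (mu t T)" by (rule continuous_measurable_mu[OF c])
  have c': "continuous_on {u..v} g" using c uv by (rule_tac continuous_on_subset) auto
  have "(\<integral>x. g x * indicator {u<..v} x \<partial>mu t T) = (\<integral>x. g x * indicator {u..v} x \<partial>mu t T)"
  proof (rule integral_cong_AE)
    have "AE x in mu t T. x \<noteq> u" by (subst AE_restrict_space_iff) (auto intro: AE_mp[OF AE_lborel_singleton])
    then show "AE x in mu t T. g x * indicator {u<..v} x = g x * indicator {u..v} x"
      by eventually_elim (auto simp: indicator_def)
    have "(indicator {u..v} :: real \<Rightarrow> real) \<in> borel_measurable (mu t T)" by (rule measurable_mu_borel) simp
    then show "(\<lambda>x. g x * indicator {u..v} x) \<in> borel_measurable (mu t T)" by measurable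
  qed measurable
  also have "\<dots> = (\<integral>x. indicator {t..T} x *\<^sub>R (g x * indicator {u..v} x) \<partial>lborel)"
    by (rule integral_restrict_space) simp
  also have "\<dots> = (LINT x:{u..v}|lborel. g x)"
    unfolding set_lebesgue_integral_def
    by (rule Bochner_Integration.integral_cong) (use uv in \<open>auto simp: indicator_def\<close>)
  also have "\<dots> = integral {u..v} g"
    by (rule set_borel_integral_eq_integral(2)[OF borel_integrable_atLeastAtMost'[OF c']])
  finally show ?thesis .
qed

lemma integral_mu:
  fixes g :: "real \<Rightarrow> real"
  assumes c: "continuous_on {t..T} g" and t: "t \<le> T"
  shows "(\<integral>x. g x \<partial>mu t T) = integral {t..T} g"
proof -
  have [measurable]: "g \<in> borel_measurable (mu t T)" by (rule continuous_measurable_mu[OF c])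
  have "(\<integral>x. g x \<partial>mu t T) = (\<integral>x. g x * indicator {t<..T} x \<partial>mu t T)"
  proof (rule integral_cong_AE)
    show "AE x in mu t T. g x = g x * indicator {t<..T} x"
      using AE_mu_neq AE_space by eventually_elim (auto simp: indicator_def)
  qed measurable
  then show ?thesis using integral_mu_cutoff[OF c _ t] by simp
qed

text \<open>Pythagoras with arbitrary coefficients: \<open>c = p\<close> yields Bessel's inequality,
  a free \<open>c\<close> shows that the projection is the best approximation. The general index
  type admits the product basis on the square.\<close>

lemma projection_distance:
  fixes e :: "'j \<Rightarrow> 'b \<Rightarrow> real"
  assumes J: "finite J" and h: "l2 N h" and e: "\<And>j. j \<in> J \<Longrightarrow> l2 N (e j)"
    and on: "\<And>j k. j \<in> J \<Longrightarrow> k \<in> J \<Longrightarrow> (\<integral>x. e j x * e k x \<partial>N) = (if j = k then 1 else 0)"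
  defines "p \<equiv> (\<lambda>j. \<integral>x. h x * e j x \<partial>N)"
  shows "(\<integral>x. (h x - (\<Sum>j\<in>J. c j * e j x))\<^sup>2 \<partial>N) = (\<integral>x. (h x)\<^sup>2 \<partial>N) - (\<Sum>j\<in>J. (p j)\<^sup>2) + (\<Sum>j\<in>J. (c j - p j)\<^sup>2)"
proof -
  let ?q = "\<lambda>x. \<Sum>j\<in>J. c j * e j x"
  have hq: "has_bochner_integral N (\<lambda>x. \<Sum>j\<in>J. c j * (h x * e j x)) (\<Sum>j\<in>J. c j * p j)"
    unfolding p_def
    by (intro has_bochner_integral_sum has_bochner_integral_mult_right has_bochner_integral_inner h e)
  have qq: "has_bochner_integral N (\<lambda>x. (?q x)\<^sup>2) (\<Sum>j\<in>J. \<Sum>k\<in>J. (c j * c k) * (\<integral>x. e j x * e k x \<partial>N))"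
    unfolding square_of_sum by (intro has_bochner_integral_double_sum e)
  have "(\<Sum>j\<in>J. \<Sum>k\<in>J. (c j * c k) * (\<integral>x. e j x * e k x \<partial>N)) = (\<Sum>j\<in>J. \<Sum>k\<in>J. if j = k then (c j)\<^sup>2 else 0)"
    by (intro sum.cong refl) (auto simp: on power2_eq_square)
  also have "\<dots> = (\<Sum>j\<in>J. (c j)\<^sup>2)" using J by (simp add: sum.delta)
  finally have qq': "(\<Sum>j\<in>J. \<Sum>k\<in>J. (c j * c k) * (\<integral>x. e j x * e k x \<partial>N)) = (\<Sum>j\<in>J. (c j)\<^sup>2)" .
  have hh: "has_bochner_integral N (\<lambda>x. (h x)\<^sup>2) (\<integral>x. (h x)\<^sup>2 \<partial>N)"
    using l2_square[OF h] by (simp add: has_bochner_integral_iff)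
  have eq: "(\<lambda>x. (h x - ?q x)\<^sup>2) = (\<lambda>x. (h x)\<^sup>2 - 2 * (\<Sum>j\<in>J. c j * (h x * e j x)) + (?q x)\<^sup>2)"
  proof
    fix x
    have "(\<Sum>j\<in>J. c j * (h x * e j x)) = h x * ?q x" by (simp add: sum_distrib_left mult_ac)
    then show "(h x - ?q x)\<^sup>2 = (h x)\<^sup>2 - 2 * (\<Sum>j\<in>J. c j * (h x * e j x)) + (?q x)\<^sup>2"
      by (simp add: power2_eq_square algebra_simps)
  qed
  have "has_bochner_integral N (\<lambda>x. (h x - ?q x)\<^sup>2) ((\<integral>x. (h x)\<^sup>2 \<partial>N) - 2 * (\<Sum>j\<in>J. c j * p j) + (\<Sum>j\<in>J. (c j)\<^sup>2))"
    unfolding eq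
    by (intro has_bochner_integral_add has_bochner_integral_diff has_bochner_integral_mult_right hh hq qq[unfolded qq'])
  from has_bochner_integral_integral_eq[OF this] show ?thesis
    by (simp add: power2_diff sum.distrib sum_subtractf sum_distrib_left mult_ac)
qed

text \<open>Completeness is required only for functions vanishing at both ends, the ones a periodic system can
  approximate uniformly; cutting off near the ends shows that this suffices in \<open>L\<^sub>2\<close>.\<close>

definition onb :: "real \<Rightarrow> real \<Rightarrow> (nat \<Rightarrow> real \<Rightarrow> real) \<Rightarrow> bool" where
  "onb t T \<phi> \<longleftrightarrow> (\<forall>j. continuous_on {t..T} (\<phi> j)) \<and>
     (\<forall>j k. (\<integral>x. \<phi> j x * \<phi> k x \<partial>mu t T) = (if j = k then 1 else 0)) \<and>
     (\<forall>g e. continuous_on {t..T} g \<and> g t = 0 \<and> g T = 0 \<and> e > 0 \<longrightarrow>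
       (\<exists>N c. \<forall>x\<in>{t..T}. \<bar>g x - (\<Sum>j\<le>N. c j * \<phi> j x)\<bar> < e))"

lemma bessel:
  assumes "onb t T \<phi>" "l2 (mu t T) h" "finite J"
  shows "(\<Sum>j\<in>J. (\<integral>x. h x * \<phi> j x \<partial>mu t T)\<^sup>2) \<le> (\<integral>x. (h x)\<^sup>2 \<partial>mu t T)"
proof -
  let ?p = "\<lambda>j. \<integral>x. h x * \<phi> j x \<partial>mu t T"
  have "(\<integral>x. (h x - (\<Sum>j\<in>J. ?p j * \<phi> j x))\<^sup>2 \<partial>mu t T) = (\<integral>x. (h x)\<^sup>2 \<partial>mu t T) - (\<Sum>j\<in>J. (?p j)\<^sup>2) + (\<Sum>j\<in>J. (?p j - ?p j)\<^sup>2)"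
    by (rule projection_distance) (use assms in \<open>auto simp: onb_def intro: l2_continuous\<close>)
  moreover have "0 \<le> (\<integral>x. (h x - (\<Sum>j\<in>J. ?p j * \<phi> j x))\<^sup>2 \<partial>mu t T)" by simp
  ultimately show ?thesis by simp
qed

text \<open>The jumps are replaced by ramps of slope \<open>n\<close> inside the interval, so the
  result vanishes outside it and in particular at \<open>t\<close> and \<open>T\<close>.\<close>

lemma cutoff_continuous_approx:
  fixes g :: "real \<Rightarrow> real"
  assumes c: "continuous_on {t..T} g" and uv: "t \<le> u" "v \<le> T" and e: "e > 0"
  shows "\<exists>g'. continuous_on {t..T} g' \<and> g' t = 0 \<and> g' T = 0 \<and>
    (\<integral>x. (g x * indicator {u<..v} x - g' x)\<^sup>2 \<partial>mu t T) < e"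
proof -
  interpret mu: finite_measure "mu t T" by (rule finite_measure_mu)
  obtain B where B: "B \<ge> 0" "\<And>x. x \<in> {t..T} \<Longrightarrow> \<bar>g x\<bar> \<le> B"
    using continuous_bounded_interval[OF c] by blast
  define r where "r n x = min 1 (real n * max 0 (min (x - u) (v - x)))" for n x
  have r01: "0 \<le> r n x" "r n x \<le> 1" for n x by (auto simp: r_def)
  define g' where "g' n x = g x * r n x" for n x
  have cg': "continuous_on {t..T} (g' n)" for n
    unfolding g'_def[abs_def] r_def by (intro continuous_intros c)
  have z: "g' n t = 0 \<and> g' n T = 0" for n
  proof -
    have "min (t - u) (v - t) \<le> 0" "min (T - u) (v - T) \<le> 0" using uv by auto
    then show ?thesis by (simp add: g'_def r_def max_absorb1)
  qed
  \<comment> \<open>At \<open>v\<close> the ramps stay at 0 while the indicator may be 1; this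
    single point is a null set.\<close>
  have lim: "(\<lambda>n. r n x) \<longlonglongrightarrow> indicator {u<..v} x" if "x \<noteq> v" for x
  proof (cases "u < x \<and> x < v")
    case True
    define d where "d = min (x - u) (v - x)"
    have d: "d > 0" using True by (simp add: d_def)
    obtain n0 :: nat where n0: "1 / d < real n0" using reals_Archimedean2 by blast
    have "r n x = 1" if "n \<ge> n0" for n
    proof -
      have "1 / d \<le> real n" using n0 that by (meson less_imp_le of_nat_mono order_trans)
      then have "1 \<le> real n * d" using d by (simp add: field_simps)
      then show ?thesis using d by (simp add: r_def d_def[symmetric] max_def)
    qed
    then have "\<forall>\<^sub>F n in sequentially. r n x = indicator {u<..v} x"
      using True unfolding eventually_sequentially by (intro exI[of _ n0]) auto
    then show ?thesis by (rule tendsto_eventually)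
  next
    case False
    then have "r n x = indicator {u<..v} x" for n using that by (auto simp: r_def indicator_def max_def min_def)
    then show ?thesis by simp
  qed
  have m[measurable]: "g \<in> borel_measurable (mu t T)" "g' n \<in> borel_measurable (mu t T)" for n
    using c cg' by (auto intro: continuous_measurable_mu)
  have "(\<lambda>n. \<integral>x. (g x * indicator {u<..v} x - g' n x)\<^sup>2 \<partial>mu t T) \<longlonglongrightarrow> (\<integral>x. 0 \<partial>mu t T)"
  proof (rule integral_dominated_convergence[where w="\<lambda>x. B\<^sup>2"])
    have "AE x in mu t T. x \<noteq> v" by (subst AE_restrict_space_iff) (auto intro: AE_mp[OF AE_lborel_singleton])
    then show "AE x in mu t T. (\<lambda>n. (g x * indicator {u<..v} x - g' n x)\<^sup>2) \<longlonglongrightarrow> 0"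
    proof eventually_elim
      case (elim x)
      from tendsto_power[OF tendsto_mult[OF tendsto_const[of "g x"] LIM_zero[OF lim[OF elim]]], of 2]
      show ?case by (simp add: g'_def power2_commute[of "g x * indicator {u<..v} x"] right_diff_distrib)
    qed
    show "AE x in mu t T. norm ((g x * indicator {u<..v} x - g' n x)\<^sup>2) \<le> B\<^sup>2" for n
    proof (rule AE_I2)
      fix x assume x: "x \<in> space (mu t T)"
      have "\<bar>g x * indicator {u<..v} x - g' n x\<bar> = \<bar>g x\<bar> * \<bar>indicator {u<..v} x - r n x\<bar>"
        by (simp add: g'_def right_diff_distrib[symmetric] abs_mult)
      also have "\<dots> \<le> B * 1" using B x r01[of n x] by (intro mult_mono) (auto simp: indicator_def)
      finally show "norm ((g x * indicator {u<..v} x - g' n x)\<^sup>2) \<le> B\<^sup>2"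
        using power_mono[of "\<bar>g x * indicator {u<..v} x - g' n x\<bar>" B 2] by simp
    qed
  qed measurable
  then have "\<forall>\<^sub>F n in sequentially. (\<integral>x. (g x * indicator {u<..v} x - g' n x)\<^sup>2 \<partial>mu t T) < e"
    using e by (auto dest: order_tendstoD(2))
  then obtain n where "(\<integral>x. (g x * indicator {u<..v} x - g' n x)\<^sup>2 \<partial>mu t T) < e"
    unfolding eventually_sequentially by blast
  then show ?thesis using cg' z by blast
qed

text \<open>Bessel gives the upper bound. For the lower one the function is replaced by a continuous
  one vanishing at both ends, that one by a finite combination, and the projection does at least as
  well.\<close>

lemma parseval_cutoff:
  fixes g :: "real \<Rightarrow> real"
  assumes o: "onb t T \<phi>" and c: "continuous_on {t..T} g" and uv: "t \<le> u" "v \<le> T" and t: "t \<le> T"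
  shows "(\<lambda>n. \<Sum>j\<le>n. (\<integral>x. (g x * indicator {u<..v} x) * \<phi> j x \<partial>mu t T)\<^sup>2)
    \<longlonglongrightarrow> (\<integral>x. (g x * indicator {u<..v} x)\<^sup>2 \<partial>mu t T)"
proof (rule LIMSEQ_I)
  interpret mu: finite_measure "mu t T" by (rule finite_measure_mu)
  fix e :: real assume e: "e > 0"
  let ?h = "\<lambda>x. g x * indicator {u<..v} x"
  let ?p = "\<lambda>j. \<integral>x. ?h x * \<phi> j x \<partial>mu t T"
  have lh: "l2 (mu t T) ?h" by (rule l2_cutoff[OF c])
  have lphi: "l2 (mu t T) (\<phi> j)" for j using o by (auto simp: onb_def intro: l2_continuous)
  obtain g' where g': "continuous_on {t..T} g'" "g' t = 0" "g' T = 0" "(\<integral>x. (?h x - g' x)\<^sup>2 \<partial>mu t T) < e / 4"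
    using cutoff_continuous_approx[OF c uv, of "e / 4"] e by auto
  \<comment> \<open>Chosen so that \<open>r^2 (T - t + 1) = e / 4\<close>; two errors of
    \<open>e / 4\<close>, doubled by the triangle inequality, make \<open>e\<close>.\<close>
  define r where "r = sqrt (e / (4 * (T - t + 1)))"
  have r: "r > 0" "r\<^sup>2 = e / (4 * (T - t + 1))" using e t by (auto simp: r_def)
  obtain N c where Nc: "\<And>x. x \<in> {t..T} \<Longrightarrow> \<bar>g' x - (\<Sum>j\<le>N. c j * \<phi> j x)\<bar> < r"
    using o g'(1-3) r(1) unfolding onb_def by blast
  let ?q = "\<lambda>x. \<Sum>j\<le>N. c j * \<phi> j x"
  have lq: "l2 (mu t T) ?q" by (intro l2_sum l2_scale lphi)
  have lg': "l2 (mu t T) g'" by (rule l2_continuous[OF g'(1)])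
  have "(\<integral>x. (g' x - ?q x)\<^sup>2 \<partial>mu t T) \<le> (\<integral>x. r\<^sup>2 \<partial>mu t T)"
  proof (rule integral_mono_AE)
    show "AE x in mu t T. (g' x - ?q x)\<^sup>2 \<le> r\<^sup>2"
      by (rule AE_I2) (use power_mono[OF less_imp_le[OF Nc], of _ 2] in auto)
  qed (use l2_square[OF l2_diff[OF lg' lq]] in auto)
  also have "\<dots> = (T - t) * r\<^sup>2" using t by (simp add: measure_mu)
  also have "\<dots> \<le> (T - t + 1) * r\<^sup>2" by (intro mult_right_mono) auto
  also have "\<dots> = e / 4" using r t by (simp add: field_simps)
  finally have 1: "(\<integral>x. (g' x - ?q x)\<^sup>2 \<partial>mu t T) \<le> e / 4" .
  have dist: "(\<integral>x. (?h x - ?q x)\<^sup>2 \<partial>mu t T) < e"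
    using integral_square_triangle[OF lh lg' lq] 1 g'(4) by simp
  have "(\<integral>x. (?h x - ?q x)\<^sup>2 \<partial>mu t T) = (\<integral>x. (?h x)\<^sup>2 \<partial>mu t T) - (\<Sum>j\<le>N. (?p j)\<^sup>2) + (\<Sum>j\<le>N. (c j - ?p j)\<^sup>2)"
    by (rule projection_distance) (use o lh lphi in \<open>auto simp: onb_def\<close>)
  moreover have "0 \<le> (\<Sum>j\<le>N. (c j - ?p j)\<^sup>2)" by (intro sum_nonneg) simp
  ultimately have lo: "(\<integral>x. (?h x)\<^sup>2 \<partial>mu t T) - (\<Sum>j\<le>N. (?p j)\<^sup>2) < e" using dist by linarith
  have "norm ((\<Sum>j\<le>n. (?p j)\<^sup>2) - (\<integral>x. (?h x)\<^sup>2 \<partial>mu t T)) < e" if "n \<ge> N" for n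
  proof -
    have "(\<Sum>j\<le>N. (?p j)\<^sup>2) \<le> (\<Sum>j\<le>n. (?p j)\<^sup>2)" using that by (intro sum_mono2) auto
    moreover have "(\<Sum>j\<le>n. (?p j)\<^sup>2) \<le> (\<integral>x. (?h x)\<^sup>2 \<partial>mu t T)" by (rule bessel[OF o lh]) simp
    ultimately show ?thesis using lo by simp
  qed
  then show "\<exists>no. \<forall>n\<ge>no. norm ((\<Sum>j\<le>n. (?p j)\<^sup>2) - (\<integral>x. (?h x)\<^sup>2 \<partial>mu t T)) < e" by blast
qed

lemma parseval_continuous:
  fixes g :: "real \<Rightarrow> real"
  assumes o: "onb t T \<phi>" and c: "continuous_on {t..T} g" and t: "t \<le> T"
  shows "(\<lambda>n. \<Sum>j\<le>n. (\<integral>x. g x * \<phi> j x \<partial>mu t T)\<^sup>2) \<longlonglongrightarrow> (\<integral>x. (g x)\<^sup>2 \<partial>mu t T)"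
proof -
  have m: "g \<in> borel_measurable (mu t T)" "\<phi> j \<in> borel_measurable (mu t T)" for j
    using c o by (auto simp: onb_def intro: continuous_measurable_mu)
  have ae: "AE x in mu t T. indicator {t<..T} x = (1::real)"
    using AE_mu_neq AE_space by eventually_elim (auto simp: indicator_def)
  have "(\<integral>x. (g x * indicator {t<..T} x) * \<phi> j x \<partial>mu t T) = (\<integral>x. g x * \<phi> j x \<partial>mu t T)" for j
    by (rule integral_cong_AE) (use ae m in auto)
  moreover have "(\<integral>x. (g x * indicator {t<..T} x)\<^sup>2 \<partial>mu t T) = (\<integral>x. (g x)\<^sup>2 \<partial>mu t T)"
    by (rule integral_cong_AE) (use ae m in auto)
  ultimately show ?thesis
    using parseval_cutoff[OF o c order_refl order_refl t] by simp
qed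

text \<open>With \<open>G\<close> the primitive of \<open>g\<close>, integrating by parts twice makes the iterated integral visibly symmetric.\<close>

lemma iterated_integral_symmetric:
  fixes g r r' :: "real \<Rightarrow> real"
  assumes t: "t \<le> T" and g: "continuous_on {t..T} g" and r': "continuous_on {t..T} r'"
    and r: "\<And>x. x \<in> {t..T} \<Longrightarrow> (r has_real_derivative r' x) (at x within {t..T})"
  defines "G \<equiv> (\<lambda>y. integral {t..y} g)"
  shows "integral {t..T} (\<lambda>y. g y * integral {t..y} (\<lambda>x. r x * g x)) =
    (r t * (G T)\<^sup>2 + integral {t..T} (\<lambda>u. r' u * (G T - G u)\<^sup>2)) / 2"
proof -
  have rc: "continuous_on {t..T} r" using r by (rule DERIV_continuous_on)
  have dG: "(G has_real_derivative g x) (at x within {t..T})" if "x \<in> {t..T}" for x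
    unfolding G_def by (rule integral_has_real_derivative[OF g that])
  have Gc: "continuous_on {t..T} G" using dG by (rule DERIV_continuous_on)
  \<comment> \<open>Primitives for the remainders of the two integrations by parts, started at
    \<open>t\<close> so that they vanish there.\<close>
  define P where "P y = integral {t..y} (\<lambda>x. r' x * G x)" for y
  define Q where "Q y = integral {t..y} (\<lambda>x. r' x * (G x)\<^sup>2)" for y
  have dP: "(P has_real_derivative r' x * G x) (at x within {t..T})" if "x \<in> {t..T}" for x
    unfolding P_def by (rule integral_has_real_derivative[OF _ that]) (intro continuous_intros r' Gc)
  have dQ: "(Q has_real_derivative r' x * (G x)\<^sup>2) (at x within {t..T})" if "x \<in> {t..T}" for x
    unfolding Q_def by (rule integral_has_real_derivative[OF _ that]) (intro continuous_intros r' Gc)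
  have z: "G t = 0" "P t = 0" "Q t = 0" by (auto simp: G_def P_def Q_def)
  have R: "integral {t..y} (\<lambda>x. r x * g x) = r y * G y - P y" if y: "y \<in> {t..T}" for y
  proof -
    have "((\<lambda>x. r x * g x) has_integral (r y * G y - P y) - (r t * G t - P t)) {t..y}"
    proof (rule fundamental_theorem_of_calculus)
      fix x assume "x \<in> {t..y}"
      then have x: "x \<in> {t..T}" using y by auto
      have "((\<lambda>y. r y * G y - P y) has_real_derivative r x * g x) (at x within {t..T})"
        using r[OF x] dG[OF x] dP[OF x] by (auto intro!: derivative_eq_intros simp: algebra_simps)
      then show "((\<lambda>y. r y * G y - P y) has_vector_derivative r x * g x) (at x within {t..y})"
        unfolding has_real_derivative_iff_has_vector_derivative[symmetric]
        by (rule has_field_derivative_subset) (use y in auto)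
    qed (use y in auto)
    then show ?thesis using z by (auto dest: integral_unique)
  qed
  \<comment> \<open>A primitive of \<open>g * (r * G - P)\<close>: the term \<open>Q\<close>
    compensates what remains of \<open>r' * G^2\<close> after differentiating the other two
    terms.\<close>
  define H where "H y = (r y * (G y)\<^sup>2 - 2 * G y * P y + Q y) / 2" for y
  have "((\<lambda>y. g y * (r y * G y - P y)) has_integral H T - H t) {t..T}"
  proof (rule fundamental_theorem_of_calculus[OF t])
    fix x assume x: "x \<in> {t..T}"
    have "(H has_real_derivative g x * (r x * G x - P x)) (at x within {t..T})"
      unfolding H_def[abs_def] using r[OF x] dG[OF x] dP[OF x] dQ[OF x]
      by (auto intro!: derivative_eq_intros simp: field_simps power2_eq_square)
    then show "(H has_vector_derivative g x * (r x * G x - P x)) (at x within {t..T})"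
      by (simp add: has_real_derivative_iff_has_vector_derivative)
  qed
  then have lhs: "integral {t..T} (\<lambda>y. g y * (r y * G y - P y)) = H T" using z by (simp add: integral_unique H_def)
  have eq: "integral {t..T} (\<lambda>y. g y * integral {t..y} (\<lambda>x. r x * g x)) = integral {t..T} (\<lambda>y. g y * (r y * G y - P y))"
    by (rule Henstock_Kurzweil_Integration.integral_cong) (simp add: R)
  have ir: "(r' has_integral r T - r t) {t..T}"
    by (rule fundamental_theorem_of_calculus[OF t]) (use r in \<open>simp add: has_real_derivative_iff_has_vector_derivative\<close>)
  have iP: "((\<lambda>x. r' x * G x) has_integral P T) {t..T}"
    unfolding P_def by (intro integrable_integral integrable_continuous_interval continuous_intros r' Gc)
  have iQ: "((\<lambda>x. r' x * (G x)\<^sup>2) has_integral Q T) {t..T}"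
    unfolding Q_def by (intro integrable_integral integrable_continuous_interval continuous_intros r' Gc)
  \<comment> \<open>The expanded square, integrated term by term, gives \<open>2 * H T\<close> minus
    the boundary term \<open>r t * (G T)^2\<close>.\<close>
  have "((\<lambda>u. (G T)\<^sup>2 * r' u - (2 * G T) * (r' u * G u) + r' u * (G u)\<^sup>2) has_integral
     (G T)\<^sup>2 * (r T - r t) - (2 * G T) * P T + Q T) {t..T}"
    by (intro has_integral_add has_integral_diff has_integral_mult_right ir iP iQ)
  moreover have "(\<lambda>u. (G T)\<^sup>2 * r' u - (2 * G T) * (r' u * G u) + r' u * (G u)\<^sup>2) = (\<lambda>u. r' u * (G T - G u)\<^sup>2)"
    by (auto simp: power2_eq_square algebra_simps)
  ultimately have "integral {t..T} (\<lambda>u. r' u * (G T - G u)\<^sup>2) = (G T)\<^sup>2 * (r T - r t) - (2 * G T) * P T + Q T"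
    by (simp add: integral_unique)
  then show ?thesis unfolding eq lhs H_def by (simp add: algebra_simps)
qed

text \<open>After symmetrisation the partial sums involve only squares of Fourier coefficients.
  Bessel's inequality dominates them uniformly, so Parseval may be used under the integral against
  \<open>r'\<close>.\<close>

lemma trace_limit_weighted:
  fixes r r' q :: "real \<Rightarrow> real"
  assumes o: "onb t T \<phi>" and t: "t \<le> T" and q: "continuous_on {t..T} q" and r': "continuous_on {t..T} r'"
    and r: "\<And>x. x \<in> {t..T} \<Longrightarrow> (r has_real_derivative r' x) (at x within {t..T})"
  shows "(\<lambda>n. \<Sum>j\<le>n. coefC (\<lambda>x. r x * q x) q \<phi> t T j j) \<longlonglongrightarrow> integral {t..T} (\<lambda>x. r x * (q x)\<^sup>2) / 2"
proof -
  interpret mu: finite_measure "mu t T" by (rule finite_measure_mu)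
  have rc: "continuous_on {t..T} r" using r by (rule DERIV_continuous_on)
  have phi: "continuous_on {t..T} (\<phi> j)" for j using o by (auto simp: onb_def)
  define g where "g j x = q x * \<phi> j x" for j x
  have g: "continuous_on {t..T} (g j)" for j unfolding g_def[abs_def] by (intro continuous_intros q phi)
  define G where "G j y = integral {t..y} (g j)" for j y
  have Gc: "continuous_on {t..T} (G j)" for j
    unfolding G_def using integral_has_real_derivative[OF g] by (rule DERIV_continuous_on)
  have C: "coefC (\<lambda>x. r x * q x) q \<phi> t T j j = (r t * (G j T)\<^sup>2 + (\<integral>u. r' u * (G j T - G j u)\<^sup>2 \<partial>mu t T)) / 2" for j
  proof -
    have "coefC (\<lambda>x. r x * q x) q \<phi> t T j j = integral {t..T} (\<lambda>y. g j y * integral {t..y} (\<lambda>x. r x * g j x))"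
      unfolding coefC_def g_def by (simp add: mult.assoc)
    also have "\<dots> = (r t * (G j T)\<^sup>2 + integral {t..T} (\<lambda>u. r' u * (G j T - G j u)\<^sup>2)) / 2"
      unfolding G_def by (rule iterated_integral_symmetric[OF t g r' r])
    also have "integral {t..T} (\<lambda>u. r' u * (G j T - G j u)\<^sup>2) = (\<integral>u. r' u * (G j T - G j u)\<^sup>2 \<partial>mu t T)"
      by (rule integral_mu[symmetric, OF _ t]) (intro continuous_intros r' Gc)
    finally show ?thesis .
  qed
  \<comment> \<open>The tail integral of \<open>q * \<phi> j\<close> is a Fourier coefficient of
    \<open>q\<close> cut off to \<open>(u, T]\<close>; this is why Parseval is needed for cut-off
    functions.\<close>
  have tail: "G j T - G j u = (\<integral>x. (q x * indicator {u<..T} x) * \<phi> j x \<partial>mu t T)" if u: "u \<in> {t..T}" for j u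
  proof -
    have "G j u + integral {u..T} (g j) = G j T"
      unfolding G_def
      by (rule Henstock_Kurzweil_Integration.integral_combine) (use u in \<open>auto intro: integrable_continuous_interval g\<close>)
    moreover have "(\<integral>x. g j x * indicator {u<..T} x \<partial>mu t T) = integral {u..T} (g j)"
      by (rule integral_mu_cutoff[OF g]) (use u in auto)
    ultimately show ?thesis by (simp add: g_def mult_ac)
  qed
  define \<Psi> where "\<Psi> u = integral {u..T} (\<lambda>x. (q x)\<^sup>2)" for u
  have Psi: "(\<integral>x. (q x * indicator {u<..T} x)\<^sup>2 \<partial>mu t T) = \<Psi> u" if u: "u \<in> {t..T}" for u
  proof -
    have "(\<lambda>x. (q x * indicator {u<..T} x)\<^sup>2) = (\<lambda>x. (q x)\<^sup>2 * indicator {u<..T} x)"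
      by (auto simp: indicator_def)
    then show ?thesis unfolding \<Psi>_def
      using integral_mu_cutoff[of t T "\<lambda>x. (q x)\<^sup>2" u T] u by (auto intro!: continuous_intros q)
  qed
  have dPsi: "(\<Psi> has_real_derivative - (q x)\<^sup>2) (at x within {t..T})" if "x \<in> {t..T}" for x
    unfolding \<Psi>_def[abs_def] by (rule integral_has_real_derivative'[OF _ that]) (intro continuous_intros q)
  have Psic: "continuous_on {t..T} \<Psi>" using dPsi by (rule DERIV_continuous_on)
  define S where "S n u = (\<Sum>j\<le>n. (G j T - G j u)\<^sup>2)" for n u
  have S_lim: "(\<lambda>n. S n u) \<longlonglongrightarrow> \<Psi> u" if "u \<in> {t..T}" for u
    unfolding S_def using parseval_cutoff[OF o q _ order_refl t, of u] that by (simp add: tail Psi)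
  have S_le: "S n u \<le> \<Psi> u" if "u \<in> {t..T}" for n u
    unfolding S_def using bessel[OF o l2_cutoff[OF q, of u T], of "{..n}"] that by (simp add: tail Psi)
  have S0: "0 \<le> S n u" for n u unfolding S_def by (intro sum_nonneg) simp
  have Sc: "continuous_on {t..T} (S n)" for n unfolding S_def[abs_def] by (intro continuous_intros Gc)
  have lim1: "(\<lambda>n. r t * S n t) \<longlonglongrightarrow> r t * \<Psi> t"
    using t by (intro tendsto_intros S_lim) auto
  have lim2: "(\<lambda>n. \<integral>u. r' u * S n u \<partial>mu t T) \<longlonglongrightarrow> (\<integral>u. r' u * \<Psi> u \<partial>mu t T)"
  proof (rule integral_dominated_convergence[where w="\<lambda>u. \<bar>r' u\<bar> * \<Psi> u"])
    show "integrable (mu t T) (\<lambda>u. \<bar>r' u\<bar> * \<Psi> u)"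
      by (rule mu.l2_integrable, rule l2_continuous) (intro continuous_intros r' Psic)
    show "AE u in mu t T. (\<lambda>n. r' u * S n u) \<longlonglongrightarrow> r' u * \<Psi> u"
      by (rule AE_I2) (auto intro!: tendsto_intros S_lim)
    show "AE u in mu t T. norm (r' u * S n u) \<le> \<bar>r' u\<bar> * \<Psi> u" for n
      by (rule AE_I2) (use S0 S_le in \<open>auto simp: abs_mult intro!: mult_left_mono\<close>)
  qed (auto intro!: continuous_measurable_mu continuous_intros r' Psic Sc)
  have "(\<Sum>j\<le>n. coefC (\<lambda>x. r x * q x) q \<phi> t T j j) = (r t * S n t + (\<integral>u. r' u * S n u \<partial>mu t T)) / 2" for n
  proof -
    have i: "integrable (mu t T) (\<lambda>u. r' u * (G j T - G j u)\<^sup>2)" for j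
      by (rule mu.l2_integrable, rule l2_continuous) (intro continuous_intros r' Gc)
    have "(\<integral>u. r' u * S n u \<partial>mu t T) = (\<Sum>j\<le>n. \<integral>u. r' u * (G j T - G j u)\<^sup>2 \<partial>mu t T)"
      unfolding S_def sum_distrib_left by (rule Bochner_Integration.integral_sum) (rule i)
    \<comment> \<open>Hence the boundary term is the case \<open>u = t\<close> of the sums
      \<open>S\<close>.\<close>
    moreover have "G j t = 0" for j by (simp add: G_def)
    ultimately show ?thesis
      unfolding C sum_divide_distrib[symmetric] sum.distrib S_def by (simp add: sum_distrib_left)
  qed
  moreover have "(\<lambda>n. (r t * S n t + (\<integral>u. r' u * S n u \<partial>mu t T)) / 2) \<longlonglongrightarrow> (r t * \<Psi> t + (\<integral>u. r' u * \<Psi> u \<partial>mu t T)) / 2"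
    by (intro tendsto_intros lim1 lim2) simp
  \<comment> \<open>Integration by parts backwards: \<open>\<Psi>\<close> has derivative
    \<open>- q^2\<close> and vanishes at \<open>T\<close>, so the boundary term at \<open>t\<close>
    cancels.\<close>
  moreover have "r t * \<Psi> t + (\<integral>u. r' u * \<Psi> u \<partial>mu t T) = integral {t..T} (\<lambda>x. r x * (q x)\<^sup>2)"
  proof -
    have "((\<lambda>x. r' x * \<Psi> x - r x * (q x)\<^sup>2) has_integral r T * \<Psi> T - r t * \<Psi> t) {t..T}"
    proof (rule fundamental_theorem_of_calculus[OF t])
      fix x assume x: "x \<in> {t..T}"
      show "((\<lambda>x. r x * \<Psi> x) has_vector_derivative r' x * \<Psi> x - r x * (q x)\<^sup>2) (at x within {t..T})"
        unfolding has_real_derivative_iff_has_vector_derivative[symmetric]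
        using r[OF x] dPsi[OF x] by (auto intro!: derivative_eq_intros)
    qed
    moreover have "\<Psi> T = 0" by (simp add: \<Psi>_def)
    ultimately have "integral {t..T} (\<lambda>x. r' x * \<Psi> x - r x * (q x)\<^sup>2) = - r t * \<Psi> t"
      by (simp add: integral_unique)
    moreover have "integral {t..T} (\<lambda>x. r' x * \<Psi> x - r x * (q x)\<^sup>2) =
        integral {t..T} (\<lambda>x. r' x * \<Psi> x) - integral {t..T} (\<lambda>x. r x * (q x)\<^sup>2)"
      by (intro Henstock_Kurzweil_Integration.integral_diff integrable_continuous_interval continuous_intros r' Psic rc q)
    moreover have "(\<integral>u. r' u * \<Psi> u \<partial>mu t T) = integral {t..T} (\<lambda>x. r' x * \<Psi> x)"
      by (rule integral_mu[OF _ t]) (intro continuous_intros r' Psic)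
    ultimately show ?thesis by simp
  qed
  ultimately show ?thesis by (simp only:)
qed

lemma continuous_indefinite_integral:
  fixes f :: "real \<Rightarrow> real"
  assumes "continuous_on {t..T} f"
  shows "continuous_on {t..T} (\<lambda>y. integral {t..y} f)"
  using integral_has_real_derivative[OF assms] by (rule DERIV_continuous_on)

lemma trace_limit:
  assumes o: "onb t T \<phi>" and t: "t \<le> T" and p1: "C1_on {t..T} \<psi>1" and p2: "C1_on {t..T} \<psi>2"
  shows "(\<lambda>n. \<Sum>j\<le>n. coefC \<psi>1 \<psi>2 \<phi> t T j j) \<longlonglongrightarrow> integral {t..T} (\<lambda>x. \<psi>1 x * \<psi>2 x) / 2"
proof -
  obtain d1 where d1: "continuous_on {t..T} d1" "\<And>x. x \<in> {t..T} \<Longrightarrow> (\<psi>1 has_real_derivative d1 x) (at x within {t..T})"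
    using p1 unfolding C1_on_def by blast
  obtain d2 where d2: "continuous_on {t..T} d2" "\<And>x. x \<in> {t..T} \<Longrightarrow> (\<psi>2 has_real_derivative d2 x) (at x within {t..T})"
    using p2 unfolding C1_on_def by blast
  have c1: "continuous_on {t..T} \<psi>1" using d1(2) by (rule DERIV_continuous_on)
  have c2: "continuous_on {t..T} \<psi>2" using d2(2) by (rule DERIV_continuous_on)
  have phi: "continuous_on {t..T} (\<phi> j)" for j using o by (auto simp: onb_def)
  obtain B where B: "B \<ge> 0" "\<And>x. x \<in> {t..T} \<Longrightarrow> \<bar>\<psi>2 x\<bar> \<le> B"
    using continuous_bounded_interval[OF c2] by blast
  have pos: "(\<lambda>n. \<Sum>j\<le>n. coefC \<psi>1 q \<phi> t T j j) \<longlonglongrightarrow> integral {t..T} (\<lambda>x. \<psi>1 x * q x) / 2"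
    if q: "continuous_on {t..T} q'" "\<And>x. x \<in> {t..T} \<Longrightarrow> (q has_real_derivative q' x) (at x within {t..T})"
      and q0: "\<And>x. x \<in> {t..T} \<Longrightarrow> q x > 0" for q q'
  proof -
    have qc: "continuous_on {t..T} q" using q(2) by (rule DERIV_continuous_on)
    have nz: "\<forall>x\<in>{t..T}. q x * q x \<noteq> 0" using q0 by force
    have r': "continuous_on {t..T} (\<lambda>x. (d1 x * q x - \<psi>1 x * q' x) / (q x * q x))"
      by (intro continuous_intros d1 q qc c1 nz)
    have r: "((\<lambda>x. \<psi>1 x / q x) has_real_derivative (d1 x * q x - \<psi>1 x * q' x) / (q x * q x)) (at x within {t..T})"
      if "x \<in> {t..T}" for x
      using DERIV_divide[OF d1(2)[OF that] q(2)[OF that]] q0[OF that] by simp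
    have "(\<lambda>n. \<Sum>j\<le>n. coefC (\<lambda>x. (\<psi>1 x / q x) * q x) q \<phi> t T j j) \<longlonglongrightarrow> integral {t..T} (\<lambda>x. (\<psi>1 x / q x) * (q x)\<^sup>2) / 2"
      by (rule trace_limit_weighted[OF o t qc r' r])
    moreover have "integral {t..T} (\<lambda>x. (\<psi>1 x / q x) * (q x)\<^sup>2) = integral {t..T} (\<lambda>x. \<psi>1 x * q x)"
      by (rule Henstock_Kurzweil_Integration.integral_cong) (use q0 in \<open>force simp: power2_eq_square\<close>)
    moreover have "coefC (\<lambda>x. (\<psi>1 x / q x) * q x) q \<phi> t T j j = coefC \<psi>1 q \<phi> t T j j" for j
    proof -
      have "integral {t..y} (\<lambda>x. (\<psi>1 x / q x) * q x * \<phi> j x) = integral {t..y} (\<lambda>x. \<psi>1 x * \<phi> j x)" if "y \<in> {t..T}" for y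
      proof (rule Henstock_Kurzweil_Integration.integral_cong)
        fix x assume "x \<in> {t..y}"
        then have "q x \<noteq> 0" using q0[of x] that by force
        then show "(\<psi>1 x / q x) * q x * \<phi> j x = \<psi>1 x * \<phi> j x" by simp
      qed
      then show ?thesis unfolding coefC_def by (intro Henstock_Kurzweil_Integration.integral_cong) simp
    qed
    ultimately show ?thesis by simp
  qed
  \<comment> \<open>The shift makes \<open>q \<ge> 1\<close>, and \<open>\<psi>2\<close> is the
    difference of the two positive functions \<open>q\<close> and \<open>B + 1\<close>.\<close>
  define q where "q x = \<psi>2 x + (B + 1)" for x
  have A: "(\<lambda>n. \<Sum>j\<le>n. coefC \<psi>1 q \<phi> t T j j) \<longlonglongrightarrow> integral {t..T} (\<lambda>x. \<psi>1 x * q x) / 2"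
  proof (rule pos[of d2])
    show "(q has_real_derivative d2 x) (at x within {t..T})" if "x \<in> {t..T}" for x
      unfolding q_def[abs_def] using d2(2)[OF that] by (auto intro!: derivative_eq_intros)
    show "q x > 0" if "x \<in> {t..T}" for x using B(2)[OF that] by (simp add: q_def abs_if split: if_splits)
  qed (rule d2)
  have A': "(\<lambda>n. \<Sum>j\<le>n. coefC \<psi>1 (\<lambda>_. B + 1) \<phi> t T j j) \<longlonglongrightarrow> integral {t..T} (\<lambda>x. \<psi>1 x * (B + 1)) / 2"
    by (rule pos[of "\<lambda>_. 0"]) (use B in auto)
  have "coefC \<psi>1 \<psi>2 \<phi> t T j j = coefC \<psi>1 q \<phi> t T j j - coefC \<psi>1 (\<lambda>_. B + 1) \<phi> t T j j" for j
    unfolding coefC_def q_def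
    by (subst Henstock_Kurzweil_Integration.integral_diff[symmetric])
       (auto intro!: integrable_continuous_interval continuous_intros c1 c2 phi continuous_indefinite_integral simp: algebra_simps)
  moreover have "integral {t..T} (\<lambda>x. \<psi>1 x * \<psi>2 x) = integral {t..T} (\<lambda>x. \<psi>1 x * q x) - integral {t..T} (\<lambda>x. \<psi>1 x * (B + 1))"
    unfolding q_def
    by (subst Henstock_Kurzweil_Integration.integral_diff[symmetric])
       (auto intro!: integrable_continuous_interval continuous_intros c1 c2 simp: algebra_simps)
  ultimately show ?thesis
    using tendsto_diff[OF A A'] by (simp add: sum_subtractf diff_divide_distrib)
qed

section \<open>Legendre and trigonometric bases\<close>

definition fspan :: "(nat \<Rightarrow> real \<Rightarrow> real) \<Rightarrow> (real \<Rightarrow> real) set" where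
  "fspan \<phi> = {q. \<exists>N c. q = (\<lambda>x. \<Sum>j\<le>N. c j * \<phi> j x)}"

lemma fspanI: "q = (\<lambda>x. \<Sum>j\<le>N. c j * \<phi> j x) \<Longrightarrow> q \<in> fspan \<phi>"
  unfolding fspan_def by blast

lemma fspan_add:
  assumes "p \<in> fspan \<phi>" "q \<in> fspan \<phi>"
  shows "(\<lambda>x. p x + q x) \<in> fspan \<phi>"
proof -
  obtain N c N' c' where e: "p = (\<lambda>x. \<Sum>j\<le>N. c j * \<phi> j x)" "q = (\<lambda>x. \<Sum>j\<le>N'. c' j * \<phi> j x)"
    using assms unfolding fspan_def by blast
  let ?K = "max N N'"
  have pad: "(\<Sum>j\<le>n. d j * \<phi> j x) = (\<Sum>j\<le>?K. (if j \<le> n then d j else 0) * \<phi> j x)" if "n \<le> ?K" for n d x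
    using that by (intro sum.mono_neutral_cong_left) auto
  have "(\<lambda>x. p x + q x) = (\<lambda>x. \<Sum>j\<le>?K. ((if j \<le> N then c j else 0) + (if j \<le> N' then c' j else 0)) * \<phi> j x)"
    unfolding e by (rule ext) (simp only: pad[of N] pad[of N'] max.cobounded1 max.cobounded2 distrib_right sum.distrib)
  then show ?thesis by (rule fspanI)
qed

lemma fspan_scale:
  assumes "p \<in> fspan \<phi>"
  shows "(\<lambda>x. k * p x) \<in> fspan \<phi>"
proof -
  obtain N c where e: "p = (\<lambda>x. \<Sum>j\<le>N. c j * \<phi> j x)" using assms unfolding fspan_def by blast
  have "(\<lambda>x. k * p x) = (\<lambda>x. \<Sum>j\<le>N. (k * c j) * \<phi> j x)" unfolding e by (simp add: sum_distrib_left mult.assoc)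
  then show ?thesis by (rule fspanI)
qed

lemma fspan_basis: "\<phi> j \<in> fspan \<phi>"
proof -
  have "\<phi> j = (\<lambda>x. \<Sum>i\<le>j. (if i = j then 1 else 0) * \<phi> i x)"
    by (rule ext) (simp add: if_distrib[of "\<lambda>u. u * _"] sum.delta cong: if_cong)
  then show ?thesis by (rule fspanI)
qed

lemma fspan_zero: "(\<lambda>x. 0) \<in> fspan \<phi>"
  using fspan_scale[OF fspan_basis, of 0] by simp

lemma fspan_sum: "(\<And>i. i \<in> I \<Longrightarrow> p i \<in> fspan \<phi>) \<Longrightarrow> (\<lambda>x. \<Sum>i\<in>I. p i x) \<in> fspan \<phi>"
  by (induction I rule: infinite_finite_induct) (auto intro: fspan_zero fspan_add)

text \<open>Closure under a multiplier is checked on basis elements only. With the coordinate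
  function, or with cosine and sine, it makes the span closed under multiplication by polynomials in
  them.\<close>

lemma fspan_multiplier:
  assumes b: "\<And>j. (\<lambda>x. u x * \<phi> j x) \<in> fspan \<phi>" and q: "q \<in> fspan \<phi>"
  shows "(\<lambda>x. u x * q x) \<in> fspan \<phi>"
proof -
  obtain N c where e: "q = (\<lambda>x. \<Sum>j\<le>N. c j * \<phi> j x)" using q unfolding fspan_def by blast
  have "(\<lambda>x. u x * q x) = (\<lambda>x. \<Sum>j\<le>N. c j * (u x * \<phi> j x))" unfolding e by (simp add: sum_distrib_left mult_ac)
  then show ?thesis using fspan_sum[of "{..N}" "\<lambda>j x. c j * (u x * \<phi> j x)"] fspan_scale[OF b] by simp
qed

lemma onbI:
  assumes "\<And>j. continuous_on {t..T} (\<phi> j)" and t: "t \<le> T"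
    and "\<And>j k. integral {t..T} (\<lambda>x. \<phi> j x * \<phi> k x) = (if j = k then 1 else 0)"
    and d: "\<And>g e. continuous_on {t..T} g \<Longrightarrow> g t = 0 \<Longrightarrow> g T = 0 \<Longrightarrow> e > 0 \<Longrightarrow> \<exists>q\<in>fspan \<phi>. \<forall>x\<in>{t..T}. \<bar>g x - q x\<bar> < e"
  shows "onb t T \<phi>"
  unfolding onb_def
proof (intro conjI allI impI; (elim conjE)?)
  show "continuous_on {t..T} (\<phi> j)" for j by fact
  show "(\<integral>x. \<phi> j x * \<phi> k x \<partial>mu t T) = (if j = k then 1 else 0)" for j k
    using assms by (subst integral_mu) (auto intro: continuous_on_mult)
  fix g :: "real \<Rightarrow> real" and e :: real
  assume "continuous_on {t..T} g" "g t = 0" "g T = 0" "e > 0"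
  from d[OF this] show "\<exists>N c. \<forall>x\<in>{t..T}. \<bar>g x - (\<Sum>j\<le>N. c j * \<phi> j x)\<bar> < e"
    unfolding fspan_def by blast
qed

section \<open>Legendre polynomials: differential equation, orthogonality, completeness\<close>

fun legendreD :: "nat \<Rightarrow> real \<Rightarrow> real" where
  "legendreD 0 x = 0"
| "legendreD (Suc 0) x = 1"
| "legendreD (Suc (Suc n)) x =
     ((2 * real n + 3) * (legendreP (Suc n) x + x * legendreD (Suc n) x) - (real n + 1) * legendreD n x) / (real n + 2)"

text \<open>\<open>legendreD\<close> is the three-term recurrence differentiated term by term, so
  its recursion scheme is the induction.\<close>

lemma legendreP_deriv: "(legendreP n has_real_derivative legendreD n x) (at x)"
proof (induction n x rule: legendreD.induct)
  case (1 x)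
  have "legendreP 0 = (\<lambda>x. 1)" by auto
  then show ?case by simp
next
  case (2 x)
  have "legendreP (Suc 0) = (\<lambda>x. x)" by auto
  then show ?case by simp
next
  case (3 n x)
  have "legendreP (Suc (Suc n)) = (\<lambda>x. ((2 * real n + 3) * x * legendreP (Suc n) x - (real n + 1) * legendreP n x) / (real n + 2))" by auto
  moreover have "((\<lambda>x. (2 * real n + 3) * x * legendreP (Suc n) x - (real n + 1) * legendreP n x) has_real_derivative
      (2 * real n + 3) * (legendreP (Suc n) x + x * legendreD (Suc n) x) - (real n + 1) * legendreD n x) (at x)"
    by (rule DERIV_cong[OF DERIV_diff[OF DERIV_mult[OF DERIV_cmult_Id 3(1)] DERIV_cmult[OF 3(2)]]]) (simp add: algebra_simps)
  ultimately show ?case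
    unfolding legendreD.simps(3) by (simp only: DERIV_cdivide)
qed

lemma legendreP_rec: "(real n + 2) * legendreP (Suc (Suc n)) x = (2 * real n + 3) * (x * legendreP (Suc n) x) - (real n + 1) * legendreP n x"
  by (simp add: mult.assoc)

lemma legendreD_rec: "(real n + 2) * legendreD (Suc (Suc n)) x =
    (2 * real n + 3) * (legendreP (Suc n) x + x * legendreD (Suc n) x) - (real n + 1) * legendreD n x"
  by simp

declare legendreP.simps(3) [simp del] legendreD.simps(3) [simp del]

text \<open>Two classical relations between neighbouring degrees, proved jointly because the
  induction step draws on both.\<close>

lemma legendreD_identities:
  "legendreD (Suc n) x = x * legendreD n x + (real n + 1) * legendreP n x \<and>
   x * legendreD (Suc n) x - legendreD n x = (real n + 1) * legendreP (Suc n) x"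
proof (induction n)
  case 0
  then show ?case by simp
next
  case (Suc n)
  let ?P = "legendreP n x" and ?P1 = "legendreP (Suc n) x" and ?P2 = "legendreP (Suc (Suc n)) x"
  let ?D = "legendreD n x" and ?D1 = "legendreD (Suc n) x" and ?D2 = "legendreD (Suc (Suc n)) x"
  let ?r = "real n"
  have a: "?D1 = x * ?D + (?r + 1) * ?P" and b: "?D = x * ?D1 - (?r + 1) * ?P1" using Suc by auto
  have "(?r + 2) * ?D2 = (?r + 2) * (x * ?D1 + (?r + 2) * ?P1)"
    unfolding legendreD_rec b by algebra
  then have i: "?D2 = x * ?D1 + (?r + 2) * ?P1" by (simp add: add_nonneg_eq_0_iff)
  have "x * ?D2 - ?D1 = x * (x * ?D1) + (?r + 2) * (x * ?P1) - ?D1" unfolding i by algebra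
  also have "\<dots> = x * (?D + (?r + 1) * ?P1) + (?r + 2) * (x * ?P1) - (x * ?D + (?r + 1) * ?P)" using a b by algebra
  also have "\<dots> = (2 * ?r + 3) * (x * ?P1) - (?r + 1) * ?P" by algebra
  also have "\<dots> = (?r + 2) * ?P2" by (rule legendreP_rec[symmetric])
  finally show ?case using i by (simp add: algebra_simps)
qed

text \<open>Legendre's equation in self-adjoint form. The product \<open>(1 - x^2) P_n'\<close> is
  first reduced to \<open>n (P_{n-1} - x P_n)\<close>, so that only first derivatives have to be
  taken.\<close>

lemma legendre_ode:
  "((\<lambda>x. (1 - x\<^sup>2) * legendreD n x) has_real_derivative - (real n * (real n + 1) * legendreP n x)) (at x)"
proof (cases n)
  case 0
  have "legendreD 0 = (\<lambda>x. 0)" by auto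
  then show ?thesis using 0 by simp
next
  case (Suc k)
  have eq: "(1 - y\<^sup>2) * legendreD (Suc k) y = (real k + 1) * (legendreP k y - y * legendreP (Suc k) y)" for y
    using legendreD_identities[of k y] by algebra
  have "((\<lambda>y. (real k + 1) * (legendreP k y - y * legendreP (Suc k) y)) has_real_derivative
    (real k + 1) * (legendreD k x - (legendreP (Suc k) x + x * legendreD (Suc k) x))) (at x)"
    using legendreP_deriv[of k x] legendreP_deriv[of "Suc k" x] by (auto intro!: derivative_eq_intros)
  moreover have "(real k + 1) * (legendreD k x - (legendreP (Suc k) x + x * legendreD (Suc k) x)) = - (real n * (real n + 1) * legendreP n x)"
  proof -
    have "x * legendreD (Suc k) x = legendreD k x + (real k + 1) * legendreP (Suc k) x" "real n = real k + 1"
      using legendreD_identities[of k x] Suc by auto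
    then show ?thesis unfolding Suc by algebra
  qed
  ultimately show ?thesis unfolding Suc eq by (simp only: Suc)
qed

definition leg_arg :: "real \<Rightarrow> real \<Rightarrow> real \<Rightarrow> real" where
  "leg_arg t T x = (x - (T + t) / 2) * (2 / (T - t))"

lemma leg_arg_ends: "t < T \<Longrightarrow> leg_arg t T t = -1" "t < T \<Longrightarrow> leg_arg t T T = 1"
  by (auto simp: leg_arg_def field_simps)

text \<open>The affine substitution is carried out through a primitive: \<open>F\<close> composed
  with \<open>leg_arg\<close>, whose end values are -1 and 1.\<close>

lemma leg_arg_integral:
  assumes t: "t < T" and F: "\<And>y. (F has_real_derivative F' y) (at y)"
  shows "((\<lambda>x. F' (leg_arg t T x)) has_integral (T - t) / 2 * (F 1 - F (-1))) {t..T}"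
proof -
  have d: "((\<lambda>x. (T - t) / 2 * F (leg_arg t T x)) has_real_derivative F' (leg_arg t T x)) (at x within {t..T})" for x
  proof -
    have "(leg_arg t T has_real_derivative 2 / (T - t)) (at x within {t..T})"
      unfolding leg_arg_def[abs_def]
      by (rule DERIV_cong[OF DERIV_cmult_right[OF DERIV_diff[OF DERIV_ident DERIV_const]]]) simp
    from DERIV_chain2[OF F this] have "((\<lambda>x. F (leg_arg t T x)) has_real_derivative F' (leg_arg t T x) * (2 / (T - t))) (at x within {t..T})" .
    from DERIV_cmult[OF this, of "(T - t) / 2"] show ?thesis using t by simp
  qed
  have "((\<lambda>x. F' (leg_arg t T x)) has_integral (T - t) / 2 * F (leg_arg t T T) - (T - t) / 2 * F (leg_arg t T t)) {t..T}"
    by (rule fundamental_theorem_of_calculus)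
       (use t d in \<open>auto simp: has_real_derivative_iff_has_vector_derivative\<close>)
  then show ?thesis using leg_arg_ends[OF t] by (simp add: right_diff_distrib)
qed

lemma leg_arg_continuous: "continuous_on S (leg_arg t T)"
  unfolding leg_arg_def[abs_def] by (intro continuous_intros)

lemma legendreP_continuous: "continuous_on S (legendreP n)"
  using legendreP_deriv DERIV_isCont continuous_at_imp_continuous_on by blast

lemma legendreP_arg_continuous: "continuous_on S (\<lambda>x. legendreP n (leg_arg t T x))"
  by (rule continuous_on_compose2[OF legendreP_continuous[of UNIV] leg_arg_continuous]) simp

definition legI :: "real \<Rightarrow> real \<Rightarrow> nat \<Rightarrow> nat \<Rightarrow> real" where
  "legI t T m n = integral {t..T} (\<lambda>x. legendreP m (leg_arg t T x) * legendreP n (leg_arg t T x))"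

text \<open>The Sturm-Liouville argument: the Wronskian times \<open>1 - y^2\<close> has derivative
  \<open>?c * P_m * P_n\<close> and vanishes at both ends.\<close>

lemma legendre_orthogonal:
  assumes t: "t < T" and mn: "m \<noteq> n"
  shows "legI t T m n = 0"
proof -
  let ?c = "real m * (real m + 1) - real n * (real n + 1)"
  let ?E = "\<lambda>n y. (1 - y\<^sup>2) * legendreD n y"
  have "((\<lambda>y. ?E n y * legendreP m y - ?E m y * legendreP n y) has_real_derivative ?c * (legendreP m y * legendreP n y)) (at y)" for y
    using DERIV_diff[OF DERIV_mult[OF legendre_ode[of n y] legendreP_deriv[of m y]] DERIV_mult[OF legendre_ode[of m y] legendreP_deriv[of n y]]]
    by (rule DERIV_cong) (simp add: algebra_simps)
  from leg_arg_integral[OF t this]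
  have "((\<lambda>x. ?c * (legendreP m (leg_arg t T x) * legendreP n (leg_arg t T x))) has_integral 0) {t..T}" by simp
  from integral_unique[OF this] have "?c * legI t T m n = 0" unfolding legI_def by simp
  \<comment> \<open>Different degrees have different eigenvalues, as this factorisation
    shows.\<close>
  moreover have "?c = (real m - real n) * (real m + real n + 1)" by algebra
  moreover have "real m - real n \<noteq> 0" "real m + real n + 1 \<noteq> 0" using mn by auto
  ultimately show ?thesis by simp
qed

lemma legendre_rec_integral:
  assumes t: "t < T"
  shows "(real n + 2) * legI t T (Suc (Suc n)) k =
    (2 * real n + 3) * integral {t..T} (\<lambda>x. leg_arg t T x * (legendreP (Suc n) (leg_arg t T x) * legendreP k (leg_arg t T x)))
    - (real n + 1) * legI t T n k"
proof -
  let ?P = "\<lambda>n x. legendreP n (leg_arg t T x)"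
  have "(\<lambda>x. (real n + 2) * (?P (Suc (Suc n)) x * ?P k x)) =
    (\<lambda>x. (2 * real n + 3) * (leg_arg t T x * (?P (Suc n) x * ?P k x)) - (real n + 1) * (?P n x * ?P k x))"
  proof
    fix x
    have "(real n + 2) * (?P (Suc (Suc n)) x * ?P k x) = ((real n + 2) * ?P (Suc (Suc n)) x) * ?P k x" by (simp only: mult.assoc)
    then show "(real n + 2) * (?P (Suc (Suc n)) x * ?P k x) =
       (2 * real n + 3) * (leg_arg t T x * (?P (Suc n) x * ?P k x)) - (real n + 1) * (?P n x * ?P k x)"
      unfolding legendreP_rec by (simp add: algebra_simps)
  qed
  then have "integral {t..T} (\<lambda>x. (real n + 2) * (?P (Suc (Suc n)) x * ?P k x)) =
    integral {t..T} (\<lambda>x. (2 * real n + 3) * (leg_arg t T x * (?P (Suc n) x * ?P k x)) - (real n + 1) * (?P n x * ?P k x))" by simp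
  also have "\<dots> = integral {t..T} (\<lambda>x. (2 * real n + 3) * (leg_arg t T x * (?P (Suc n) x * ?P k x))) - integral {t..T} (\<lambda>x. (real n + 1) * (?P n x * ?P k x))"
    by (intro Henstock_Kurzweil_Integration.integral_diff integrable_continuous_interval continuous_intros legendreP_arg_continuous leg_arg_continuous)
  finally show ?thesis by (simp add: legI_def)
qed

text \<open>The recurrence for degree \<open>n\<close> is tested against \<open>P_n\<close>, the one
  for degree \<open>n + 1\<close> against \<open>P_{n-1}\<close>. Orthogonality removes one term
  from each and leaves the integral of \<open>x P_n P_{n-1}\<close> as common unknown, to be
  eliminated.\<close>

lemma legendre_norm:
  assumes t: "t < T"
  shows "legI t T n n = (T - t) / (2 * real n + 1)"
proof (induction n rule: less_induct)
  case (less n)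
  consider "n = 0" | "n = 1" | k where "n = Suc (Suc k)" by (metis One_nat_def nat.exhaust)
  then show ?case
  proof cases
    case 1
    then show ?thesis using t by (simp add: legI_def)
  next
    case 2
    have "((\<lambda>y::real. y ^ 3 / 3) has_real_derivative y\<^sup>2) (at y)" for y
      by (auto intro!: derivative_eq_intros)
    from integral_unique[OF leg_arg_integral[OF t this]] show ?thesis
      using 2 by (simp add: legI_def power2_eq_square)
  next
    case (3 k)
    let ?M = "\<lambda>a b. integral {t..T} (\<lambda>x. leg_arg t T x * (legendreP a (leg_arg t T x) * legendreP b (leg_arg t T x)))"
    have A: "(real k + 2) * legI t T n n = (2 * real k + 3) * ?M (Suc k) n"
      using legendre_rec_integral[OF t, of k n] legendre_orthogonal[OF t, of k n] 3 by simp
    have B0: "0 = (2 * real (Suc k) + 3) * ?M n (Suc k) - (real (Suc k) + 1) * legI t T (Suc k) (Suc k)"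
      using legendre_rec_integral[OF t, of "Suc k" "Suc k"] legendre_orthogonal[OF t, of "Suc (Suc (Suc k))" "Suc k"] 3 by simp
    have B1: "?M n (Suc k) = ?M (Suc k) n" by (simp add: mult_ac)
    have B2: "legI t T (Suc k) (Suc k) = (T - t) / (2 * real (Suc k) + 1)" using less[of "Suc k"] 3 by simp
    have coeffs: "2 * real (Suc k) + 3 = 2 * real k + 5" "real (Suc k) + 1 = real k + 2" "2 * real (Suc k) + 1 = 2 * real k + 3"
      by auto
    have B: "(2 * real k + 5) * ?M (Suc k) n = (real k + 2) * ((T - t) / (2 * real k + 3))"
      using B0 unfolding B1 B2 coeffs by linarith
    \<comment> \<open>Elimination of \<open>M\<close>, used with \<open>a = 2 k + 5\<close>,
      \<open>b = 2 k + 3\<close>, \<open>c = k + 2\<close> and \<open>d = T - t\<close>.\<close>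
    have solve: "y = d / a" if "a > 0" "b > 0" "c > 0" "a * M = c * (d / b)" "c * y = b * M" for a b c d y M :: real
    proof -
      have "c * (a * y) = b * (a * M)" using that(5) by algebra
      also have "\<dots> = c * d" using that(2,4) by simp
      finally show ?thesis using that(1,3) by (simp add: field_simps)
    qed
    have "legI t T n n = (T - t) / (2 * real k + 5)"
      by (rule solve[OF _ _ _ B A]) auto
    then show ?thesis using 3 by (simp add: algebra_simps)
  qed
qed

lemma phi_legendre_eq: "phi_legendre t T j x = sqrt ((2 * real j + 1) / (T - t)) * legendreP j (leg_arg t T x)"
  by (simp add: phi_legendre_def leg_arg_def)

lemma onb_legendre:
  assumes t: "t < T"
  shows "onb t T (phi_legendre t T)"
proof (rule onbI)
  let ?s = "\<lambda>j. sqrt ((2 * real j + 1) / (T - t))"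
  have s: "?s j > 0" for j using t by simp
  show "continuous_on {t..T} (phi_legendre t T j)" for j
    unfolding phi_legendre_eq[abs_def] by (intro continuous_intros legendreP_arg_continuous)
  show "integral {t..T} (\<lambda>x. phi_legendre t T j x * phi_legendre t T k x) = (if j = k then 1 else 0)" for j k
  proof -
    have "integral {t..T} (\<lambda>x. phi_legendre t T j x * phi_legendre t T k x) =
      integral {t..T} (\<lambda>x. (?s j * ?s k) * (legendreP j (leg_arg t T x) * legendreP k (leg_arg t T x)))"
      by (simp only: phi_legendre_eq mult_ac)
    also have "\<dots> = (?s j * ?s k) * legI t T j k" by (simp add: legI_def)
    also have "\<dots> = (if j = k then 1 else 0)"
    proof (cases "j = k")
      case True
      have "?s j * ?s j = (2 * real j + 1) / (T - t)" using t by simp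
      then show ?thesis using True t by (simp add: legendre_norm[OF t])
    qed (simp add: legendre_orthogonal[OF t])
    finally show ?thesis .
  qed
  let ?Sp = "fspan (phi_legendre t T)"
  have P: "(\<lambda>x. legendreP j (leg_arg t T x)) \<in> ?Sp" for j
  proof -
    have "(\<lambda>x. legendreP j (leg_arg t T x)) = (\<lambda>x. (1 / ?s j) * phi_legendre t T j x)"
    proof -
      have "1 / c * (c * y) = y" if "c > 0" for c y :: real using that by simp
      from this[OF s] show ?thesis by (simp only: phi_legendre_eq)
    qed
    then show ?thesis using fspan_scale[OF fspan_basis[of "phi_legendre t T" j], of "1 / ?s j"] by simp
  qed
  \<comment> \<open>The recurrence solved for \<open>x P_j\<close> shows that multiplication by the
    coordinate preserves the span. The span then contains all powers, and Weierstrass approximation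
    applies.\<close>
  have yP: "(\<lambda>x. leg_arg t T x * legendreP j (leg_arg t T x)) \<in> ?Sp" for j
  proof (cases j)
    case 0
    then show ?thesis using P[of 1] by simp
  next
    case (Suc n)
    have "y * legendreP j y = ((real n + 2) / (2 * real n + 3)) * legendreP (Suc (Suc n)) y + ((real n + 1) / (2 * real n + 3)) * legendreP n y" for y
    proof -
      have "(2 * real n + 3) * (y * legendreP j y) = (real n + 2) * legendreP (Suc (Suc n)) y + (real n + 1) * legendreP n y"
        unfolding legendreP_rec Suc by simp
      then have "y * legendreP j y = ((real n + 2) * legendreP (Suc (Suc n)) y + (real n + 1) * legendreP n y) / (2 * real n + 3)"
        by (simp add: eq_divide_eq mult.commute add_nonneg_eq_0_iff)
      then show ?thesis by (simp only: times_divide_eq_left add_divide_distrib[of "(real n + 2) * _"])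
    qed
    then show ?thesis by (simp only:) (intro fspan_add fspan_scale P)
  qed
  have "(\<lambda>x. leg_arg t T x * phi_legendre t T j x) \<in> ?Sp" for j
    using fspan_scale[OF yP[of j], of "?s j"] by (simp add: phi_legendre_eq mult_ac)
  note mult_y = fspan_multiplier[of "leg_arg t T", OF this]
  have pow: "(\<lambda>x. (leg_arg t T x) ^ i) \<in> ?Sp" for i
  proof (induction i)
    case 0
    then show ?case using P[of 0] by simp
  next
    case (Suc i)
    then show ?case using mult_y by simp
  qed
  fix g :: "real \<Rightarrow> real" and e :: real
  assume g: "continuous_on {t..T} g" and e: "e > 0"
  define h where "h y = g (((T - t) * y + (T + t)) / 2)" for y
  have "continuous_on {-1..1} h"
    unfolding h_def[abs_def]
  proof (rule continuous_on_compose2[OF g])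
    show "(\<lambda>y. ((T - t) * y + (T + t)) / 2) ` {-1..1} \<subseteq> {t..T}"
    proof safe
      fix y :: real assume y: "y \<in> {-1..1}"
      have "(T - t) * y \<le> (T - t) * 1" "(T - t) * (-1) \<le> (T - t) * y" using y t by (intro mult_left_mono; simp)+
      then show "((T - t) * y + (T + t)) / 2 \<in> {t..T}" by simp
    qed
  qed (intro continuous_intros, simp)
  from Stone_Weierstrass_real_polynomial_function[OF compact_Icc this e]
  obtain p where p: "real_polynomial_function p" "\<And>y. y \<in> {-1..1} \<Longrightarrow> \<bar>h y - p y\<bar> < e" by blast
  obtain a n where an: "p = (\<lambda>x. \<Sum>i\<le>n. a i * x ^ i)" using p(1) unfolding real_polynomial_function_iff_sum by blast
  have "(\<lambda>x. p (leg_arg t T x)) \<in> ?Sp" unfolding an by (intro fspan_sum fspan_scale pow)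
  moreover have "\<bar>g x - p (leg_arg t T x)\<bar> < e" if x: "x \<in> {t..T}" for x
  proof -
    have eq: "(T - t) * leg_arg t T x = 2 * x - (T + t)"
    proof -
      have "(T - t) * (c * (2 / (T - t))) = 2 * c" for c using t by simp
      moreover have "2 * (x - (T + t) / 2) = 2 * x - (T + t)" by (simp add: field_simps)
      ultimately show ?thesis unfolding leg_arg_def by (simp only:)
    qed
    have "(T - t) * leg_arg t T x \<le> (T - t) * 1" "(T - t) * (-1) \<le> (T - t) * leg_arg t T x"
      unfolding eq using x by auto
    then have "leg_arg t T x \<in> {-1..1}" using t by (simp only: mult_le_cancel_left_pos atLeastAtMost_iff)
    from p(2)[OF this] show ?thesis unfolding h_def eq by simp
  qed
  ultimately show "\<exists>q\<in>?Sp. \<forall>x\<in>{t..T}. \<bar>g x - q x\<bar> < e"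
    by (intro bexI[of _ "\<lambda>x. p (leg_arg t T x)"] ballI)
qed (use t in simp)

section \<open>Trigonometric system: orthogonality and completeness\<close>

definition ang :: "real \<Rightarrow> real \<Rightarrow> real \<Rightarrow> real" where
  "ang t T x = 2 * pi * (x - t) / (T - t)"

lemma ang_continuous: "continuous_on S (ang t T)"
  unfolding ang_def[abs_def] by (cases "T = t") (auto intro!: continuous_intros)

lemma ang_ends: "t < T \<Longrightarrow> ang t T T = 2 * pi" "ang t T t = 0"
  by (simp_all add: ang_def)

text \<open>Frequencies are integers of either sign because products lead to
  \<open>a - b\<close>.\<close>

lemma integral_cos_ang:
  assumes t: "t < T"
  shows "((\<lambda>x. cos (of_int k * ang t T x)) has_integral (if k = 0 then T - t else 0)) {t..T}"
proof (cases "k = 0")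
  case True
  then show ?thesis using has_integral_const_real[of "1::real" t T] t by simp
next
  case False
  let ?F = "\<lambda>x. sin (of_int k * ang t T x) * ((T - t) / (2 * pi * of_int k))"
  have "((\<lambda>x. cos (of_int k * ang t T x)) has_integral ?F T - ?F t) {t..T}"
    by (rule fundamental_theorem_of_calculus)
       (use t False in \<open>auto simp: has_real_derivative_iff_has_vector_derivative[symmetric] ang_def intro!: derivative_eq_intros\<close>)
  moreover have "sin (of_int k * ang t T T) = 0" using sin_int_2pin[of k] by (simp add: ang_ends(1)[OF t] mult.commute)
  moreover have "sin (of_int k * ang t T t) = 0" by (simp add: ang_ends)
  ultimately show ?thesis using False by simp
qed

lemma integral_sin_ang:
  assumes t: "t < T"
  shows "((\<lambda>x. sin (of_int k * ang t T x)) has_integral 0) {t..T}"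
proof (cases "k = 0")
  case True
  then show ?thesis by simp
next
  case False
  let ?F = "\<lambda>x. - cos (of_int k * ang t T x) * ((T - t) / (2 * pi * of_int k))"
  have "((\<lambda>x. sin (of_int k * ang t T x)) has_integral ?F T - ?F t) {t..T}"
    by (rule fundamental_theorem_of_calculus)
       (use t False in \<open>auto simp: has_real_derivative_iff_has_vector_derivative[symmetric] ang_def intro!: derivative_eq_intros\<close>)
  moreover have "cos (of_int k * ang t T T) = 1" using cos_int_2pin[of k] by (simp add: ang_ends(1)[OF t] mult.commute)
  moreover have "cos (of_int k * ang t T t) = 1" by (simp add: ang_ends)
  ultimately show ?thesis by simp
qed

definition trig_amp :: "real \<Rightarrow> real \<Rightarrow> nat \<Rightarrow> real" where
  "trig_amp t T j = (if j = 0 then 1 / sqrt (T - t) else sqrt (2 / (T - t)))"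

text \<open>The sine of index \<open>2 r - 1\<close> and the cosine of index \<open>2 r\<close>
  share the frequency \<open>r\<close>; index 0 is a cosine of frequency 0.\<close>

definition freq :: "nat \<Rightarrow> int" where
  "freq j = int ((j + 1) div 2)"

lemma phi_trig_eq: "phi_trig t T j x = trig_amp t T j * (if odd j then sin (of_int (freq j) * ang t T x) else cos (of_int (freq j) * ang t T x))"
proof -
  have "(j + 1) div 2 = j div 2" if "even j" using that by (auto elim!: evenE)
  moreover have "2 * pi * r * (x - t) / (T - t) = r * ang t T x" for r by (simp add: ang_def)
  ultimately show ?thesis by (auto simp: phi_trig_def trig_amp_def freq_def ang_ends)
qed

lemma freq_eq_iff: "even j = even k \<Longrightarrow> freq j = freq k \<longleftrightarrow> j = k"
  unfolding freq_def by (cases "even j") (auto elim!: evenE oddE)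

text \<open>For nonnegative frequencies the case \<open>a + b = 0\<close> is frequency 0 alone:
  there it doubles the cosine norm, whence the different amplitude of index 0.\<close>

lemma has_integral_trig_product:
  assumes t: "t < T"
  shows "((\<lambda>x. sin (of_int a * ang t T x) * sin (of_int b * ang t T x)) has_integral
      ((if a = b then T - t else 0) - (if a + b = 0 then T - t else 0)) / 2) {t..T}"
    and "((\<lambda>x. cos (of_int a * ang t T x) * cos (of_int b * ang t T x)) has_integral
      ((if a = b then T - t else 0) + (if a + b = 0 then T - t else 0)) / 2) {t..T}"
    and "((\<lambda>x. sin (of_int a * ang t T x) * cos (of_int b * ang t T x)) has_integral 0) {t..T}"
proof -
  note c = integral_cos_ang[OF t, of "a - b"] integral_cos_ang[OF t, of "a + b"]
  note s = integral_sin_ang[OF t, of "a + b"] integral_sin_ang[OF t, of "a - b"]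
  show "((\<lambda>x. sin (of_int a * ang t T x) * sin (of_int b * ang t T x)) has_integral
      ((if a = b then T - t else 0) - (if a + b = 0 then T - t else 0)) / 2) {t..T}"
    using has_integral_divide[OF has_integral_diff[OF c], of 2]
    by (simp add: sin_times_sin left_diff_distrib distrib_right)
  show "((\<lambda>x. cos (of_int a * ang t T x) * cos (of_int b * ang t T x)) has_integral
      ((if a = b then T - t else 0) + (if a + b = 0 then T - t else 0)) / 2) {t..T}"
    using has_integral_divide[OF has_integral_add[OF c], of 2]
    by (simp add: cos_times_cos left_diff_distrib distrib_right)
  show "((\<lambda>x. sin (of_int a * ang t T x) * cos (of_int b * ang t T x)) has_integral 0) {t..T}"
    using has_integral_divide[OF has_integral_add[OF s], of 2]
    by (simp add: sin_times_cos left_diff_distrib distrib_right)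
qed

lemma phi_trig_inner:
  assumes t: "t < T"
  shows "integral {t..T} (\<lambda>x. phi_trig t T j x * phi_trig t T k x) = (if j = k then 1 else 0)"
proof -
  let ?A = "trig_amp t T"
  have f0: "freq j = 0 \<longleftrightarrow> j = 0" "freq j \<ge> 0" for j by (auto simp: freq_def)
  have A0: "?A 0 * ?A 0 = 1 / (T - t)" using t by (simp add: trig_amp_def)
  have A1: "?A j * ?A j = 2 / (T - t)" if "j \<noteq> 0" for j using t that by (simp add: trig_amp_def)
  have sum0: "freq j + freq k = 0 \<longleftrightarrow> j = 0 \<and> k = 0" using f0 by (metis add_nonneg_eq_0_iff)
  note H = has_integral_trig_product[OF t, of "freq j" "freq k"] has_integral_trig_product(3)[OF t, of "freq k" "freq j"]
  consider "odd j" "odd k" | "even j" "even k" | "odd j" "even k" | "even j" "odd k" by blast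
  then show ?thesis
  proof cases
    case 1
    have h: "((\<lambda>x. (?A j * ?A k) * (sin (of_int (freq j) * ang t T x) * sin (of_int (freq k) * ang t T x))) has_integral
       (?A j * ?A k) * (((if freq j = freq k then T - t else 0) - (if freq j + freq k = 0 then T - t else 0)) / 2)) {t..T}"
      by (intro has_integral_mult_right H)
    have e: "(\<lambda>x. phi_trig t T j x * phi_trig t T k x) = (\<lambda>x. (?A j * ?A k) * (sin (of_int (freq j) * ang t T x) * sin (of_int (freq k) * ang t T x)))"
      using 1 by (simp add: phi_trig_eq mult_ac)
    have "j \<noteq> 0" using 1 by (auto intro: odd_pos)
    then show ?thesis unfolding e integral_unique[OF h] using 1 freq_eq_iff[of j k] sum0 A1[of j] t by (auto simp: field_simps)
  next
    case 2
    have h: "((\<lambda>x. (?A j * ?A k) * (cos (of_int (freq j) * ang t T x) * cos (of_int (freq k) * ang t T x))) has_integral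
       (?A j * ?A k) * (((if freq j = freq k then T - t else 0) + (if freq j + freq k = 0 then T - t else 0)) / 2)) {t..T}"
      by (intro has_integral_mult_right H)
    have e: "(\<lambda>x. phi_trig t T j x * phi_trig t T k x) = (\<lambda>x. (?A j * ?A k) * (cos (of_int (freq j) * ang t T x) * cos (of_int (freq k) * ang t T x)))"
      using 2 by (simp add: phi_trig_eq mult_ac)
    show ?thesis unfolding e integral_unique[OF h] using 2 freq_eq_iff[of j k] sum0 A1[of j] A0 t by (cases "j = 0") (auto simp: field_simps)
  next
    case 3
    have h: "((\<lambda>x. (?A j * ?A k) * (sin (of_int (freq j) * ang t T x) * cos (of_int (freq k) * ang t T x))) has_integral (?A j * ?A k) * 0) {t..T}"
      by (intro has_integral_mult_right H)
    have e: "(\<lambda>x. phi_trig t T j x * phi_trig t T k x) = (\<lambda>x. (?A j * ?A k) * (sin (of_int (freq j) * ang t T x) * cos (of_int (freq k) * ang t T x)))"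
      using 3 by (simp add: phi_trig_eq mult_ac)
    show ?thesis unfolding e integral_unique[OF h] using 3 by auto
  next
    case 4
    have h: "((\<lambda>x. (?A j * ?A k) * (sin (of_int (freq k) * ang t T x) * cos (of_int (freq j) * ang t T x))) has_integral (?A j * ?A k) * 0) {t..T}"
      by (intro has_integral_mult_right H)
    have e: "(\<lambda>x. phi_trig t T j x * phi_trig t T k x) = (\<lambda>x. (?A j * ?A k) * (sin (of_int (freq k) * ang t T x) * cos (of_int (freq j) * ang t T x)))"
      using 4 by (simp add: phi_trig_eq mult_ac)
    show ?thesis unfolding e integral_unique[OF h] using 4 by auto
  qed
qed

text \<open>Parity extends the frequencies to all integers, so that a shift by one never leaves the
  family.\<close>

lemma trig_in_fspan:
  assumes t: "t < T"
  shows "(\<lambda>x. cos (of_int k * ang t T x)) \<in> fspan (phi_trig t T)"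
    and "(\<lambda>x. sin (of_int k * ang t T x)) \<in> fspan (phi_trig t T)"
proof -
  have A: "trig_amp t T j \<noteq> 0" for j using t by (simp add: trig_amp_def)
  have c: "(\<lambda>x. cos (of_int (int n) * ang t T x)) \<in> fspan (phi_trig t T)" for n
    using fspan_scale[OF fspan_basis[of "phi_trig t T" "2 * n"], of "1 / trig_amp t T (2 * n)"] A[of "2 * n"]
    by (simp add: phi_trig_eq freq_def)
  have s: "(\<lambda>x. sin (of_int (int n) * ang t T x)) \<in> fspan (phi_trig t T)" for n
  proof (cases n)
    case 0
    then show ?thesis using fspan_zero by simp
  next
    case (Suc r)
    then show ?thesis
      using fspan_scale[OF fspan_basis[of "phi_trig t T" "2 * r + 1"], of "1 / trig_amp t T (2 * r + 1)"] A[of "2 * r + 1"]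
      by (simp add: phi_trig_eq freq_def)
  qed
  show "(\<lambda>x. cos (of_int k * ang t T x)) \<in> fspan (phi_trig t T)"
    using c[of "nat k"] c[of "nat (- k)"] by (cases "k \<ge> 0") auto
  show "(\<lambda>x. sin (of_int k * ang t T x)) \<in> fspan (phi_trig t T)"
    using s[of "nat k"] fspan_scale[OF s[of "nat (- k)"], of "-1"] by (cases "k \<ge> 0") auto
qed

text \<open>Product-to-sum formulas turn the multiplier into shifts of the frequency by 1 and
  -1.\<close>

lemma trig_multipliers:
  assumes t: "t < T" and q: "q \<in> fspan (phi_trig t T)"
  shows "(\<lambda>x. cos (ang t T x) * q x) \<in> fspan (phi_trig t T)"
    and "(\<lambda>x. sin (ang t T x) * q x) \<in> fspan (phi_trig t T)"
proof -
  let ?c = "\<lambda>k x. cos (of_int k * ang t T x)" and ?s = "\<lambda>k x. sin (of_int k * ang t T x)"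
  note tr = trig_in_fspan[OF t]
  have km: "of_int (k - 1) * ang t T x = of_int k * ang t T x - ang t T x"
    "of_int (k + 1) * ang t T x = of_int k * ang t T x + ang t T x" for k x
    by (simp_all add: left_diff_distrib distrib_right)
  have cc: "cos (ang t T x) * ?c k x = (1/2) * ?c (k - 1) x + (1/2) * ?c (k + 1) x" for k x
    unfolding km using cos_times_cos[of "of_int k * ang t T x" "ang t T x"] by (simp add: mult.commute add_divide_distrib diff_divide_distrib)
  have cs: "cos (ang t T x) * ?s k x = (1/2) * ?s (k + 1) x + (1/2) * ?s (k - 1) x" for k x
    unfolding km using sin_times_cos[of "of_int k * ang t T x" "ang t T x"] by (simp add: mult.commute add_divide_distrib diff_divide_distrib)
  have sc: "sin (ang t T x) * ?c k x = (1/2) * ?s (k + 1) x + (-1/2) * ?s (k - 1) x" for k x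
    unfolding km using cos_times_sin[of "of_int k * ang t T x" "ang t T x"] by (simp add: mult.commute add_divide_distrib diff_divide_distrib)
  have ss: "sin (ang t T x) * ?s k x = (1/2) * ?c (k - 1) x + (-1/2) * ?c (k + 1) x" for k x
    unfolding km using sin_times_sin[of "of_int k * ang t T x" "ang t T x"] by (simp add: mult.commute add_divide_distrib diff_divide_distrib)
  have "(\<lambda>x. cos (ang t T x) * ?c k x) \<in> fspan (phi_trig t T)" "(\<lambda>x. cos (ang t T x) * ?s k x) \<in> fspan (phi_trig t T)"
    "(\<lambda>x. sin (ang t T x) * ?c k x) \<in> fspan (phi_trig t T)" "(\<lambda>x. sin (ang t T x) * ?s k x) \<in> fspan (phi_trig t T)" for k
    unfolding cc cs sc ss by (intro fspan_add fspan_scale tr)+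
  note m = this
  have "(\<lambda>x. cos (ang t T x) * phi_trig t T j x) \<in> fspan (phi_trig t T)" for j
    using fspan_scale[OF m(1)[of "freq j"], of "trig_amp t T j"] fspan_scale[OF m(2)[of "freq j"], of "trig_amp t T j"]
    by (cases "odd j") (simp_all add: phi_trig_eq mult.left_commute)
  then show "(\<lambda>x. cos (ang t T x) * q x) \<in> fspan (phi_trig t T)" by (rule fspan_multiplier[OF _ q])
  have "(\<lambda>x. sin (ang t T x) * phi_trig t T j x) \<in> fspan (phi_trig t T)" for j
    using fspan_scale[OF m(3)[of "freq j"], of "trig_amp t T j"] fspan_scale[OF m(4)[of "freq j"], of "trig_amp t T j"]
    by (cases "odd j") (simp_all add: phi_trig_eq mult.left_commute)
  then show "(\<lambda>x. sin (ang t T x) * q x) \<in> fspan (phi_trig t T)" by (rule fspan_multiplier[OF _ q])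
qed

text \<open>Stated as a multiplier for all \<open>q\<close>, so that the product case of the
  induction is the composition of two multipliers. A real-linear form of \<open>cis a\<close> is a
  combination of \<open>cos a\<close> and \<open>sin a\<close>.\<close>

lemma circle_polynomial_multiplier:
  fixes p :: "complex \<Rightarrow> real"
  assumes p: "real_polynomial_function p" and t: "t < T" and q: "q \<in> fspan (phi_trig t T)"
  shows "(\<lambda>x. p (cis (ang t T x)) * q x) \<in> fspan (phi_trig t T)"
  using p q
proof (induction p arbitrary: q rule: real_polynomial_function.induct)
  case (linear h)
  then interpret bounded_linear h by simp
  have "h (cis a) = cos a * h 1 + sin a * h \<i>" for a
  proof -
    have "cis a = cos a *\<^sub>R 1 + sin a *\<^sub>R \<i>" by (simp add: complex_eq_iff)
    then show ?thesis by (metis add scale real_scaleR_def)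
  qed
  then have "(\<lambda>x. h (cis (ang t T x)) * q x) = (\<lambda>x. h 1 * (cos (ang t T x) * q x) + h \<i> * (sin (ang t T x) * q x))"
    by (simp add: algebra_simps)
  then show ?case by (simp only:) (intro fspan_add fspan_scale trig_multipliers[OF t linear.prems])
next
  case (const c)
  then show ?case by (intro fspan_scale)
next
  case (add f g)
  then show ?case using fspan_add[OF add.IH(1) add.IH(2)] by (simp add: distrib_right)
next
  case (mult f g)
  then show ?case using mult.IH(1)[OF mult.IH(2)[OF mult.prems]] by (simp add: mult.assoc)
qed

text \<open>Equal end values make \<open>g\<close> a function on the circle, where Stone-Weierstrass
  supplies polynomials in two real coordinates; these are trigonometric polynomials in the
  angle.\<close>

lemma onb_trig:
  assumes t: "t < T"
  shows "onb t T (phi_trig t T)"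
proof (rule onbI)
  show "continuous_on {t..T} (phi_trig t T j)" for j
    unfolding phi_trig_eq[abs_def] by (cases "odd j") (auto intro!: continuous_intros ang_continuous)
  show "integral {t..T} (\<lambda>x. phi_trig t T j x * phi_trig t T k x) = (if j = k then 1 else 0)" for j k
    by (rule phi_trig_inner[OF t])
  fix g :: "real \<Rightarrow> real" and e :: real
  assume g: "continuous_on {t..T} g" "g t = 0" "g T = 0" and e: "e > 0"
  define h where "h u = g (t + (T - t) * u)" for u
  have "path h"
    unfolding path_def h_def[abs_def]
  proof (rule continuous_on_compose2[OF g(1)])
    show "(\<lambda>u. t + (T - t) * u) ` {0..1} \<subseteq> {t..T}"
    proof safe
      fix u :: real assume u: "u \<in> {0..1}"
      have "(T - t) * u \<le> (T - t) * 1" using u t by (intro mult_left_mono) auto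
      moreover have "0 \<le> (T - t) * u" using u t by (intro mult_nonneg_nonneg) auto
      ultimately show "t + (T - t) * u \<in> {t..T}" by simp
    qed
  qed (intro continuous_intros)
  \<comment> \<open>\<open>Arg2pi\<close> jumps at 1, so continuity on the circle is not that of a
    composition. It is read off from the passage from loops to circle maps, applied to the trivial
    homotopy of \<open>h\<close> with itself.\<close>
  then have "homotopic_loops UNIV h h"
    using g(2,3) by (simp add: homotopic_loops_refl pathstart_def pathfinish_def h_def)
  from homotopic_with_imp_continuous[OF homotopic_loops_imp_homotopic_circlemaps[OF this]]
  have "continuous_on (sphere 0 1) (h \<circ> (\<lambda>z. Arg2pi z / (2 * pi)))" by blast
  from Stone_Weierstrass_real_polynomial_function[OF compact_sphere this e]
  obtain p where p: "real_polynomial_function p"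
    "\<And>z. z \<in> sphere 0 1 \<Longrightarrow> \<bar>(h \<circ> (\<lambda>z. Arg2pi z / (2 * pi))) z - p z\<bar> < e" by blast
  have "(\<lambda>x. cos (of_int 0 * ang t T x)) \<in> fspan (phi_trig t T)" by (rule trig_in_fspan[OF t])
  from circle_polynomial_multiplier[OF p(1) t this]
  have "(\<lambda>x. p (cis (ang t T x))) \<in> fspan (phi_trig t T)" by simp
  moreover have "\<bar>g x - p (cis (ang t T x))\<bar> < e" if x: "x \<in> {t..T}" for x
  proof -
    have "h (Arg2pi (cis (ang t T x)) / (2 * pi)) = g x"
    proof (cases "x = T")
      case True
      \<comment> \<open>The angle \<open>2 * pi\<close> is read by \<open>Arg2pi\<close> as 0; the
        equal end values of \<open>g\<close> close the gap.\<close>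
      then have "cis (ang t T x) = 1" using t by (simp add: ang_def complex_eq_iff)
      then show ?thesis using True g using Arg2pi_of_real[of 1] by (simp add: h_def)
    next
      case False
      have "(x - t) / (T - t) < 1" "0 \<le> (x - t) / (T - t)" using x False t by (auto simp: field_simps)
      moreover have "ang t T x = (2 * pi) * ((x - t) / (T - t))" by (simp add: ang_def)
      ultimately have a: "0 \<le> ang t T x" "ang t T x < 2 * pi"
        using mult_strict_left_mono[of "(x - t) / (T - t)" 1 "2 * pi"] by (simp_all del: times_divide_eq_right)
      have "Arg2pi (cis (ang t T x)) = ang t T x"
        by (rule Arg2pi_unique[of 1]) (use a in \<open>auto simp: cis_conv_exp\<close>)
      moreover have "t + (T - t) * (ang t T x / (2 * pi)) = x" using t by (simp add: ang_def)
      ultimately show ?thesis by (simp add: h_def)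
    qed
    then show ?thesis using p(2)[of "cis (ang t T x)"] by simp
  qed
  ultimately show "\<exists>q\<in>fspan (phi_trig t T). \<forall>x\<in>{t..T}. \<bar>g x - q x\<bar> < e"
    by (intro bexI[of _ "\<lambda>x. p (cis (ang t T x))"] ballI)
qed (use t in simp)

section \<open>The Volterra kernel\<close>

abbreviation mu2 :: "real \<Rightarrow> real \<Rightarrow> (real \<times> real) measure" where
  "mu2 t T \<equiv> mu t T \<Otimes>\<^sub>M mu t T"

lemma finite_measure_mu2: "finite_measure (mu2 t T)"
  by (intro finite_measure_pair_measure finite_measure_mu)

lemma has_bochner_integral_product:
  fixes a b :: "'b \<Rightarrow> real"
  assumes fin: "finite_measure N" and a: "integrable N a" and b: "integrable N b"
  shows "has_bochner_integral (N \<Otimes>\<^sub>M N) (\<lambda>p. a (fst p) * b (snd p)) ((\<integral>x. a x \<partial>N) * (\<integral>x. b x \<partial>N))"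
proof -
  interpret finite_measure N by (rule fin)
  interpret pair_sigma_finite N N ..
  have [measurable]: "a \<in> borel_measurable N" "b \<in> borel_measurable N" using a b by auto
  have i: "integrable (N \<Otimes>\<^sub>M N) (\<lambda>p. a (fst p) * b (snd p))"
  proof (rule Fubini_integrable)
    show "integrable N (\<lambda>x. \<integral>y. norm (a (fst (x, y)) * b (snd (x, y))) \<partial>N)"
      using a b by (simp add: abs_mult)
    show "AE x in N. integrable N (\<lambda>y. a (fst (x, y)) * b (snd (x, y)))" using b by simp
  qed measurable
  have "(\<integral>p. a (fst p) * b (snd p) \<partial>(N \<Otimes>\<^sub>M N)) = (\<integral>x. \<integral>y. a x * b y \<partial>N \<partial>N)"
    using integral_fst'[OF i] by simp
  then show ?thesis using i by (simp add: has_bochner_integral_iff)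
qed

lemma gram_eq_integral:
  assumes fin: "finite_measure N" and l: "\<And>j. j \<in> J \<Longrightarrow> l2 N (a j)" "\<And>j. j \<in> J \<Longrightarrow> l2 N (b j)"
  shows "gram N J a b = (\<integral>p. (\<Sum>j\<in>J. a j (fst p) * b j (snd p))\<^sup>2 \<partial>(N \<Otimes>\<^sub>M N))"
proof -
  have "has_bochner_integral (N \<Otimes>\<^sub>M N) (\<lambda>p. \<Sum>j\<in>J. \<Sum>k\<in>J. (a j (fst p) * a k (fst p)) * (b j (snd p) * b k (snd p))) (gram N J a b)"
    unfolding gram_def
    by (intro has_bochner_integral_sum has_bochner_integral_product[OF fin, of "\<lambda>x. a _ x * a _ x" "\<lambda>x. b _ x * b _ x"] l2_mult l)
  from has_bochner_integral_integral_eq[OF this] show ?thesis by (simp add: square_of_sum)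
qed

text \<open>From here on a form enters only through its kernel on the square and its trace, however
  the kernel is split into products.\<close>

lemma (in prob_space) quad_wint:
  fixes a b :: "'j \<Rightarrow> real \<Rightarrow> real"
  assumes fi: "rc_filtration M F" and W: "wiener_process_m M F m f" and t: "0 \<le> t" "t \<le> T"
    and i: "i1 \<le> m" "i2 \<le> m"
    and p: "\<And>j. j \<in> J \<Longrightarrow> wint M (wproc f i1) t T (a j) (X j)"
      "\<And>j. j \<in> J \<Longrightarrow> wint M (wproc f i2) t T (b j) (Y j)"
  shows "l2 M (\<lambda>\<omega>. \<Sum>j\<in>J. X j \<omega> * Y j \<omega>)"
    and "expectation (\<lambda>\<omega>. (\<Sum>j\<in>J. X j \<omega> * Y j \<omega>)\<^sup>2)
      \<le> (2 + (T - t) + (T - t)\<^sup>2) * (\<integral>p. (\<Sum>j\<in>J. a j (fst p) * b j (snd p))\<^sup>2 \<partial>mu2 t T)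
      + trace_on i1 i2 * (\<Sum>j\<in>J. \<integral>x. a j x * b j x \<partial>mu t T)\<^sup>2"
proof -
  have "gram (mu t T) J a b = (\<integral>p. (\<Sum>j\<in>J. a j (fst p) * b j (snd p))\<^sup>2 \<partial>mu2 t T)"
    by (intro gram_eq_integral finite_measure_mu) (use wint_l2 p in blast)+
  with quad_wint_gram[where J=J and a=a and b=b and X=X and Y=Y, OF fi W t i p]
  show "l2 M (\<lambda>\<omega>. \<Sum>j\<in>J. X j \<omega> * Y j \<omega>)"
    "expectation (\<lambda>\<omega>. (\<Sum>j\<in>J. X j \<omega> * Y j \<omega>)\<^sup>2)
      \<le> (2 + (T - t) + (T - t)\<^sup>2) * (\<integral>p. (\<Sum>j\<in>J. a j (fst p) * b j (snd p))\<^sup>2 \<partial>mu2 t T)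
      + trace_on i1 i2 * (\<Sum>j\<in>J. \<integral>x. a j x * b j x \<partial>mu t T)\<^sup>2"
    by simp_all
qed

text \<open>The first coordinate is the inner time, the second the outer one; the left-open cut
  matches the integrands of the inner integrals.\<close>

definition kern :: "real \<Rightarrow> (real \<Rightarrow> real) \<Rightarrow> (real \<Rightarrow> real) \<Rightarrow> real \<times> real \<Rightarrow> real" where
  "kern t \<psi>1 \<psi>2 p = \<psi>1 (fst p) * indicator {t<..snd p} (fst p) * \<psi>2 (snd p)"

lemma kern_measurable:
  assumes "continuous_on {t..T} \<psi>1" "continuous_on {t..T} \<psi>2"
  shows "kern t \<psi>1 \<psi>2 \<in> borel_measurable (mu2 t T)"
proof -
  note m[measurable] = assms[THEN continuous_measurable_mu]
  have id: "(\<lambda>x::real. x) \<in> borel_measurable (mu t T)" by (rule measurable_mu_borel) simp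
  have [measurable]: "(\<lambda>p. fst p) \<in> borel_measurable (mu2 t T)" "(\<lambda>p. snd p) \<in> borel_measurable (mu2 t T)"
    using measurable_compose[OF measurable_fst id] measurable_compose[OF measurable_snd id] by auto
  have [measurable]: "(\<lambda>p. \<psi>1 (fst p)) \<in> borel_measurable (mu2 t T)" "(\<lambda>p. \<psi>2 (snd p)) \<in> borel_measurable (mu2 t T)"
    using measurable_compose[OF measurable_fst m(1)] measurable_compose[OF measurable_snd m(2)] by auto
  \<comment> \<open>The moving indicator is rewritten as a comparison of the two coordinates, which
    is jointly measurable.\<close>
  have "(\<lambda>p. if t < fst p \<and> fst p \<le> snd p then \<psi>1 (fst p) * \<psi>2 (snd p) else 0) \<in> borel_measurable (mu2 t T)"
    by measurable
  also have "(\<lambda>p. if t < fst p \<and> fst p \<le> snd p then \<psi>1 (fst p) * \<psi>2 (snd p) else 0) = kern t \<psi>1 \<psi>2"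
    by (auto simp: kern_def indicator_def fun_eq_iff)
  finally show ?thesis .
qed

lemma space_mu2: "space (mu2 t T) = {t..T} \<times> {t..T}"
  by (simp add: space_pair_measure)

lemma kern_l2:
  assumes "continuous_on {t..T} \<psi>1" "continuous_on {t..T} \<psi>2"
  shows "l2 (mu2 t T) (kern t \<psi>1 \<psi>2)"
proof -
  interpret mu2: finite_measure "mu2 t T" by (rule finite_measure_mu2)
  obtain B1 where B1: "B1 \<ge> 0" "\<And>x. x \<in> {t..T} \<Longrightarrow> \<bar>\<psi>1 x\<bar> \<le> B1"
    using continuous_bounded_interval[OF assms(1)] by blast
  obtain B2 where B2: "B2 \<ge> 0" "\<And>x. x \<in> {t..T} \<Longrightarrow> \<bar>\<psi>2 x\<bar> \<le> B2"
    using continuous_bounded_interval[OF assms(2)] by blast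
  show ?thesis
  proof (rule mu2.l2_bounded[of _ "B1 * B2"])
    fix p assume "p \<in> space (mu2 t T)"
    then have "\<bar>\<psi>1 (fst p)\<bar> * \<bar>\<psi>2 (snd p)\<bar> \<le> B1 * B2"
      unfolding space_mu2 by (intro mult_mono B1 B2) auto
    then show "\<bar>kern t \<psi>1 \<psi>2 p\<bar> \<le> B1 * B2" using B1(1) B2(1) by (auto simp: kern_def abs_mult indicator_def)
  qed (rule kern_measurable[OF assms])
qed

lemma tensor_l2:
  assumes "continuous_on {t..T} a" "continuous_on {t..T} b"
  shows "l2 (mu2 t T) (\<lambda>p. a (fst p) * b (snd p))"
proof -
  have "has_bochner_integral (mu2 t T) (\<lambda>p. (a (fst p))\<^sup>2 * (b (snd p))\<^sup>2) ((\<integral>x. (a x)\<^sup>2 \<partial>mu t T) * (\<integral>x. (b x)\<^sup>2 \<partial>mu t T))"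
    by (intro has_bochner_integral_product[where a="\<lambda>x. (a x)\<^sup>2" and b="\<lambda>x. (b x)\<^sup>2"] finite_measure_mu l2_square l2_continuous assms)
  moreover have "(\<lambda>p. a (fst p) * b (snd p)) \<in> borel_measurable (mu2 t T)"
    by (intro borel_measurable_times measurable_compose[OF measurable_fst] measurable_compose[OF measurable_snd]
        continuous_measurable_mu assms)
  ultimately show ?thesis
    by (auto simp: l2_def power_mult_distrib has_bochner_integral_iff)
qed

text \<open>Fubini with the inner time integrated first turns the cut of the kernel into the upper
  limit of the inner integral.\<close>

lemma kern_coefficient:
  assumes c: "continuous_on {t..T} \<psi>1" "continuous_on {t..T} \<psi>2" and phi: "\<And>j. continuous_on {t..T} (\<phi> j)" and t: "t \<le> T"
  shows "(\<integral>p. kern t \<psi>1 \<psi>2 p * (\<phi> j1 (fst p) * \<phi> j2 (snd p)) \<partial>mu2 t T) = coefC \<psi>1 \<psi>2 \<phi> t T j2 j1"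
proof -
  interpret mu: finite_measure "mu t T" by (rule finite_measure_mu)
  interpret pair_sigma_finite "mu t T" "mu t T" ..
  let ?f = "\<lambda>x y. kern t \<psi>1 \<psi>2 (x, y) * (\<phi> j1 x * \<phi> j2 y)"
  have i: "integrable (mu2 t T) (\<lambda>p. kern t \<psi>1 \<psi>2 p * (\<phi> j1 (fst p) * \<phi> j2 (snd p)))"
    by (rule l2_mult[OF kern_l2[OF c] tensor_l2[OF phi phi]])
  then have i': "integrable (mu2 t T) (case_prod ?f)" by (simp add: case_prod_unfold)
  have "(\<integral>p. kern t \<psi>1 \<psi>2 p * (\<phi> j1 (fst p) * \<phi> j2 (snd p)) \<partial>mu2 t T) = (\<integral>y. \<integral>x. ?f x y \<partial>mu t T \<partial>mu t T)"
    unfolding integral_snd[OF i'] by (simp add: case_prod_unfold)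
  also have "\<dots> = (\<integral>y. \<psi>2 y * \<phi> j2 y * integral {t..y} (\<lambda>x. \<psi>1 x * \<phi> j1 x) \<partial>mu t T)"
  proof (rule Bochner_Integration.integral_cong)
    fix y assume "y \<in> space (mu t T)"
    then have y: "t \<le> y" "y \<le> T" by auto
    have "(\<integral>x. ?f x y \<partial>mu t T) = (\<integral>x. (\<psi>2 y * \<phi> j2 y) * ((\<psi>1 x * \<phi> j1 x) * indicator {t<..y} x) \<partial>mu t T)"
      by (simp add: kern_def mult_ac)
    also have "\<dots> = \<psi>2 y * \<phi> j2 y * integral {t..y} (\<lambda>x. \<psi>1 x * \<phi> j1 x)"
      using integral_mu_cutoff[of t T "\<lambda>x. \<psi>1 x * \<phi> j1 x" t y] y by (simp add: continuous_on_mult c phi)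
    finally show "(\<integral>x. ?f x y \<partial>mu t T) = \<psi>2 y * \<phi> j2 y * integral {t..y} (\<lambda>x. \<psi>1 x * \<phi> j1 x)" .
  qed simp
  also have "\<dots> = integral {t..T} (\<lambda>y. \<psi>2 y * \<phi> j2 y * integral {t..y} (\<lambda>x. \<psi>1 x * \<phi> j1 x))"
    by (rule integral_mu[OF _ t]) (intro continuous_intros continuous_indefinite_integral c phi)
  finally show ?thesis by (simp add: coefC_def)
qed

lemma kern_norm:
  assumes c: "continuous_on {t..T} \<psi>1" "continuous_on {t..T} \<psi>2"
  shows "(\<integral>p. (kern t \<psi>1 \<psi>2 p)\<^sup>2 \<partial>mu2 t T) = (\<integral>y. (\<psi>2 y)\<^sup>2 * integral {t..y} (\<lambda>x. (\<psi>1 x)\<^sup>2) \<partial>mu t T)"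
proof -
  interpret mu: finite_measure "mu t T" by (rule finite_measure_mu)
  interpret pair_sigma_finite "mu t T" "mu t T" ..
  let ?f = "\<lambda>x y. (kern t \<psi>1 \<psi>2 (x, y))\<^sup>2"
  have i': "integrable (mu2 t T) (case_prod ?f)"
    using l2_square[OF kern_l2[OF c]] by (simp add: case_prod_unfold)
  have "(\<integral>p. (kern t \<psi>1 \<psi>2 p)\<^sup>2 \<partial>mu2 t T) = (\<integral>y. \<integral>x. ?f x y \<partial>mu t T \<partial>mu t T)"
    unfolding integral_snd[OF i'] by (simp add: case_prod_unfold)
  also have "\<dots> = (\<integral>y. (\<psi>2 y)\<^sup>2 * integral {t..y} (\<lambda>x. (\<psi>1 x)\<^sup>2) \<partial>mu t T)"
  proof (rule Bochner_Integration.integral_cong)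
    fix y assume "y \<in> space (mu t T)"
    then have y: "t \<le> y" "y \<le> T" by auto
    have "(\<integral>x. ?f x y \<partial>mu t T) = (\<integral>x. (\<psi>2 y)\<^sup>2 * ((\<psi>1 x)\<^sup>2 * indicator {t<..y} x) \<partial>mu t T)"
      by (rule Bochner_Integration.integral_cong) (auto simp: kern_def power_mult_distrib indicator_def)
    also have "\<dots> = (\<psi>2 y)\<^sup>2 * integral {t..y} (\<lambda>x. (\<psi>1 x)\<^sup>2)"
      using integral_mu_cutoff[of t T "\<lambda>x. (\<psi>1 x)\<^sup>2" t y] y by (simp add: continuous_on_power c)
    finally show "(\<integral>x. ?f x y \<partial>mu t T) = (\<psi>2 y)\<^sup>2 * integral {t..y} (\<lambda>x. (\<psi>1 x)\<^sup>2)" .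
  qed simp
  finally show ?thesis .
qed

section \<open>Fourier sums of the kernel on the square\<close>

definition fourier_kern :: "(nat \<Rightarrow> nat \<Rightarrow> real) \<Rightarrow> (nat \<Rightarrow> real \<Rightarrow> real) \<Rightarrow> nat \<Rightarrow> nat \<Rightarrow> real \<times> real \<Rightarrow> real" where
  "fourier_kern C \<phi> p1 p2 p = (\<Sum>j1\<le>p1. \<Sum>j2\<le>p2. C j2 j1 * (\<phi> j1 (fst p) * \<phi> j2 (snd p)))"

lemma fourier_kern_l2:
  assumes "\<And>j. continuous_on {t..T} (\<phi> j)"
  shows "l2 (mu2 t T) (fourier_kern C \<phi> p1 p2)"
  unfolding fourier_kern_def[abs_def] by (intro l2_sum l2_scale tensor_l2 assms)

text \<open>Products of basis functions are orthonormal on the square and the coefficients are the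
  projections, so the last sum of \<open>projection_distance\<close> is 0.\<close>

lemma fourier_kern_distance:
  assumes c: "continuous_on {t..T} \<psi>1" "continuous_on {t..T} \<psi>2" and o: "onb t T \<phi>" and t: "t \<le> T"
  defines "C \<equiv> coefC \<psi>1 \<psi>2 \<phi> t T"
  shows "(\<integral>p. (kern t \<psi>1 \<psi>2 p - fourier_kern C \<phi> p1 p2 p)\<^sup>2 \<partial>mu2 t T)
    = (\<integral>p. (kern t \<psi>1 \<psi>2 p)\<^sup>2 \<partial>mu2 t T) - (\<Sum>j1\<le>p1. \<Sum>j2\<le>p2. (C j2 j1)\<^sup>2)"
proof -
  have phi: "continuous_on {t..T} (\<phi> j)" for j using o by (auto simp: onb_def)
  let ?J = "{..p1} \<times> {..p2}"
  let ?e = "\<lambda>j p. \<phi> (fst j) (fst p) * \<phi> (snd j) (snd p)"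
  have on: "(\<integral>p. ?e j p * ?e k p \<partial>mu2 t T) = (if j = k then 1 else 0)" for j k
  proof -
    have "has_bochner_integral (mu2 t T) (\<lambda>p. (\<phi> (fst j) (fst p) * \<phi> (fst k) (fst p)) * (\<phi> (snd j) (snd p) * \<phi> (snd k) (snd p)))
      ((\<integral>x. \<phi> (fst j) x * \<phi> (fst k) x \<partial>mu t T) * (\<integral>x. \<phi> (snd j) x * \<phi> (snd k) x \<partial>mu t T))"
      by (intro has_bochner_integral_product[where a="\<lambda>x. \<phi> (fst j) x * \<phi> (fst k) x" and b="\<lambda>x. \<phi> (snd j) x * \<phi> (snd k) x"]
          finite_measure_mu l2_mult l2_continuous phi)
    from has_bochner_integral_integral_eq[OF this] show ?thesis
      using o by (auto simp: onb_def mult_ac prod_eq_iff)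
  qed
  have "(\<integral>p. (kern t \<psi>1 \<psi>2 p - (\<Sum>j\<in>?J. C (snd j) (fst j) * ?e j p))\<^sup>2 \<partial>mu2 t T)
    = (\<integral>p. (kern t \<psi>1 \<psi>2 p)\<^sup>2 \<partial>mu2 t T) - (\<Sum>j\<in>?J. (\<integral>p. kern t \<psi>1 \<psi>2 p * ?e j p \<partial>mu2 t T)\<^sup>2)
      + (\<Sum>j\<in>?J. (C (snd j) (fst j) - (\<integral>p. kern t \<psi>1 \<psi>2 p * ?e j p \<partial>mu2 t T))\<^sup>2)"
    by (rule projection_distance, simp, intro kern_l2 c, intro tensor_l2 phi, rule on)
  also have "\<dots> = (\<integral>p. (kern t \<psi>1 \<psi>2 p)\<^sup>2 \<partial>mu2 t T) - (\<Sum>j\<in>?J. (C (snd j) (fst j))\<^sup>2)"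
    unfolding kern_coefficient[where \<phi>=\<phi>, OF c phi t] C_def by simp
  also have "(\<Sum>j\<in>?J. (C (snd j) (fst j))\<^sup>2) = (\<Sum>j1\<le>p1. \<Sum>j2\<le>p2. (C j2 j1)\<^sup>2)"
    by (simp add: sum.cartesian_product case_prod_unfold)
  also have "(\<lambda>p. \<Sum>j\<in>?J. C (snd j) (fst j) * ?e j p) = fourier_kern C \<phi> p1 p2"
    by (auto simp: fourier_kern_def sum.cartesian_product case_prod_unfold)
  then have "(\<integral>p. (kern t \<psi>1 \<psi>2 p - (\<Sum>j\<in>?J. C (snd j) (fst j) * ?e j p))\<^sup>2 \<partial>mu2 t T) =
    (\<integral>p. (kern t \<psi>1 \<psi>2 p - fourier_kern C \<phi> p1 p2 p)\<^sup>2 \<partial>mu2 t T)" by metis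
  finally show ?thesis .
qed

text \<open>Parseval is used twice: over \<open>j2\<close> for fixed \<open>j1\<close> in the outer
  variable, then over \<open>j1\<close> at each fixed outer time, where Bessel's bound allows the
  passage under the integral.\<close>

lemma fourier_kern_limit:
  assumes c: "continuous_on {t..T} \<psi>1" "continuous_on {t..T} \<psi>2" and o: "onb t T \<phi>" and t: "t \<le> T" and e: "e > 0"
  defines "C \<equiv> coefC \<psi>1 \<psi>2 \<phi> t T"
  shows "\<exists>P. \<forall>p1\<ge>P. \<forall>p2\<ge>P. (\<integral>p. (kern t \<psi>1 \<psi>2 p - fourier_kern C \<phi> p1 p2 p)\<^sup>2 \<partial>mu2 t T) < e"
proof -
  interpret mu: finite_measure "mu t T" by (rule finite_measure_mu)
  have phi: "continuous_on {t..T} (\<phi> j)" for j using o by (auto simp: onb_def)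
  define c1 where "c1 j y = integral {t..y} (\<lambda>x. \<psi>1 x * \<phi> j x)" for j y
  define m where "m y = integral {t..y} (\<lambda>x. (\<psi>1 x)\<^sup>2)" for y
  have c1c: "continuous_on {t..T} (c1 j)" for j
    unfolding c1_def by (intro continuous_indefinite_integral continuous_intros c phi)
  have mc: "continuous_on {t..T} m"
    unfolding m_def by (intro continuous_indefinite_integral continuous_intros c)
  have c1_eq: "(\<integral>x. (\<psi>1 x * indicator {t<..y} x) * \<phi> j x \<partial>mu t T) = c1 j y" if "y \<in> {t..T}" for j y
    using integral_mu_cutoff[of t T "\<lambda>x. \<psi>1 x * \<phi> j x" t y] that
    by (simp add: c1_def continuous_on_mult c phi mult_ac)
  have m_eq: "(\<integral>x. (\<psi>1 x * indicator {t<..y} x)\<^sup>2 \<partial>mu t T) = m y" if "y \<in> {t..T}" for y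
  proof -
    have "(\<lambda>x. (\<psi>1 x * indicator {t<..y} x)\<^sup>2) = (\<lambda>x. (\<psi>1 x)\<^sup>2 * indicator {t<..y} x)" by (auto simp: indicator_def)
    then show ?thesis using integral_mu_cutoff[of t T "\<lambda>x. (\<psi>1 x)\<^sup>2" t y] that
      by (simp add: m_def continuous_on_power c)
  qed
  define D where "D j = (\<integral>y. (\<psi>2 y)\<^sup>2 * (c1 j y)\<^sup>2 \<partial>mu t T)" for j
  define L where "L = (\<integral>y. (\<psi>2 y)\<^sup>2 * m y \<partial>mu t T)"
  have L: "(\<integral>p. (kern t \<psi>1 \<psi>2 p)\<^sup>2 \<partial>mu2 t T) = L" unfolding kern_norm[OF c] L_def m_def ..
  have C_eq: "C j2 j1 = (\<integral>y. (\<psi>2 y * c1 j1 y) * \<phi> j2 y \<partial>mu t T)" for j1 j2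
  proof -
    have "(\<integral>y. \<psi>2 y * \<phi> j2 y * c1 j1 y \<partial>mu t T) = integral {t..T} (\<lambda>y. \<psi>2 y * \<phi> j2 y * c1 j1 y)"
      by (rule integral_mu[OF _ t]) (intro continuous_intros c c1c phi)
    then show ?thesis unfolding C_def coefC_def c1_def by (simp add: mult_ac)
  qed
  have inner: "(\<lambda>n. \<Sum>j2\<le>n. (C j2 j1)\<^sup>2) \<longlonglongrightarrow> D j1" for j1
    unfolding C_eq D_def power_mult_distrib[symmetric]
    by (intro parseval_continuous[OF o _ t] continuous_intros c c1c)
  define s where "s n y = (\<Sum>j\<le>n. (c1 j y)\<^sup>2)" for n y
  have sc: "continuous_on {t..T} (s n)" for n unfolding s_def[abs_def] by (intro continuous_intros c1c)
  have s0: "0 \<le> s n y" for n y unfolding s_def by (intro sum_nonneg) simp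
  have s_le: "s n y \<le> m y" if "y \<in> {t..T}" for n y
    using bessel[OF o l2_cutoff[OF c(1)], of "{..n}" t y] that by (simp add: s_def c1_eq m_eq)
  have s_lim: "(\<lambda>n. s n y) \<longlonglongrightarrow> m y" if "y \<in> {t..T}" for y
    using parseval_cutoff[OF o c(1) order_refl _ t, of y] that by (simp add: s_def c1_eq m_eq)
  have sD: "(\<Sum>j\<le>n. D j) = (\<integral>y. (\<psi>2 y)\<^sup>2 * s n y \<partial>mu t T)" for n
    unfolding D_def s_def sum_distrib_left
    by (rule Bochner_Integration.integral_sum[symmetric], rule mu.l2_integrable, rule l2_continuous)
       (intro continuous_intros c c1c)
  have outer: "(\<lambda>n. \<Sum>j\<le>n. D j) \<longlonglongrightarrow> L"
    unfolding sD L_def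
  proof (rule integral_dominated_convergence[where w="\<lambda>y. (\<psi>2 y)\<^sup>2 * m y"])
    show "integrable (mu t T) (\<lambda>y. (\<psi>2 y)\<^sup>2 * m y)"
      by (rule mu.l2_integrable, rule l2_continuous) (intro continuous_intros c mc)
    show "AE y in mu t T. (\<lambda>n. (\<psi>2 y)\<^sup>2 * s n y) \<longlonglongrightarrow> (\<psi>2 y)\<^sup>2 * m y"
      by (rule AE_I2) (auto intro!: tendsto_intros s_lim)
    show "AE y in mu t T. norm ((\<psi>2 y)\<^sup>2 * s n y) \<le> (\<psi>2 y)\<^sup>2 * m y" for n
      by (rule AE_I2) (use s0 s_le in \<open>auto simp: abs_mult intro!: mult_left_mono\<close>)
  qed (auto intro!: continuous_measurable_mu continuous_intros c mc sc)
  have "\<forall>\<^sub>F n in sequentially. L - e / 2 < (\<Sum>j\<le>n. D j)"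
    by (rule order_tendstoD(1)[OF outer]) (use e in simp)
  then obtain P1 where P1: "L - e / 2 < (\<Sum>j\<le>P1. D j)" unfolding eventually_sequentially by blast
  have "(\<lambda>n. \<Sum>j1\<le>P1. \<Sum>j2\<le>n. (C j2 j1)\<^sup>2) \<longlonglongrightarrow> (\<Sum>j\<le>P1. D j)"
    by (intro tendsto_sum inner)
  then have "\<forall>\<^sub>F n in sequentially. (\<Sum>j\<le>P1. D j) - e / 2 < (\<Sum>j1\<le>P1. \<Sum>j2\<le>n. (C j2 j1)\<^sup>2)"
    by (rule order_tendstoD(1)) (use e in simp)
  then obtain P2 where P2: "(\<Sum>j\<le>P1. D j) - e / 2 < (\<Sum>j1\<le>P1. \<Sum>j2\<le>P2. (C j2 j1)\<^sup>2)"
    unfolding eventually_sequentially by blast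
  \<comment> \<open>The error decreases in \<open>p1\<close> and in \<open>p2\<close>, so the single
    pair \<open>P1\<close>, \<open>P2\<close> settles all larger pairs and the indices may grow
    independently.\<close>
  show ?thesis
  proof (intro exI[of _ "max P1 P2"] allI impI)
    fix p1 p2 assume p: "max P1 P2 \<le> p1" "max P1 P2 \<le> p2"
    have "(\<Sum>j1\<le>P1. \<Sum>j2\<le>P2. (C j2 j1)\<^sup>2) \<le> (\<Sum>j1\<le>P1. \<Sum>j2\<le>p2. (C j2 j1)\<^sup>2)"
      using p by (intro sum_mono sum_mono2) auto
    also have "\<dots> \<le> (\<Sum>j1\<le>p1. \<Sum>j2\<le>p2. (C j2 j1)\<^sup>2)"
      using p by (intro sum_mono2) (auto intro!: sum_nonneg)
    finally show "(\<integral>p. (kern t \<psi>1 \<psi>2 p - fourier_kern C \<phi> p1 p2 p)\<^sup>2 \<partial>mu2 t T) < e"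
      using P1 P2 unfolding C_def fourier_kern_distance[OF c o t] L[unfolded C_def] by linarith
  qed
qed

section \<open>Kernel of the trapezoidal sums\<close>

definition mesh_a :: "real \<Rightarrow> (real \<Rightarrow> real) \<Rightarrow> (real \<Rightarrow> real) \<Rightarrow> (nat \<Rightarrow> real) \<Rightarrow> nat \<Rightarrow> real \<Rightarrow> real" where
  "mesh_a t \<psi>1 \<psi>2 \<tau> k x = (\<psi>2 (\<tau> k) / 2) * (\<psi>1 x * indicator {t<..\<tau> k} x)
     + (\<psi>2 (\<tau> (Suc k)) / 2) * (\<psi>1 x * indicator {t<..\<tau> (Suc k)} x)"

text \<open>The random value at \<open>\<tau> k\<close> is itself an integral of
  \<open>\<psi>1\<close> cut at \<open>\<tau> k\<close>, which gives \<open>mesh_a\<close> in the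
  inner variable; the outer increment gives the cell indicator.\<close>

definition mesh_kern :: "real \<Rightarrow> (real \<Rightarrow> real) \<Rightarrow> (real \<Rightarrow> real) \<Rightarrow> nat \<Rightarrow> (nat \<Rightarrow> real) \<Rightarrow> real \<times> real \<Rightarrow> real" where
  "mesh_kern t \<psi>1 \<psi>2 n \<tau> p = (\<Sum>k<n. mesh_a t \<psi>1 \<psi>2 \<tau> k (fst p) * indicator {\<tau> k<..\<tau> (Suc k)} (snd p))"

lemma mesh_kern_eq: "mesh_kern t \<psi>1 \<psi>2 n \<tau> p = pstep n \<tau> (\<lambda>k. mesh_a t \<psi>1 \<psi>2 \<tau> k (fst p)) (snd p)"
  by (simp add: mesh_kern_def pstep_def)

lemma mesh_a_l2:
  assumes "continuous_on {t..T} \<psi>1"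
  shows "l2 (mu t T) (mesh_a t \<psi>1 \<psi>2 \<tau> k)"
  unfolding mesh_a_def[abs_def] by (intro l2_add l2_scale l2_cutoff assms)

lemma indicator_l2: "l2 (mu t T) (indicator {a<..b})"
  using l2_cutoff[of t T "\<lambda>_. 1" a b] by simp

lemma mesh_kern_l2:
  assumes c: "continuous_on {t..T} \<psi>1"
  shows "l2 (mu2 t T) (mesh_kern t \<psi>1 \<psi>2 n \<tau>)"
  unfolding mesh_kern_def[abs_def]
proof (intro l2_sum)
  fix k
  have "has_bochner_integral (mu2 t T) (\<lambda>p. (mesh_a t \<psi>1 \<psi>2 \<tau> k (fst p))\<^sup>2 * (indicator {\<tau> k<..\<tau> (Suc k)} (snd p))\<^sup>2)
    ((\<integral>x. (mesh_a t \<psi>1 \<psi>2 \<tau> k x)\<^sup>2 \<partial>mu t T) * (\<integral>x. (indicator {\<tau> k<..\<tau> (Suc k)} x)\<^sup>2 \<partial>mu t T))"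
    by (intro has_bochner_integral_product[where a="\<lambda>x. (mesh_a t \<psi>1 \<psi>2 \<tau> k x)\<^sup>2" and b="\<lambda>x. (indicator {\<tau> k<..\<tau> (Suc k)} x)\<^sup>2"]
        finite_measure_mu l2_square mesh_a_l2[OF c] indicator_l2)
  moreover have "(\<lambda>p. mesh_a t \<psi>1 \<psi>2 \<tau> k (fst p) * indicator {\<tau> k<..\<tau> (Suc k)} (snd p)) \<in> borel_measurable (mu2 t T)"
    by (intro borel_measurable_times measurable_compose[OF measurable_fst] measurable_compose[OF measurable_snd]
        indicator_measurable_mu) (rule l2_measurable[OF mesh_a_l2[OF c]])
  ultimately show "l2 (mu2 t T) (\<lambda>p. mesh_a t \<psi>1 \<psi>2 \<tau> k (fst p) * indicator {\<tau> k<..\<tau> (Suc k)} (snd p))"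
    by (auto simp: l2_def power_mult_distrib has_bochner_integral_iff)
qed

lemma integral_indicator_mu:
  assumes "t \<le> u" "u \<le> v" "v \<le> T"
  shows "(\<integral>x. indicator {u<..v} x \<partial>mu t T) = v - u"
  using integral_mu_cutoff[of t T "\<lambda>_. 1" u v] assms by simp

text \<open>On diagonal cells the mesh kernel need not be near its limit. Their total area is the
  sum of squared cell lengths, at most the mesh times \<open>T - t\<close>.\<close>

lemma diagonal_blocks_integral_le:
  assumes p: "is_partition t T n \<tau>" and d: "\<And>k. k < n \<Longrightarrow> \<tau> (Suc k) - \<tau> k \<le> \<delta>"
  defines "V \<equiv> (\<lambda>p. \<Sum>k<n. indicator {\<tau> k<..\<tau> (Suc k)} (fst p) * indicator {\<tau> k<..\<tau> (Suc k)} (snd p))"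
  shows "integrable (mu2 t T) V" and "(\<integral>p. V p \<partial>mu2 t T) \<le> \<delta> * (T - t)"
proof -
  interpret mu: finite_measure "mu t T" by (rule finite_measure_mu)
  have I: "(\<integral>x. indicator {\<tau> k<..\<tau> (Suc k)} x \<partial>mu t T) = \<tau> (Suc k) - \<tau> k" if "k < n" for k
    using partition_mem[OF p, of k] partition_mem[OF p, of "Suc k"] that p
    by (intro integral_indicator_mu) (auto simp: is_partition_def less_imp_le)
  have h: "has_bochner_integral (mu2 t T) V (\<Sum>k<n. (\<integral>x. indicator {\<tau> k<..\<tau> (Suc k)} x \<partial>mu t T) * (\<integral>x. indicator {\<tau> k<..\<tau> (Suc k)} x \<partial>mu t T))"
    unfolding V_def
    by (intro has_bochner_integral_sum has_bochner_integral_product finite_measure_mu mu.l2_integrable indicator_l2)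
  show "integrable (mu2 t T) V" using h by (rule integrable.intros)
  have "(\<integral>p. V p \<partial>mu2 t T) = (\<Sum>k<n. (\<tau> (Suc k) - \<tau> k) * (\<tau> (Suc k) - \<tau> k))"
    using has_bochner_integral_integral_eq[OF h] I by simp
  also have "\<dots> \<le> (\<Sum>k<n. \<delta> * (\<tau> (Suc k) - \<tau> k))"
    using d p by (intro sum_mono mult_right_mono) (auto simp: is_partition_def less_imp_le)
  also have "\<dots> = \<delta> * (T - t)"
    using p by (simp add: sum_distrib_left[symmetric] sum_lessThan_telescope is_partition_def)
  finally show "(\<integral>p. V p \<partial>mu2 t T) \<le> \<delta> * (T - t)" .
qed

text \<open>For inner times before the cell of the outer time the kernels differ by the oscillation
  of \<open>\<psi>2\<close>, after it both vanish, and within it a crude bound suffices because the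
  diagonal cells have small area.\<close>

lemma mesh_kern_limit:
  assumes c: "continuous_on {t..T} \<psi>1" "continuous_on {t..T} \<psi>2" and t: "t \<le> T" and e: "e > 0"
  shows "\<exists>\<delta>>0. \<forall>n \<tau>. is_partition t T n \<tau> \<and> (\<forall>k<n. \<tau> (Suc k) - \<tau> k < \<delta>) \<longrightarrow>
      (\<integral>p. (mesh_kern t \<psi>1 \<psi>2 n \<tau> p - kern t \<psi>1 \<psi>2 p)\<^sup>2 \<partial>mu2 t T) < e"
proof -
  interpret mu: finite_measure "mu t T" by (rule finite_measure_mu)
  interpret mu2: finite_measure "mu2 t T" by (rule finite_measure_mu2)
  obtain B1 where B1: "B1 \<ge> 0" "\<And>x. x \<in> {t..T} \<Longrightarrow> \<bar>\<psi>1 x\<bar> \<le> B1"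
    using continuous_bounded_interval[OF c(1)] by blast
  obtain B2 where B2: "B2 \<ge> 0" "\<And>x. x \<in> {t..T} \<Longrightarrow> \<bar>\<psi>2 x\<bar> \<le> B2"
    using continuous_bounded_interval[OF c(2)] by blast
  define B where "B = B1 + B2 + 1"
  have B: "B \<ge> 1" "\<And>x. x \<in> {t..T} \<Longrightarrow> \<bar>\<psi>1 x\<bar> \<le> B" "\<And>x. x \<in> {t..T} \<Longrightarrow> \<bar>\<psi>2 x\<bar> \<le> B"
    using B1(1) B2(1) order_trans[OF B1(2), of _ B] order_trans[OF B2(2), of _ B] by (auto simp: B_def)
  define m where "m = measure (mu2 t T) (space (mu2 t T))"
  have m0: "0 \<le> m" by (simp add: m_def)
  \<comment> \<open>Makes the off-diagonal error \<open>(B * r)^2\<close>, times the mass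
    \<open>m\<close>, less than \<open>e / 2\<close>.\<close>
  define r where "r = sqrt (e / (2 * (m + 1))) / B"
  have r: "r > 0" using e m0 B by (simp add: r_def)
  have Br: "(B * r)\<^sup>2 * m < e / 2"
  proof -
    have "(B * r)\<^sup>2 = e / (2 * (m + 1))" using B e m0 by (simp add: r_def)
    then have "(B * r)\<^sup>2 * m = (e / 2) * (m / (m + 1))" by (simp add: field_simps)
    also have "\<dots> < (e / 2) * 1" using e m0 by (intro mult_strict_left_mono) auto
    finally show ?thesis by simp
  qed
  obtain \<delta>1 where \<delta>1: "\<delta>1 > 0" "\<And>x y. x \<in> {t..T} \<Longrightarrow> y \<in> {t..T} \<Longrightarrow> \<bar>x - y\<bar> < \<delta>1 \<Longrightarrow> \<bar>\<psi>2 x - \<psi>2 y\<bar> < r"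
    using uniform_modulus[OF c(2) r] by blast
  \<comment> \<open>\<open>4 * B ^ 4\<close> is the square of the crude bound \<open>2 * B^2\<close>
    on a diagonal cell; the added 1 makes \<open>q\<close> positive.\<close>
  define q where "q = 4 * B ^ 4 * (T - t) + 1"
  have q: "q > 0" using t B by (auto simp: q_def intro!: add_nonneg_pos)
  define \<delta> where "\<delta> = min \<delta>1 (e / (2 * q))"
  have \<delta>: "\<delta> > 0" using \<delta>1 e q by (simp add: \<delta>_def)
  have "(\<integral>p. (mesh_kern t \<psi>1 \<psi>2 n \<tau> p - kern t \<psi>1 \<psi>2 p)\<^sup>2 \<partial>mu2 t T) < e"
    if p: "is_partition t T n \<tau>" and f: "\<forall>k<n. \<tau> (Suc k) - \<tau> k < \<delta>" for n \<tau>
  proof -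
    define V where "V = (\<lambda>p. \<Sum>k<n. indicator {\<tau> k<..\<tau> (Suc k)} (fst p) * (indicator {\<tau> k<..\<tau> (Suc k)} (snd p) :: real))"
    have V: "integrable (mu2 t T) V" "(\<integral>p. V p \<partial>mu2 t T) \<le> \<delta> * (T - t)"
      unfolding V_def using diagonal_blocks_integral_le[OF p, of \<delta>] f by (auto simp: less_imp_le)
    have V0: "0 \<le> V z" for z unfolding V_def by (intro sum_nonneg) auto
    have ptw: "(mesh_kern t \<psi>1 \<psi>2 n \<tau> z - kern t \<psi>1 \<psi>2 z)\<^sup>2 \<le> (B * r)\<^sup>2 + (4 * B ^ 4) * V z" if z: "z \<in> space (mu2 t T)" for z
    proof -
      obtain x y where xy: "z = (x, y)" "x \<in> {t..T}" "y \<in> {t..T}" using z unfolding space_mu2 by auto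
      have pos: "0 \<le> (B * r)\<^sup>2 + (4 * B ^ 4) * V z" using V0 by (intro add_nonneg_nonneg mult_nonneg_nonneg) auto
      show ?thesis
      proof (cases "y = t")
        case True
        \<comment> \<open>The point \<open>t\<close> belongs to no left-open cell.\<close>
        then have "mesh_kern t \<psi>1 \<psi>2 n \<tau> z = 0" "kern t \<psi>1 \<psi>2 z = 0"
          by (auto simp: mesh_kern_eq pstep_outside[OF p] xy kern_def)
        then show ?thesis using pos by simp
      next
        case False
        then obtain k where k: "k < n" "\<tau> k < y" "y \<le> \<tau> (Suc k)" using partition_cover[OF p, of y] xy by auto
        have mem: "\<tau> k \<in> {t..T}" "\<tau> (Suc k) \<in> {t..T}" using partition_mem[OF p, of k] partition_mem[OF p, of "Suc k"] k by auto
        have mk: "mesh_kern t \<psi>1 \<psi>2 n \<tau> z = mesh_a t \<psi>1 \<psi>2 \<tau> k x"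
          using pstep_eq[OF p k] by (simp add: mesh_kern_eq xy)
        show ?thesis
        proof (cases "\<tau> k < x \<and> x \<le> \<tau> (Suc k)")
          case True
          have "V z = pstep n \<tau> (\<lambda>k. indicator {\<tau> k<..\<tau> (Suc k)} x) y" by (simp add: V_def pstep_def xy)
          also have "\<dots> = 1" using True by (simp add: pstep_eq[OF p k])
          finally have Vz: "V z = 1" .
          have "x > t" using True mem by auto
          then have a: "mesh_a t \<psi>1 \<psi>2 \<tau> k x = \<psi>2 (\<tau> (Suc k)) / 2 * \<psi>1 x" using True by (simp add: mesh_a_def)
          have "\<bar>\<psi>2 (\<tau> (Suc k)) / 2 * \<psi>1 x\<bar> \<le> B * B"
            unfolding abs_mult using B(2)[OF xy(2)] B(3)[OF mem(2)] by (intro mult_mono) auto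
          moreover have "\<bar>kern t \<psi>1 \<psi>2 z\<bar> \<le> B * B"
          proof -
            have "\<bar>\<psi>1 x\<bar> * \<bar>\<psi>2 y\<bar> \<le> B * B" using B(2)[OF xy(2)] B(3)[OF xy(3)] by (intro mult_mono) auto
            then show ?thesis using B(1) by (auto simp: kern_def xy abs_mult indicator_def)
          qed
          ultimately have "\<bar>mesh_kern t \<psi>1 \<psi>2 n \<tau> z - kern t \<psi>1 \<psi>2 z\<bar> \<le> 2 * (B * B)" unfolding mk a by linarith
          from power_mono[OF this, of 2] have "(mesh_kern t \<psi>1 \<psi>2 n \<tau> z - kern t \<psi>1 \<psi>2 z)\<^sup>2 \<le> 4 * B ^ 4"
            by (simp add: power_mult_distrib power2_eq_square power4_eq_xxxx mult_ac)
          then show ?thesis using Vz by simp (smt (verit) zero_le_power2)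
        next
          case False
          have "\<bar>mesh_a t \<psi>1 \<psi>2 \<tau> k x - kern t \<psi>1 \<psi>2 z\<bar> \<le> B * r"
          proof (cases "t < x \<and> x \<le> \<tau> k")
            case True
            have "\<bar>\<tau> k - y\<bar> < \<delta>1" "\<bar>\<tau> (Suc k) - y\<bar> < \<delta>1" using f k unfolding \<delta>_def by fastforce+
            then have "\<bar>\<psi>2 (\<tau> k) - \<psi>2 y\<bar> < r" "\<bar>\<psi>2 (\<tau> (Suc k)) - \<psi>2 y\<bar> < r"
              using \<delta>1(2) mem xy by auto
            then have d: "\<bar>(\<psi>2 (\<tau> k) + \<psi>2 (\<tau> (Suc k))) / 2 - \<psi>2 y\<bar> \<le> r"
              unfolding abs_less_iff abs_le_iff by (simp add: field_simps)
            have "mesh_a t \<psi>1 \<psi>2 \<tau> k x - kern t \<psi>1 \<psi>2 z = \<psi>1 x * ((\<psi>2 (\<tau> k) + \<psi>2 (\<tau> (Suc k))) / 2 - \<psi>2 y)"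
              using True k by (simp add: mesh_a_def kern_def xy field_simps)
            then show ?thesis
              unfolding abs_mult using d B(2)[OF xy(2)] B(1) by (simp add: abs_mult mult_mono)
          next
            case F: False
            \<comment> \<open>Here \<open>x\<close> is \<open>t\<close> or lies beyond the cell of
              \<open>y\<close>.\<close>
            then have "mesh_a t \<psi>1 \<psi>2 \<tau> k x = 0" "kern t \<psi>1 \<psi>2 z = 0"
              using False k mem xy by (auto simp: mesh_a_def kern_def indicator_def)
            then show ?thesis using B(1) r by simp
          qed
          from power_mono[OF this, of 2] have "(mesh_kern t \<psi>1 \<psi>2 n \<tau> z - kern t \<psi>1 \<psi>2 z)\<^sup>2 \<le> (B * r)\<^sup>2"
            unfolding mk by simp
          moreover have "0 \<le> (4 * B ^ 4) * V z" using V0 by (intro mult_nonneg_nonneg) auto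
          ultimately show ?thesis by linarith
        qed
      qed
    qed
    have "(\<integral>p. (mesh_kern t \<psi>1 \<psi>2 n \<tau> p - kern t \<psi>1 \<psi>2 p)\<^sup>2 \<partial>mu2 t T) \<le> (\<integral>z. (B * r)\<^sup>2 + (4 * B ^ 4) * V z \<partial>mu2 t T)"
    proof (rule integral_mono_AE)
      show "integrable (mu2 t T) (\<lambda>p. (mesh_kern t \<psi>1 \<psi>2 n \<tau> p - kern t \<psi>1 \<psi>2 p)\<^sup>2)"
        by (intro l2_square l2_diff mesh_kern_l2 kern_l2 c)
    qed (use V ptw in auto)
    also have "\<dots> = (B * r)\<^sup>2 * m + (4 * B ^ 4) * (\<integral>z. V z \<partial>mu2 t T)"
      using V by (simp add: m_def mult.commute)
    also have "\<dots> \<le> (B * r)\<^sup>2 * m + (4 * B ^ 4) * (\<delta> * (T - t))"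
      using V by (intro add_left_mono mult_left_mono) auto
    finally have 1: "(\<integral>p. (mesh_kern t \<psi>1 \<psi>2 n \<tau> p - kern t \<psi>1 \<psi>2 p)\<^sup>2 \<partial>mu2 t T)
      \<le> (B * r)\<^sup>2 * m + (4 * B ^ 4) * (\<delta> * (T - t))" .
    have "(4 * B ^ 4) * (\<delta> * (T - t)) = (4 * B ^ 4 * (T - t)) * \<delta>" by (simp only: mult_ac)
    also have "\<dots> \<le> q * \<delta>"
      using \<delta> unfolding q_def by (intro mult_right_mono) auto
    also have "\<dots> \<le> q * (e / (2 * q))" using q by (intro mult_left_mono) (auto simp: \<delta>_def)
    also have "\<dots> = e / 2" using q by simp
    finally show ?thesis using Br 1 by linarith
  qed
  then show ?thesis using \<delta> by blast
qed

text \<open>On a diagonal cell the term of the left endpoint is cut off, so half of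
  \<open>\<psi>1 x * \<psi>2 (\<tau> (Suc k))\<close> remains. This is the origin of the factor 1/2
  in the Ito-Stratonovich correction. What is left is a step approximation of
  \<open>\<psi>2\<close>, tested against \<open>\<psi>1 / 2\<close>.\<close>

lemma mesh_trace_limit:
  assumes c: "continuous_on {t..T} \<psi>1" "continuous_on {t..T} \<psi>2" and t: "t \<le> T" and e: "e > 0"
  shows "\<exists>\<delta>>0. \<forall>n \<tau>. is_partition t T n \<tau> \<and> (\<forall>k<n. \<tau> (Suc k) - \<tau> k < \<delta>) \<longrightarrow>
      ((\<Sum>k<n. \<integral>x. mesh_a t \<psi>1 \<psi>2 \<tau> k x * indicator {\<tau> k<..\<tau> (Suc k)} x \<partial>mu t T) - integral {t..T} (\<lambda>x. \<psi>1 x * \<psi>2 x) / 2)\<^sup>2 < e"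
proof -
  interpret mu: finite_measure "mu t T" by (rule finite_measure_mu)
  define A where "A = (\<integral>x. (\<psi>1 x / 2)\<^sup>2 \<partial>mu t T)"
  have A0: "0 \<le> A" by (simp add: A_def)
  \<comment> \<open>Cauchy-Schwarz multiplies the step error by \<open>A\<close>; the added 1 covers
    \<open>A = 0\<close>.\<close>
  define r where "r = e / (A + 1)"
  have r: "r > 0" using e A0 by (simp add: r_def)
  have lp: "l2 (mu t T) (\<lambda>x. \<psi>1 x / 2)" by (rule l2_continuous) (intro continuous_intros c, simp)
  obtain \<delta> where \<delta>: "\<delta> > 0" "\<And>n \<tau>. is_partition t T n \<tau> \<Longrightarrow> \<forall>k<n. \<tau> (Suc k) - \<tau> k < \<delta> \<Longrightarrow>
      (\<integral>x. (pstep n \<tau> (\<lambda>k. \<psi>2 (\<tau> (Suc k))) x - \<psi>2 x * indicator {t<..T} x)\<^sup>2 \<partial>mu t T) < r"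
    using pstep_approx[OF t order_refl c(2), of "\<lambda>n \<tau> k. \<psi>2 (\<tau> (Suc k))" r] r by blast
  have "((\<Sum>k<n. \<integral>x. mesh_a t \<psi>1 \<psi>2 \<tau> k x * indicator {\<tau> k<..\<tau> (Suc k)} x \<partial>mu t T) - integral {t..T} (\<lambda>x. \<psi>1 x * \<psi>2 x) / 2)\<^sup>2 < e"
    if p: "is_partition t T n \<tau>" and f: "\<forall>k<n. \<tau> (Suc k) - \<tau> k < \<delta>" for n \<tau>
  proof -
    let ?s = "pstep n \<tau> (\<lambda>k. \<psi>2 (\<tau> (Suc k)))" and ?h = "\<lambda>x. \<psi>2 x * indicator {t<..T} x"
    have ls: "l2 (mu t T) ?s"
      unfolding pstep_def[abs_def] by (intro l2_sum l2_scale indicator_l2)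
    have lh: "l2 (mu t T) ?h" by (rule l2_cutoff[OF c(2)])
    have "(\<Sum>k<n. \<integral>x. mesh_a t \<psi>1 \<psi>2 \<tau> k x * indicator {\<tau> k<..\<tau> (Suc k)} x \<partial>mu t T)
       = (\<integral>x. (\<Sum>k<n. mesh_a t \<psi>1 \<psi>2 \<tau> k x * indicator {\<tau> k<..\<tau> (Suc k)} x) \<partial>mu t T)"
      by (rule Bochner_Integration.integral_sum[symmetric]) (intro l2_mult mesh_a_l2 indicator_l2 c)
    moreover have "(\<integral>x. (\<Sum>k<n. mesh_a t \<psi>1 \<psi>2 \<tau> k x * indicator {\<tau> k<..\<tau> (Suc k)} x) \<partial>mu t T)
       = (\<integral>x. (\<psi>1 x / 2) * ?s x \<partial>mu t T)"
    proof (rule Bochner_Integration.integral_cong[OF refl])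
      fix x
      show "(\<Sum>k<n. mesh_a t \<psi>1 \<psi>2 \<tau> k x * indicator {\<tau> k<..\<tau> (Suc k)} x) = (\<psi>1 x / 2) * ?s x"
        unfolding pstep_def sum_distrib_left
      proof (intro sum.cong refl)
        fix k assume "k \<in> {..<n}"
        then have "t \<le> \<tau> k" using partition_mem[OF p, of k] by auto
        then show "mesh_a t \<psi>1 \<psi>2 \<tau> k x * indicator {\<tau> k<..\<tau> (Suc k)} x = \<psi>1 x / 2 * (\<psi>2 (\<tau> (Suc k)) * indicator {\<tau> k<..\<tau> (Suc k)} x)"
          by (auto simp: mesh_a_def indicator_def)
      qed
    qed
    moreover have "(\<integral>x. (\<psi>1 x / 2) * ?s x \<partial>mu t T) - integral {t..T} (\<lambda>x. \<psi>1 x * \<psi>2 x) / 2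
       = (\<integral>x. (\<psi>1 x / 2) * (?s x - ?h x) \<partial>mu t T)"
    proof -
      have "(\<integral>x. (\<psi>1 x / 2) * ?h x \<partial>mu t T) = (\<integral>x. (\<psi>1 x * \<psi>2 x) * indicator {t<..T} x / 2 \<partial>mu t T)"
        by (simp add: mult_ac)
      also have "\<dots> = integral {t..T} (\<lambda>x. \<psi>1 x * \<psi>2 x) / 2"
        using integral_mu_cutoff[of t T "\<lambda>x. \<psi>1 x * \<psi>2 x" t T] t by (simp add: continuous_on_mult c)
      finally show ?thesis
        using l2_mult[OF lp ls] l2_mult[OF lp lh] unfolding right_diff_distrib
        by (subst Bochner_Integration.integral_diff) auto
    qed
    ultimately have "(\<Sum>k<n. \<integral>x. mesh_a t \<psi>1 \<psi>2 \<tau> k x * indicator {\<tau> k<..\<tau> (Suc k)} x \<partial>mu t T) - integral {t..T} (\<lambda>x. \<psi>1 x * \<psi>2 x) / 2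
       = (\<integral>x. (\<psi>1 x / 2) * (?s x - ?h x) \<partial>mu t T)" by (simp only:)
    then have "((\<Sum>k<n. \<integral>x. mesh_a t \<psi>1 \<psi>2 \<tau> k x * indicator {\<tau> k<..\<tau> (Suc k)} x \<partial>mu t T) - integral {t..T} (\<lambda>x. \<psi>1 x * \<psi>2 x) / 2)\<^sup>2
       \<le> A * (\<integral>x. (?s x - ?h x)\<^sup>2 \<partial>mu t T)"
      using integral_cauchy_schwarz'[OF lp l2_diff[OF ls lh]] by (simp only: A_def)
    also have "\<dots> \<le> A * r" using \<delta>(2)[OF p f] A0 by (intro mult_left_mono) auto
    also have "\<dots> < (A + 1) * r" using r by simp
    also have "\<dots> = e" using A0 by (simp add: r_def)
    finally show ?thesis .
  qed
  then show ?thesis using \<delta>(1) by blast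
qed

section \<open>The expansion\<close>

text \<open>Only indices common to both ranges contribute, so independent \<open>p1\<close> and
  \<open>p2\<close> reduce to one limit along their minimum.\<close>

lemma fourier_kern_trace:
  fixes C :: "nat \<Rightarrow> nat \<Rightarrow> real"
  shows "(\<Sum>j1\<le>p1. \<Sum>j2\<le>p2. C j2 j1 * (if j1 = j2 then 1 else 0)) = (\<Sum>j\<le>min p1 p2. C j j)"
proof -
  have "(\<Sum>j1\<le>p1. \<Sum>j2\<le>p2. C j2 j1 * (if j1 = j2 then 1 else 0)) = (\<Sum>j1\<le>p1. if j1 \<le> p2 then C j1 j1 else 0)"
    by (intro sum.cong refl) (simp add: if_distrib[of "\<lambda>x. _ * x"] sum.delta cong: if_cong)
  also have "\<dots> = (\<Sum>j\<in>{..p1} \<inter> {..p2}. C j j)"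
    by (subst sum.inter_restrict) auto
  also have "{..p1} \<inter> {..p2} = {..min p1 p2}" by auto
  finally show ?thesis .
qed

text \<open>Both bases enter only through \<open>onb\<close>, so the argument is carried out once
  for an abstract \<open>\<phi>\<close>.\<close>

locale strat_setting = prob_space M for M :: "'a measure" +
  fixes F :: "real \<Rightarrow> 'a set set" and m :: nat and f :: "nat \<Rightarrow> real \<Rightarrow> 'a \<Rightarrow> real"
    and t T :: real and \<phi> :: "nat \<Rightarrow> real \<Rightarrow> real" and \<psi>1 \<psi>2 :: "real \<Rightarrow> real" and i1 i2 :: nat
  assumes fi: "rc_filtration M F" and W: "wiener_process_m M F m f"
    and t0: "0 \<le> t" and tT: "t \<le> T" and o: "onb t T \<phi>"
    and C1: "C1_on {t..T} \<psi>1" "C1_on {t..T} \<psi>2"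
    and i: "i1 \<le> m" "i2 \<le> m"
begin

lemma psi_continuous: "continuous_on {t..T} \<psi>1" "continuous_on {t..T} \<psi>2"
  using C1 unfolding C1_on_def by (metis DERIV_continuous_on)+

lemma phi_continuous: "continuous_on {t..T} (\<phi> j)"
  using o by (auto simp: onb_def)

definition C :: "nat \<Rightarrow> nat \<Rightarrow> real" where "C = coefC \<psi>1 \<psi>2 \<phi> t T"

definition S :: "(real \<Rightarrow> 'a \<Rightarrow> real) \<Rightarrow> nat \<Rightarrow> (nat \<Rightarrow> real) \<Rightarrow> 'a \<Rightarrow> real" where
  "S \<eta> n \<tau> \<omega> = (\<Sum>k<n. (\<psi>2 (\<tau> k) * \<eta> (\<tau> k) \<omega> + \<psi>2 (\<tau> (Suc k)) * \<eta> (\<tau> (Suc k)) \<omega>) / 2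
     * (wproc f i2 (\<tau> (Suc k)) \<omega> - wproc f i2 (\<tau> k) \<omega>))"

definition Jp :: "(nat \<Rightarrow> nat \<Rightarrow> 'a \<Rightarrow> real) \<Rightarrow> nat \<Rightarrow> nat \<Rightarrow> 'a \<Rightarrow> real" where
  "Jp \<zeta> p1 p2 \<omega> = (\<Sum>j1\<le>p1. \<Sum>j2\<le>p2. C j2 j1 * \<zeta> i1 j1 \<omega> * \<zeta> i2 j2 \<omega>)"

text \<open>The difference is one form over a disjoint union of indices: mesh cells and, with a
  minus sign in the first factor, pairs of basis functions. Its kernel and trace are then
  differences, which preserves the cancellation between the two traces.\<close>

lemma outer_estimate:
  assumes eta: "\<And>s. s \<in> {t..T} \<Longrightarrow> wint M (wproc f i1) t T (\<lambda>x. \<psi>1 x * indicator {t<..s} x) (\<eta> s)"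
    and zeta: "\<And>j. wint M (wproc f i1) t T (\<phi> j) (\<zeta> i1 j)" "\<And>j. wint M (wproc f i2) t T (\<phi> j) (\<zeta> i2 j)"
    and p: "is_partition t T n \<tau>"
  shows "l2 M (\<lambda>\<omega>. S \<eta> n \<tau> \<omega> - Jp \<zeta> p1 p2 \<omega>)"
    and "expectation (\<lambda>\<omega>. (S \<eta> n \<tau> \<omega> - Jp \<zeta> p1 p2 \<omega>)\<^sup>2) \<le>
      (2 + (T - t) + (T - t)\<^sup>2) * (\<integral>p. (mesh_kern t \<psi>1 \<psi>2 n \<tau> p - fourier_kern C \<phi> p1 p2 p)\<^sup>2 \<partial>mu2 t T)
      + ((\<Sum>k<n. \<integral>x. mesh_a t \<psi>1 \<psi>2 \<tau> k x * indicator {\<tau> k<..\<tau> (Suc k)} x \<partial>mu t T) - (\<Sum>j\<le>min p1 p2. C j j))\<^sup>2"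
proof -
  let ?J2 = "{..p1} \<times> {..p2}"
  let ?J = "{..<n} <+> ?J2"
  define a where "a = case_sum (mesh_a t \<psi>1 \<psi>2 \<tau>) (\<lambda>j x. - C (snd j) (fst j) * \<phi> (fst j) x)"
  define b where "b = case_sum (\<lambda>k. indicator {\<tau> k<..\<tau> (Suc k)}) (\<lambda>j::nat \<times> nat. \<phi> (snd j))"
  define X where "X = case_sum (\<lambda>k \<omega>. (\<psi>2 (\<tau> k) / 2) * \<eta> (\<tau> k) \<omega> + (\<psi>2 (\<tau> (Suc k)) / 2) * \<eta> (\<tau> (Suc k)) \<omega>)
    (\<lambda>j \<omega>. - C (snd j) (fst j) * \<zeta> i1 (fst j) \<omega>)"
  define Y where "Y = case_sum (\<lambda>k \<omega>. wproc f i2 (\<tau> (Suc k)) \<omega> - wproc f i2 (\<tau> k) \<omega>) (\<lambda>j::nat \<times> nat. \<zeta> i2 (snd j))"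
  have pa: "wint M (wproc f i1) t T (a j) (X j)" if "j \<in> ?J" for j
    using that
  proof (rule PlusE)
    fix k assume k: "k \<in> {..<n}" "j = Inl k"
    then have "\<tau> k \<in> {t..T}" "\<tau> (Suc k) \<in> {t..T}" using partition_mem[OF p, of k] partition_mem[OF p, of "Suc k"] by auto
    then show ?thesis
      unfolding k a_def X_def mesh_a_def[abs_def] sum.case by (intro wint_lincomb wint_scale eta)
  next
    fix l assume l: "l \<in> ?J2" "j = Inr l"
    show ?thesis unfolding l a_def X_def sum.case by (intro wint_scale zeta)
  qed
  have pb: "wint M (wproc f i2) t T (b j) (Y j)" if "j \<in> ?J" for j
    using that
  proof (rule PlusE)
    fix k assume k: "k \<in> {..<n}" "j = Inl k"
    then show ?thesis
      unfolding k b_def Y_def sum.case by (intro wint_increment[OF p]) (auto intro: spair_wproc_l2[OF fi W t0 i(2)])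
  next
    fix l assume l: "l \<in> ?J2" "j = Inr l"
    show ?thesis unfolding l b_def Y_def sum.case by (intro zeta)
  qed
  note q = quad_wint[where J="?J" and a=a and b=b and X=X and Y=Y, OF fi W t0 tT i pa pb]
  have XY: "(\<lambda>\<omega>. \<Sum>j\<in>?J. X j \<omega> * Y j \<omega>) = (\<lambda>\<omega>. S \<eta> n \<tau> \<omega> - Jp \<zeta> p1 p2 \<omega>)"
    by (simp add: sum.Plus X_def Y_def S_def Jp_def sum.cartesian_product case_prod_unfold sum_negf add_divide_distrib mult_ac)
  have ab: "(\<Sum>j\<in>?J. a j (fst z) * b j (snd z)) = mesh_kern t \<psi>1 \<psi>2 n \<tau> z - fourier_kern C \<phi> p1 p2 z" for z
    by (simp add: sum.Plus a_def b_def mesh_kern_def fourier_kern_def sum.cartesian_product case_prod_unfold sum_negf mult_ac)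
  have tr: "(\<Sum>j\<in>?J. \<integral>x. a j x * b j x \<partial>mu t T) =
     (\<Sum>k<n. \<integral>x. mesh_a t \<psi>1 \<psi>2 \<tau> k x * indicator {\<tau> k<..\<tau> (Suc k)} x \<partial>mu t T) - (\<Sum>j\<le>min p1 p2. C j j)"
  proof -
    have "(\<Sum>j\<in>?J2. \<integral>x. - C (snd j) (fst j) * \<phi> (fst j) x * \<phi> (snd j) x \<partial>mu t T)
      = (\<Sum>j\<in>?J2. - (C (snd j) (fst j) * (if fst j = snd j then 1 else 0)))"
    proof (intro sum.cong refl)
      fix j :: "nat \<times> nat"
      have "(\<integral>x. - C (snd j) (fst j) * \<phi> (fst j) x * \<phi> (snd j) x \<partial>mu t T)
         = - C (snd j) (fst j) * (\<integral>x. \<phi> (fst j) x * \<phi> (snd j) x \<partial>mu t T)" by (simp add: mult.assoc)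
      then show "(\<integral>x. - C (snd j) (fst j) * \<phi> (fst j) x * \<phi> (snd j) x \<partial>mu t T)
         = - (C (snd j) (fst j) * (if fst j = snd j then 1 else 0))"
        using o by (simp add: onb_def)
    qed
    also have "\<dots> = - (\<Sum>j1\<le>p1. \<Sum>j2\<le>p2. C j2 j1 * (if j1 = j2 then 1 else 0))"
      by (simp add: sum_negf sum.cartesian_product case_prod_unfold)
    also note fourier_kern_trace
    finally show ?thesis by (simp add: sum.Plus a_def b_def)
  qed
  show "l2 M (\<lambda>\<omega>. S \<eta> n \<tau> \<omega> - Jp \<zeta> p1 p2 \<omega>)" using q(1) unfolding XY .
  let ?tr = "(\<Sum>k<n. \<integral>x. mesh_a t \<psi>1 \<psi>2 \<tau> k x * indicator {\<tau> k<..\<tau> (Suc k)} x \<partial>mu t T) - (\<Sum>j\<le>min p1 p2. C j j)"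
  \<comment> \<open>Since \<open>trace_on\<close> is at most 1, one bound serves all index
    pairs.\<close>
  have "trace_on i1 i2 * ?tr\<^sup>2 \<le> ?tr\<^sup>2" by (simp add: trace_on_def)
  moreover have "expectation (\<lambda>\<omega>. (S \<eta> n \<tau> \<omega> - Jp \<zeta> p1 p2 \<omega>)\<^sup>2) \<le>
      (2 + (T - t) + (T - t)\<^sup>2) * (\<integral>p. (mesh_kern t \<psi>1 \<psi>2 n \<tau> p - fourier_kern C \<phi> p1 p2 p)\<^sup>2 \<partial>mu2 t T)
      + trace_on i1 i2 * ?tr\<^sup>2"
    using q(2) unfolding ab tr fun_cong[OF XY] .
  ultimately show "expectation (\<lambda>\<omega>. (S \<eta> n \<tau> \<omega> - Jp \<zeta> p1 p2 \<omega>)\<^sup>2) \<le>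
      (2 + (T - t) + (T - t)\<^sup>2) * (\<integral>p. (mesh_kern t \<psi>1 \<psi>2 n \<tau> p - fourier_kern C \<phi> p1 p2 p)\<^sup>2 \<partial>mu2 t T) + ?tr\<^sup>2"
    by linarith
qed

lemma Jp_l2:
  assumes zeta: "\<And>j. wint M (wproc f i1) t T (\<phi> j) (\<zeta> i1 j)" "\<And>j. wint M (wproc f i2) t T (\<phi> j) (\<zeta> i2 j)"
  shows "l2 M (Jp \<zeta> p1 p2)"
proof -
  have "l2 M (\<lambda>\<omega>. \<Sum>j\<in>{..p1} \<times> {..p2}. (C (snd j) (fst j) * \<zeta> i1 (fst j) \<omega>) * \<zeta> i2 (snd j) \<omega>)"
    by (rule quad_wint(1)[where a="\<lambda>j x. C (snd j) (fst j) * \<phi> (fst j) x" and b="\<lambda>j. \<phi> (snd j)", OF fi W t0 tT i])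
       (intro wint_scale zeta)+
  then show ?thesis unfolding Jp_def[abs_def] by (simp add: sum.cartesian_product case_prod_unfold)
qed

text \<open>The common references are \<open>kern\<close> for the kernels and half the integral of
  \<open>\<psi>1 * \<psi>2\<close> for the traces. The thresholds for the mesh and for
  \<open>p1\<close>, \<open>p2\<close> do not depend on each other.\<close>

lemma sums_close:
  assumes eta: "\<And>s. s \<in> {t..T} \<Longrightarrow> wint M (wproc f i1) t T (\<lambda>x. \<psi>1 x * indicator {t<..s} x) (\<eta> s)"
    and zeta: "\<And>j. wint M (wproc f i1) t T (\<phi> j) (\<zeta> i1 j)" "\<And>j. wint M (wproc f i2) t T (\<phi> j) (\<zeta> i2 j)"
    and e: "e > 0"
  shows "\<exists>\<delta>>0. \<exists>P. \<forall>n \<tau> p1 p2. is_partition t T n \<tau> \<and> (\<forall>k<n. \<tau> (Suc k) - \<tau> k < \<delta>) \<and> P \<le> p1 \<and> P \<le> p2 \<longrightarrow>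
     l2 M (S \<eta> n \<tau>) \<and> expectation (\<lambda>\<omega>. (S \<eta> n \<tau> \<omega> - Jp \<zeta> p1 p2 \<omega>)\<^sup>2) < e"
proof -
  define K where "K = 2 + (T - t) + (T - t)\<^sup>2"
  have K: "K > 0" using tT by (simp add: K_def add_pos_nonneg)
  \<comment> \<open>Two kernel errors \<open>d\<close> make \<open>4 * d\<close> and contribute
    \<open>K * (4 * d) = e / 2\<close>; two trace errors \<open>e / 8\<close>, doubled, contribute
    less than \<open>e / 2\<close>.\<close>
  define d where "d = e / (8 * K)"
  have d: "d > 0" using e K by (simp add: d_def)
  have e8: "e / 8 > 0" using e by simp
  let ?I = "integral {t..T} (\<lambda>x. \<psi>1 x * \<psi>2 x) / 2"
  let ?fine = "\<lambda>\<delta> n \<tau>. is_partition t T n \<tau> \<and> (\<forall>k<n. \<tau> (Suc k) - \<tau> k < \<delta>)"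
  let ?tr = "\<lambda>n \<tau>. \<Sum>k<n. \<integral>x. mesh_a t \<psi>1 \<psi>2 \<tau> k x * indicator {\<tau> k<..\<tau> (Suc k)} x \<partial>mu t T"
  obtain \<delta>1 where \<delta>1: "\<delta>1 > 0" "\<And>n \<tau>. ?fine \<delta>1 n \<tau> \<Longrightarrow>
      (\<integral>p. (mesh_kern t \<psi>1 \<psi>2 n \<tau> p - kern t \<psi>1 \<psi>2 p)\<^sup>2 \<partial>mu2 t T) < d"
    using mesh_kern_limit[OF psi_continuous tT d] by blast
  obtain \<delta>2 where \<delta>2: "\<delta>2 > 0" "\<And>n \<tau>. ?fine \<delta>2 n \<tau> \<Longrightarrow> (?tr n \<tau> - ?I)\<^sup>2 < e / 8"
    using mesh_trace_limit[OF psi_continuous tT e8] by blast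
  obtain P1 where P1: "\<And>p1 p2. p1 \<ge> P1 \<Longrightarrow> p2 \<ge> P1 \<Longrightarrow>
      (\<integral>p. (kern t \<psi>1 \<psi>2 p - fourier_kern C \<phi> p1 p2 p)\<^sup>2 \<partial>mu2 t T) < d"
    using fourier_kern_limit[OF psi_continuous o tT d, folded C_def] by blast
  have "(\<lambda>n. (?I - (\<Sum>j\<le>n. C j j))\<^sup>2) \<longlonglongrightarrow> (?I - ?I)\<^sup>2"
    unfolding C_def by (intro tendsto_intros trace_limit[OF o tT C1])
  then have "\<forall>\<^sub>F n in sequentially. (?I - (\<Sum>j\<le>n. C j j))\<^sup>2 < e / 8"
    by (rule order_tendstoD(2)) (use e8 in simp)
  then obtain P2 where P2: "\<And>n. n \<ge> P2 \<Longrightarrow> (?I - (\<Sum>j\<le>n. C j j))\<^sup>2 < e / 8"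
    unfolding eventually_sequentially by blast
  have main: "l2 M (S \<eta> n \<tau>) \<and> expectation (\<lambda>\<omega>. (S \<eta> n \<tau> \<omega> - Jp \<zeta> p1 p2 \<omega>)\<^sup>2) < e"
    if p: "is_partition t T n \<tau>" and f: "\<forall>k<n. \<tau> (Suc k) - \<tau> k < min \<delta>1 \<delta>2" and pp: "max P1 P2 \<le> p1" "max P1 P2 \<le> p2" for n \<tau> p1 p2
  proof
    note E = outer_estimate[where \<eta>=\<eta> and \<zeta>=\<zeta> and ?p1.0=p1 and ?p2.0=p2, OF eta zeta p]
    show "l2 M (S \<eta> n \<tau>)" using l2_add[OF E(1) Jp_l2[where \<zeta>=\<zeta> and ?p1.0=p1 and ?p2.0=p2, OF zeta]] by simp
    have 1: "(\<integral>p. (mesh_kern t \<psi>1 \<psi>2 n \<tau> p - kern t \<psi>1 \<psi>2 p)\<^sup>2 \<partial>mu2 t T) < d" using f p by (intro \<delta>1(2)) auto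
    have 2: "(?tr n \<tau> - ?I)\<^sup>2 < e / 8" using f p by (intro \<delta>2(2)) auto
    have 3: "(\<integral>p. (kern t \<psi>1 \<psi>2 p - fourier_kern C \<phi> p1 p2 p)\<^sup>2 \<partial>mu2 t T) < d" using pp by (intro P1) auto
    have 4: "(?I - (\<Sum>j\<le>min p1 p2. C j j))\<^sup>2 < e / 8" using pp by (intro P2) auto
    have "(\<integral>p. (mesh_kern t \<psi>1 \<psi>2 n \<tau> p - fourier_kern C \<phi> p1 p2 p)\<^sup>2 \<partial>mu2 t T) < 4 * d"
      using integral_square_triangle[OF mesh_kern_l2[OF psi_continuous(1)] kern_l2[OF psi_continuous] fourier_kern_l2[where \<phi>=\<phi>, OF phi_continuous], of \<psi>2 n \<tau> C p1 p2] 1 3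
      by simp
    then have "K * (\<integral>p. (mesh_kern t \<psi>1 \<psi>2 n \<tau> p - fourier_kern C \<phi> p1 p2 p)\<^sup>2 \<partial>mu2 t T) < K * (4 * d)"
      using K by simp
    also have "K * (4 * d) = e / 2" using K by (simp add: d_def)
    finally have A: "K * (\<integral>p. (mesh_kern t \<psi>1 \<psi>2 n \<tau> p - fourier_kern C \<phi> p1 p2 p)\<^sup>2 \<partial>mu2 t T) < e / 2" .
    have "(x - z)\<^sup>2 \<le> 2 * (x - y)\<^sup>2 + 2 * (y - z)\<^sup>2" for x y z :: real
      using zero_le_power2[of "(x - y) - (y - z)"] by (simp add: power2_eq_square algebra_simps)
    from this[of "?tr n \<tau>" "\<Sum>j\<le>min p1 p2. C j j" ?I]
    have "(?tr n \<tau> - (\<Sum>j\<le>min p1 p2. C j j))\<^sup>2 < e / 2" using 2 4 by simp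
    with A E(2) show "expectation (\<lambda>\<omega>. (S \<eta> n \<tau> \<omega> - Jp \<zeta> p1 p2 \<omega>)\<^sup>2) < e"
      unfolding K_def by linarith
  qed
  then show ?thesis using \<delta>1(1) \<delta>2(1)
    by (intro exI[of _ "min \<delta>1 \<delta>2"] conjI exI[of _ "max P1 P2"]) auto
qed

lemma ito_exists:
  assumes "i \<le> m"
  shows "\<exists>z. ito_integral M (wproc f i) (\<phi> j) t T z"
  by (rule ito_integral_wint(1)[OF fi W t0 tT assms phi_continuous])

lemma eta_wint:
  assumes "inner_strat M (wproc f i1) \<psi>1 t T \<eta>" "s \<in> {t..T}"
  shows "wint M (wproc f i1) t T (\<lambda>x. \<psi>1 x * indicator {t<..s} x) (\<eta> s)"
  using assms by (intro strat_integral_wint(2)[OF fi W t0 _ _ i(1) psi_continuous(1)]) (auto simp: inner_strat_def)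

lemma inner_exists: "\<exists>\<eta>. inner_strat M (wproc f i1) \<psi>1 t T \<eta>"
proof -
  have "\<exists>X. strat_integral M (wproc f i1) (\<lambda>u \<omega>. \<psi>1 u) t s X" if "s \<in> {t..T}" for s
    using that by (intro strat_integral_wint(1)[OF fi W t0 _ _ i(1) psi_continuous(1)]) auto
  then have "\<forall>s\<in>{t..T}. \<exists>X. strat_integral M (wproc f i1) (\<lambda>u \<omega>. \<psi>1 u) t s X" by blast
  then show ?thesis unfolding inner_strat_def bchoice_iff .
qed

lemma strat_eq: "strat_integral M (wproc f i2) (\<lambda>s \<omega>. \<psi>2 s * \<eta> s \<omega>) t T J \<longleftrightarrow> ms_limit_mesh M t T (S \<eta>) J"
  unfolding strat_integral_def S_def[abs_def] ..

text \<open>All fine mesh sums lie close to the single partial sum \<open>Jp \<zeta> P P\<close>,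
  hence to each other: the expansion provides the Cauchy property, for any version
  \<open>\<eta>\<close> of the inner integrals.\<close>

lemma outer_exists:
  assumes eta: "inner_strat M (wproc f i1) \<psi>1 t T \<eta>"
  shows "\<exists>J. iter_strat2 M (wproc f i1) (wproc f i2) \<psi>1 \<psi>2 t T \<eta> J"
proof -
  \<comment> \<open>Some versions of the basis integrals, chosen for the comparison only.\<close>
  have "\<forall>i. \<forall>j. \<exists>z. i \<le> m \<longrightarrow> ito_integral M (wproc f i) (\<phi> j) t T z" using ito_exists by blast
  then obtain \<zeta> where z: "\<And>i j. i \<le> m \<Longrightarrow> ito_integral M (wproc f i) (\<phi> j) t T (\<zeta> i j)"
    unfolding choice_iff by blast
  have zeta: "wint M (wproc f i1) t T (\<phi> j) (\<zeta> i1 j)" "wint M (wproc f i2) t T (\<phi> j) (\<zeta> i2 j)" for j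
    using i z by (auto intro!: ito_integral_wint(2)[OF fi W t0 tT _ phi_continuous])
  have "\<exists>J. ms_limit_mesh M t T (S \<eta>) J"
  proof (rule mesh_limit_exists[OF tT])
    fix e :: real assume "e > 0"
    then have "e / 4 > 0" by simp
    from sums_close[where \<eta>=\<eta> and \<zeta>=\<zeta>, OF eta_wint[OF eta] zeta this]
    obtain \<delta> P where \<delta>: "\<delta> > 0" "\<And>n \<tau> p1 p2. is_partition t T n \<tau> \<and> (\<forall>k<n. \<tau> (Suc k) - \<tau> k < \<delta>) \<and> P \<le> p1 \<and> P \<le> p2 \<longrightarrow>
       l2 M (S \<eta> n \<tau>) \<and> expectation (\<lambda>\<omega>. (S \<eta> n \<tau> \<omega> - Jp \<zeta> p1 p2 \<omega>)\<^sup>2) < e / 4"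
      by blast
    show "\<exists>\<delta>>0. \<forall>n \<tau> n' \<tau>'. is_partition t T n \<tau> \<and> (\<forall>k<n. \<tau> (Suc k) - \<tau> k < \<delta>) \<and>
       is_partition t T n' \<tau>' \<and> (\<forall>k<n'. \<tau>' (Suc k) - \<tau>' k < \<delta>) \<longrightarrow>
       l2 M (S \<eta> n \<tau>) \<and> l2 M (S \<eta> n' \<tau>') \<and> expectation (\<lambda>\<omega>. (S \<eta> n \<tau> \<omega> - S \<eta> n' \<tau>' \<omega>)\<^sup>2) < e"
    proof (intro exI[of _ \<delta>] conjI allI impI; (elim conjE)?)
      fix n \<tau> n' \<tau>'
      assume p: "is_partition t T n \<tau>" "\<forall>k<n. \<tau> (Suc k) - \<tau> k < \<delta>"
        and p': "is_partition t T n' \<tau>'" "\<forall>k<n'. \<tau>' (Suc k) - \<tau>' k < \<delta>"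
      have a: "l2 M (S \<eta> n \<tau>)" "expectation (\<lambda>\<omega>. (S \<eta> n \<tau> \<omega> - Jp \<zeta> P P \<omega>)\<^sup>2) < e / 4"
        using \<delta>(2)[of n \<tau> P P] p by auto
      have b: "l2 M (S \<eta> n' \<tau>')" "expectation (\<lambda>\<omega>. (S \<eta> n' \<tau>' \<omega> - Jp \<zeta> P P \<omega>)\<^sup>2) < e / 4"
        using \<delta>(2)[of n' \<tau>' P P] p' by auto
      show "l2 M (S \<eta> n \<tau>)" "l2 M (S \<eta> n' \<tau>')" by (rule a b)+
      have "l2 M (Jp \<zeta> P P)" by (rule Jp_l2[where \<zeta>=\<zeta>, OF zeta])
      from integral_square_triangle[OF a(1) this b(1)]
      show "expectation (\<lambda>\<omega>. (S \<eta> n \<tau> \<omega> - S \<eta> n' \<tau>' \<omega>)\<^sup>2) < e"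
        using a b by (simp add: power2_commute[of "Jp \<zeta> P P _"])
    qed (rule \<delta>(1))
  qed
  then show ?thesis using eta unfolding iter_strat2_def strat_eq by blast
qed

text \<open>The limit \<open>J\<close> is reached through one partition that is fine enough both for
  \<open>J\<close> and for the comparison with partial sums; it stays fixed while \<open>p1\<close>
  and \<open>p2\<close> vary.\<close>

lemma expansion_converges:
  assumes J: "iter_strat2 M (wproc f i1) (wproc f i2) \<psi>1 \<psi>2 t T \<eta> J"
    and z: "\<And>i j. i \<le> m \<Longrightarrow> ito_integral M (wproc f i) (\<phi> j) t T (\<zeta> i j)"
  shows "ms_tendsto M (\<lambda>(p1, p2). Jp \<zeta> p1 p2) J (sequentially \<times>\<^sub>F sequentially)"
proof -
  have eta: "inner_strat M (wproc f i1) \<psi>1 t T \<eta>" and JS: "ms_limit_mesh M t T (S \<eta>) J"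
    using J unfolding iter_strat2_def strat_eq by auto
  have zeta: "wint M (wproc f i1) t T (\<phi> j) (\<zeta> i1 j)" "wint M (wproc f i2) t T (\<phi> j) (\<zeta> i2 j)" for j
    using i z by (auto intro!: ito_integral_wint(2)[OF fi W t0 tT _ phi_continuous])
  have lJ: "l2 M J" by (rule ms_limit_mesh_l2[OF JS])
  have lp: "l2 M (Jp \<zeta> p1 p2)" for p1 p2 by (rule Jp_l2[where \<zeta>=\<zeta>, OF zeta])
  have close: "\<exists>P. \<forall>p1 p2. P \<le> p1 \<and> P \<le> p2 \<longrightarrow> expectation (\<lambda>\<omega>. (Jp \<zeta> p1 p2 \<omega> - J \<omega>)\<^sup>2) < e" if e: "e > 0" for e
  proof -
    have e4: "e / 4 > 0" using e by simp
    from sums_close[where \<eta>=\<eta> and \<zeta>=\<zeta>, OF eta_wint[OF eta] zeta this]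
    obtain \<delta> P where \<delta>: "\<delta> > 0" "\<And>n \<tau> p1 p2. is_partition t T n \<tau> \<and> (\<forall>k<n. \<tau> (Suc k) - \<tau> k < \<delta>) \<and> P \<le> p1 \<and> P \<le> p2 \<longrightarrow>
       l2 M (S \<eta> n \<tau>) \<and> expectation (\<lambda>\<omega>. (S \<eta> n \<tau> \<omega> - Jp \<zeta> p1 p2 \<omega>)\<^sup>2) < e / 4"
      by blast
    obtain \<delta>' where \<delta>': "\<delta>' > 0" "\<And>n \<tau>. is_partition t T n \<tau> \<Longrightarrow> (\<And>k. k < n \<Longrightarrow> \<tau> (Suc k) - \<tau> k < \<delta>') \<Longrightarrow>
       l2 M (S \<eta> n \<tau>) \<and> expectation (\<lambda>\<omega>. (S \<eta> n \<tau> \<omega> - J \<omega>)\<^sup>2) < e / 4"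
      using ms_limit_meshD[OF JS e4] by blast
    have "min \<delta> \<delta>' > 0" using \<delta> \<delta>' by simp
    from ex_fine_partition[OF tT this] obtain n \<tau> where p: "is_partition t T n \<tau>" "\<forall>k<n. \<tau> (Suc k) - \<tau> k < min \<delta> \<delta>'" by blast
    have a: "l2 M (S \<eta> n \<tau>)" "expectation (\<lambda>\<omega>. (S \<eta> n \<tau> \<omega> - J \<omega>)\<^sup>2) < e / 4" using \<delta>'(2)[of n \<tau>] p by auto
    have "expectation (\<lambda>\<omega>. (Jp \<zeta> p1 p2 \<omega> - J \<omega>)\<^sup>2) < e" if "P \<le> p1" "P \<le> p2" for p1 p2
    proof -
      have "expectation (\<lambda>\<omega>. (S \<eta> n \<tau> \<omega> - Jp \<zeta> p1 p2 \<omega>)\<^sup>2) < e / 4" using \<delta>(2)[of n \<tau> p1 p2] p that by auto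
      then show ?thesis using integral_square_triangle[OF lp[of p1 p2] a(1) lJ] a(2)
        by (simp add: power2_commute[of "Jp \<zeta> p1 p2 _" "S \<eta> n \<tau> _"])
    qed
    then show ?thesis by blast
  qed
  have lim: "((\<lambda>p. expectation (\<lambda>\<omega>. (Jp \<zeta> (fst p) (snd p) \<omega> - J \<omega>)\<^sup>2)) \<longlongrightarrow> 0) (sequentially \<times>\<^sub>F sequentially)"
  proof (rule order_tendstoI)
    fix a :: real assume a: "a < 0"
    have "a < expectation (\<lambda>\<omega>. (Jp \<zeta> (fst p) (snd p) \<omega> - J \<omega>)\<^sup>2)" for p
      by (rule less_le_trans[OF a]) simp
    then show "\<forall>\<^sub>F p in sequentially \<times>\<^sub>F sequentially. a < expectation (\<lambda>\<omega>. (Jp \<zeta> (fst p) (snd p) \<omega> - J \<omega>)\<^sup>2)"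
      by simp
  next
    fix a :: real assume "0 < a"
    from close[OF this] obtain P where P: "\<And>p1 p2. P \<le> p1 \<Longrightarrow> P \<le> p2 \<Longrightarrow> expectation (\<lambda>\<omega>. (Jp \<zeta> p1 p2 \<omega> - J \<omega>)\<^sup>2) < a" by blast
    show "\<forall>\<^sub>F p in sequentially \<times>\<^sub>F sequentially. expectation (\<lambda>\<omega>. (Jp \<zeta> (fst p) (snd p) \<omega> - J \<omega>)\<^sup>2) < a"
      \<comment> \<open>The product filter asks for one eventual condition on each index; both times
        it is the same bound \<open>P\<close>.\<close>
      unfolding eventually_prod_filter
      by (intro exI[of _ "\<lambda>p. P \<le> p"] conjI eventually_ge_at_top allI impI) (use P in auto)
  qed
  show ?thesis
    unfolding ms_tendsto_def
    using lJ lp lim by (auto simp: l2_def case_prod_unfold)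
qed

end

lemma C2_on_imp_C1_on: "C2_on S g \<Longrightarrow> C1_on S g"
  unfolding C2_on_def C1_on_def by (metis DERIV_continuous_on)

text \<open>Mesh limits determine a variable only almost surely. Existence is therefore asserted
  apart from convergence, which is claimed for every choice of versions and could otherwise hold
  vacuously.\<close>

theorem theorem2:
  fixes M :: "'a measure" and F :: "real \<Rightarrow> 'a set set" and m :: nat
    and f :: "nat \<Rightarrow> real \<Rightarrow> 'a \<Rightarrow> real"
    and t T :: real and \<phi> :: "nat \<Rightarrow> real \<Rightarrow> real"
    and \<psi>1 \<psi>2 :: "real \<Rightarrow> real" and i1 i2 :: nat
  assumes "complete_prob_space M" and "rc_filtration M F"
    and "wiener_process_m M F m f"
    and "0 \<le> t" and "t < T"
    and "\<phi> = phi_legendre t T \<or> \<phi> = phi_trig t T"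
    and "C1_on {t..T} \<psi>2" and "C2_on {t..T} \<psi>1"
    and "i1 \<le> m" and "i2 \<le> m"
  shows
    "(\<forall>i\<le>m. \<forall>j. \<exists>z. ito_integral M (wproc f i) (\<phi> j) t T z) \<and>
     (\<exists>\<eta> J. iter_strat2 M (wproc f i1) (wproc f i2) \<psi>1 \<psi>2 t T \<eta> J) \<and>
     (\<forall>\<eta>. inner_strat M (wproc f i1) \<psi>1 t T \<eta> \<longrightarrow>
        (\<exists>J. iter_strat2 M (wproc f i1) (wproc f i2) \<psi>1 \<psi>2 t T \<eta> J)) \<and>
     (\<forall>\<eta> J \<zeta>. iter_strat2 M (wproc f i1) (wproc f i2) \<psi>1 \<psi>2 t T \<eta> J \<and>
        (\<forall>i\<le>m. \<forall>j. ito_integral M (wproc f i) (\<phi> j) t T (\<zeta> i j)) \<longrightarrow>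
        ms_tendsto M
          (\<lambda>(p1, p2) \<omega>. \<Sum>j1\<le>p1. \<Sum>j2\<le>p2.
              coefC \<psi>1 \<psi>2 \<phi> t T j2 j1 * \<zeta> i1 j1 \<omega> * \<zeta> i2 j2 \<omega>)
          J (sequentially \<times>\<^sub>F sequentially))"
proof -
  interpret prob_space M using assms(1) by (simp add: complete_prob_space_def)
  have "onb t T \<phi>" using assms(5,6) onb_legendre onb_trig by blast
  then interpret strat_setting M F m f t T \<phi> \<psi>1 \<psi>2 i1 i2
    using assms by unfold_locales (auto intro: C2_on_imp_C1_on)
  have "(\<lambda>(p1, p2) \<omega>. \<Sum>j1\<le>p1. \<Sum>j2\<le>p2. coefC \<psi>1 \<psi>2 \<phi> t T j2 j1 * \<zeta> i1 j1 \<omega> * \<zeta> i2 j2 \<omega>) = (\<lambda>(p1, p2). Jp \<zeta> p1 p2)" for \<zeta>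
    by (simp add: Jp_def[abs_def] C_def)
  then show ?thesis
    using ito_exists inner_exists outer_exists expansion_converges by simp blast
qed

end
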